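(* Let $\mathcal{S}$ be a polytopal cut and project scheme (possibly with a polytopal labelling partition of its window). Then its complexity function satisfies $p(r)\asymp r^\alpha$, where $$\alpha=\max_{f\in\mathscr{F}_0}\alpha_f,\qquad \alpha_f=\sum_{V\in f}\alpha_V,\qquad \alpha_V=d-\mathrm{rk}(V)+\beta_V,\qquad \beta_V=\dim\langle\Gamma^V_<\rangle_{\mathbb{R}}.$$
   Context: SCHEMES. A ($k$-to-$d$) polytopal cut and project scheme $\mathcal{S}$ consists of a $k$-dimensional real vector space $\mathbb{E}$, complementary subspaces $\mathbb{E}_\vee$ (physical space, dimension $d\ge 1$) and $\mathbb{E}_<$ (internal space, dimension $n=k-d\ge 1$) with $\mathbb{E}=\mathbb{E}_\vee\oplus\mathbb{E}_<$, a lattice $\Gamma<\mathbb{E}$ and a (non-empty) polytopal window $W\subset\mathbb{E}_<$. The projections to $\mathbb{E}_\vee,\mathbb{E}_<$ are written $x\mapsto x_\vee$, $x\mapsto x_<$ (also for subsets). A set $W$ is polytopal if it is compact, the closure of its interior, and $\partial W$ is contained in the union of a finite set $\mathscr{H}$ of properly supporting hyperplanes (affine, codimension 1); $H$ is properly supporting if there are $w_H\in H$, an open neighbourhood $U_H$ of $w_H$ and a closed half-space $H^+$ of $H$ with $W\cap U_H=H^+\cap U_H$. (Equivalently $W$ is a finite union of convex polytopes with non-empty interior; $\mathscr H$ is then exactly the set of properly supporting hyperplanes.) The window may carry a labelling $W=\bigcup_i W_i$ with each $W_i$ polytopal and distinct $W_i$ meeting at most on their boundaries; then $\mathscr{H}$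 denotes the union of the sets of supporting hyperplanes of the $W_i$. For $H\in\mathscr H$, $V(H)=H-H$; $\mathscr{H}_0=\{V(H): H\in\mathscr{H}\}$. Standing assumptions: both projections are injective on $\Gamma$; $\Gamma_<$ is dense in $\mathbb{E}_<$; the scheme is non-singular, i.e. $\gamma_<\notin\partial W$ (resp. $\notin\partial W_i$ for all $i$) for all $\gamma\in\Gamma$. For $x=\gamma_\vee\in\Gamma_\vee$ put $x^\star=\gamma_<$. The cut and project set is $\Lambda=\{x\in\Gamma_\vee: x^\star\in W\}$, where $x$ has label $i$ if $x^\star\in W_i$ in the labelled case. COMPLEXITY. Fix a norm on $\mathbb{E}_\vee$. For $x\in\Lambda$ the $r$-patch $P_r(x)$ is $\Lambda\cap B_r(x)$ (closed ball, with labels) with marked centre $x$; $r$-patches are identified if they agree up to a translation taking centre to centre. $p(r)$ is the number of distinct $r$-patches. $p(r)\asymp r^\alpha$ means there are $c,C>0$ with $cr^\alpha\le p(r)\le Cr^\alpha$ for all sufficiently large $r$. FLAGS AND STABILISERS. $\mathscr{F}_0$ is the set of $f\subseteq\mathscr{H}_0$ with exactly $n$ elements and $\bigcap_{V\in f}V=\{0\}$. For $V\in\mathscr{H}_0$, $\Gamma^V=\{\gamma\in\Gamma:\gamma_<\in V\}$, $\mathrm{rk}(V)=\mathrm{rk}(\Gamma^V)$ (rank as a free Abelian group), and $\langle\Gamma^V_<\rangle_{\mathbb{R}}$ is the real span of $\{\gamma_<:\gamma\in\Gamma^V\}$. *)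

theory Defs
  imports "HOL-Analysis.Analysis"
begin

section \<open>Decompositions and lattices\<close>

text \<open>
  The total space is an arbitrary Euclidean space; it merely supplies a finite-dimensional real
  vector space with its topology. The inner product is only used to write down linear functionals.
\<close>

definition complementary :: "'a::real_vector set \<Rightarrow> 'a set \<Rightarrow> bool" where
  "complementary P Q \<longleftrightarrow>
     subspace P \<and> subspace Q \<and> P \<inter> Q = {0} \<and> (\<forall>x. \<exists>p\<in>P. \<exists>q\<in>Q. x = p + q)"

text \<open>The projection onto \<open>P\<close> along \<open>Q\<close>.\<close>

definition proj :: "'a::real_vector set \<Rightarrow> 'a set \<Rightarrow> 'a \<Rightarrow> 'a" where
  "proj P Q x = (THE p. p \<in> P \<and> x - p \<in> Q)"

global_interpretation int_module: module "\<lambda>(m::int) (x::'a::real_vector). of_int m *\<^sub>R x"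
  by unfold_locales (simp_all add: algebra_simps)

definition is_full_lattice :: "'a::real_vector set \<Rightarrow> bool" where
  "is_full_lattice \<Gamma> \<longleftrightarrow> (\<exists>B. independent B \<and> span B = UNIV \<and> \<Gamma> = int_module.span B)"

text \<open>Rank of a finitely generated free Abelian group: the cardinality of any of its bases.\<close>

definition free_rank :: "'a::real_vector set \<Rightarrow> nat" where
  "free_rank G =
     (THE m. \<exists>B. finite B \<and> card B = m \<and> int_module.independent B \<and> int_module.span B = G)"

section \<open>Polytopal sets\<close>

text \<open>
  Throughout, \<open>F\<close> is the internal space, a linear subspace, and interior, boundary, hyperplanes
  and half-spaces are taken relative to \<open>F\<close>. Replacing \<open>(a, b)\<close> by \<open>(-a, -b)\<close> exchanges the two
  half-spaces of a hyperplane.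
\<close>

definition hyperplane :: "'a::euclidean_space set \<Rightarrow> 'a \<Rightarrow> real \<Rightarrow> 'a set" where
  "hyperplane F a b = {x \<in> F. a \<bullet> x = b}"

definition halfspace :: "'a::euclidean_space set \<Rightarrow> 'a \<Rightarrow> real \<Rightarrow> 'a set" where
  "halfspace F a b = {x \<in> F. a \<bullet> x \<le> b}"

definition properly_supporting :: "'a::euclidean_space set \<Rightarrow> 'a set \<Rightarrow> 'a set \<Rightarrow> bool" where
  "properly_supporting F W H \<longleftrightarrow>
     (\<exists>a b. a \<in> F \<and> a \<noteq> 0 \<and> H = hyperplane F a b \<and>
        (\<exists>w\<in>H. \<exists>U. openin (top_of_set F) U \<and> w \<in> U \<and> W \<inter> U = halfspace F a b \<inter> U))"

definition polytopal :: "'a::euclidean_space set \<Rightarrow> 'a set \<Rightarrow> bool" where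
  "polytopal F W \<longleftrightarrow>
     W \<subseteq> F \<and> compact W \<and>
     W = top_of_set F closure_of (top_of_set F interior_of W) \<and>
     (\<exists>\<H>. finite \<H> \<and> (\<forall>H\<in>\<H>. properly_supporting F W H) \<and>
          top_of_set F frontier_of W \<subseteq> \<Union>\<H>)"

definition polytopal_labelling ::
  "'a::euclidean_space set \<Rightarrow> 'a set \<Rightarrow> 'l set \<Rightarrow> ('l \<Rightarrow> 'a set) \<Rightarrow> bool" where
  "polytopal_labelling F W I Wl \<longleftrightarrow>
     finite I \<and> W = (\<Union>i\<in>I. Wl i) \<and> (\<forall>i\<in>I. polytopal F (Wl i)) \<and>
     (\<forall>i\<in>I. \<forall>j\<in>I. i \<noteq> j \<longrightarrow>
        Wl i \<inter> Wl j \<subseteq> (top_of_set F frontier_of Wl i) \<inter> (top_of_set F frontier_of Wl j))"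

text \<open>
  For a polytopal set, the finite family of properly supporting hyperplanes covering the boundary
  necessarily consists of all properly supporting hyperplanes.
\<close>

definition supporting_hyperplanes ::
  "'a::euclidean_space set \<Rightarrow> 'l set \<Rightarrow> ('l \<Rightarrow> 'a set) \<Rightarrow> 'a set set" where
  "supporting_hyperplanes F I Wl = (\<Union>i\<in>I. {H. properly_supporting F (Wl i) H})"

text \<open>An unlabelled window is the same thing as a window with a single label.\<close>

lemma polytopal_labelling_single:
  "polytopal_labelling F W {l} (\<lambda>_. W) \<longleftrightarrow> polytopal F W"
  by (auto simp: polytopal_labelling_def)

lemma supporting_hyperplanes_single:
  "supporting_hyperplanes F {l} (\<lambda>_. W) = {H. properly_supporting F W H}"
  by (simp add: supporting_hyperplanes_def)

section \<open>Polytopal cut and project schemes\<close>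

text \<open>\<open>E\<close> is the physical space, \<open>F\<close> the internal space.\<close>

locale polytopal_scheme =
  fixes E F \<Gamma> W :: "'a::euclidean_space set"
    and I :: "'l set" and Wl :: "'l \<Rightarrow> 'a set"
  assumes complementary: "complementary E F"
    and dim_physical: "dim E \<ge> 1"
    and dim_internal: "dim F \<ge> 1"
    and lattice: "is_full_lattice \<Gamma>"
    and window: "polytopal F W" "W \<noteq> {}"
    and labelling: "polytopal_labelling F W I Wl"
    and inj_physical: "inj_on (proj E F) \<Gamma>"
    and inj_internal: "inj_on (proj F E) \<Gamma>"
    and dense: "top_of_set F closure_of (proj F E ` \<Gamma>) = F"
    and non_singular: "\<And>\<gamma> i. \<gamma> \<in> \<Gamma> \<Longrightarrow> i \<in> I \<Longrightarrow> proj F E \<gamma> \<notin> top_of_set F frontier_of Wl i"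

definition star :: "'a::real_vector set \<Rightarrow> 'a set \<Rightarrow> 'a set \<Rightarrow> 'a \<Rightarrow> 'a" where
  "star E F \<Gamma> x = proj F E (the_inv_into \<Gamma> (proj E F) x)"

definition cut_and_project_set :: "'a::real_vector set \<Rightarrow> 'a set \<Rightarrow> 'a set \<Rightarrow> 'a set \<Rightarrow> 'a set" where
  "cut_and_project_set E F \<Gamma> W = {x \<in> proj E F ` \<Gamma>. star E F \<Gamma> x \<in> W}"

section \<open>Complexity\<close>

definition norm_on :: "'a::real_vector set \<Rightarrow> ('a \<Rightarrow> real) \<Rightarrow> bool" where
  "norm_on E N \<longleftrightarrow>
     (\<forall>x\<in>E. N x \<ge> 0 \<and> (N x = 0 \<longleftrightarrow> x = 0)) \<and>
     (\<forall>x\<in>E. \<forall>c. N (c *\<^sub>R x) = \<bar>c\<bar> * N x) \<and>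
     (\<forall>x\<in>E. \<forall>y\<in>E. N (x + y) \<le> N x + N y)"

text \<open>A patch is recorded as the set of its points, each paired with its label.\<close>

definition patch ::
  "'a::real_vector set \<Rightarrow> 'a set \<Rightarrow> 'a set \<Rightarrow> 'a set \<Rightarrow> 'l set \<Rightarrow> ('l \<Rightarrow> 'a set) \<Rightarrow> ('a \<Rightarrow> real)
     \<Rightarrow> real \<Rightarrow> 'a \<Rightarrow> ('a \<times> 'l) set" where
  "patch E F \<Gamma> W I Wl N r x =
     {(y, i). y \<in> cut_and_project_set E F \<Gamma> W \<and> N (y - x) \<le> r \<and> i \<in> I \<and> star E F \<Gamma> y \<in> Wl i}"

definition patch_equiv ::
  "'a::real_vector set \<Rightarrow> 'a set \<Rightarrow> 'a set \<Rightarrow> 'a set \<Rightarrow> 'l set \<Rightarrow> ('l \<Rightarrow> 'a set) \<Rightarrow> ('a \<Rightarrow> real)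
     \<Rightarrow> real \<Rightarrow> ('a \<times> 'a) set" where
  "patch_equiv E F \<Gamma> W I Wl N r =
     {(x, x'). x \<in> cut_and_project_set E F \<Gamma> W \<and> x' \<in> cut_and_project_set E F \<Gamma> W \<and>
        (\<lambda>(y, i). (y + (x' - x), i)) ` patch E F \<Gamma> W I Wl N r x = patch E F \<Gamma> W I Wl N r x'}"

definition complexity ::
  "'a::real_vector set \<Rightarrow> 'a set \<Rightarrow> 'a set \<Rightarrow> 'a set \<Rightarrow> 'l set \<Rightarrow> ('l \<Rightarrow> 'a set) \<Rightarrow> ('a \<Rightarrow> real)
     \<Rightarrow> real \<Rightarrow> nat" where
  "complexity E F \<Gamma> W I Wl N r =
     card (cut_and_project_set E F \<Gamma> W // patch_equiv E F \<Gamma> W I Wl N r)"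

definition same_growth :: "(real \<Rightarrow> real) \<Rightarrow> (real \<Rightarrow> real) \<Rightarrow> bool" (infix "\<asymp>" 50) where
  "p \<asymp> q \<longleftrightarrow> (\<exists>c>0. \<exists>C>0. \<forall>\<^sub>F r in at_top. c * q r \<le> p r \<and> p r \<le> C * q r)"

section \<open>Flags and exponents\<close>

definition directions :: "'a::euclidean_space set \<Rightarrow> 'l set \<Rightarrow> ('l \<Rightarrow> 'a set) \<Rightarrow> 'a set set" where
  "directions F I Wl = (\<lambda>H. {x - y |x y. x \<in> H \<and> y \<in> H}) ` supporting_hyperplanes F I Wl"

definition flags :: "'a::euclidean_space set \<Rightarrow> 'l set \<Rightarrow> ('l \<Rightarrow> 'a set) \<Rightarrow> 'a set set set" where
  "flags F I Wl = {f. f \<subseteq> directions F I Wl \<and> card f = dim F \<and> \<Inter>f = {0}}"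

definition stabiliser :: "'a::real_vector set \<Rightarrow> 'a set \<Rightarrow> 'a set \<Rightarrow> 'a set \<Rightarrow> 'a set" where
  "stabiliser E F \<Gamma> V = {\<gamma> \<in> \<Gamma>. proj F E \<gamma> \<in> V}"

definition beta :: "'a::euclidean_space set \<Rightarrow> 'a set \<Rightarrow> 'a set \<Rightarrow> 'a set \<Rightarrow> nat" where
  "beta E F \<Gamma> V = dim (span (proj F E ` stabiliser E F \<Gamma> V))"

definition hyperplane_exponent ::
  "'a::euclidean_space set \<Rightarrow> 'a set \<Rightarrow> 'a set \<Rightarrow> 'a set \<Rightarrow> int" where
  "hyperplane_exponent E F \<Gamma> V =
     int (dim E) - int (free_rank (stabiliser E F \<Gamma> V)) + int (beta E F \<Gamma> V)"

definition flag_exponent ::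
  "'a::euclidean_space set \<Rightarrow> 'a set \<Rightarrow> 'a set \<Rightarrow> 'a set set \<Rightarrow> int" where
  "flag_exponent E F \<Gamma> f = (\<Sum>V\<in>f. hyperplane_exponent E F \<Gamma> V)"

definition complexity_exponent ::
  "'a::euclidean_space set \<Rightarrow> 'a set \<Rightarrow> 'a set \<Rightarrow> 'l set \<Rightarrow> ('l \<Rightarrow> 'a set) \<Rightarrow> int" where
  "complexity_exponent E F \<Gamma> I Wl = Max (flag_exponent E F \<Gamma> ` flags F I Wl)"

end

theory Submission
  imports Defs
begin

text \<open>The number of offsets of a direction is a quotient of two lattice counts, so each bound
  on it needs an upper bound for one lattice and a lower bound for the other; both counts have to be
  sharp up to constants. Codes are governed by bounded faces, cells by whole hyperplanes. The upper
  bound tolerates the excess, since extra walls only refine the cells. But non-singularity keeps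
  internal lattice points off the faces only: such a point may still lie on the prolongation of a
  face, so it is first perturbed into an open cell. The lower bound cannot use prolongations, so it
  stays in a ball where each chosen face fills its hyperplane. The set of all supporting hyperplanes
  is never shown to be finite. The upper bound uses a finite covering subfamily, the lower bound a
  single flag, and the maximum over flags exists because the exponents are integers in a bounded
  range.\<close>

text \<open>
  The \<open>r\<close>-patch of \<open>x\<close> records which translates \<open>W\<^sub>i - \<gamma>\<^sub><\<close>, with \<open>\<gamma>\<close> in the lattice
  and \<open>\<gamma>\<^sub>\<or>\<close> of norm at most \<open>r\<close>, contain \<open>x\<^sup>\<star>\<close>; only \<open>\<gamma>\<close> with bounded \<open>\<gamma>\<^sub><\<close> matter. The faces of
  these translates with direction \<open>V\<close> lie on hyperplanes parallel to \<open>V\<close>, one for each coset of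
  \<open>\<Gamma>\<^sup>V\<close> that is hit. A pigeonhole count shows that a lattice of rank \<open>m\<close> whose internal projection
  spans a space of dimension \<open>b\<close> has about \<open>r\<^bsup>m - b\<^esup>\<close> points of norm at most \<open>r\<close> with bounded internal
  projection; applied to \<open>\<Gamma>\<close> and to \<open>\<Gamma>\<^sup>V\<close>, it yields about \<open>r\<^bsup>d - rk V + \<beta>\<^sub>V\<^esup>\<close> such hyperplanes.
  For the upper bound, patches are constant on the cells of the arrangement, and a cell is determined,
  up to boundedly many choices, by one of its vertices, that is, by a flag and one hyperplane for
  each of its directions. For the lower bound, the faces belonging to a flag are moved close to a
  common interior point of the window, where they cut out a grid of boxes with distinct patches.
\<close>

section \<open>Lattices and their subgroups\<close>

lemma int_span_subset_span: "int_module.span B \<subseteq> span (B :: 'a::real_vector set)"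
  by (rule int_module.span_minimal)
     (auto simp: int_module.subspace_def span_base span_zero span_add span_scale)

lemma independent_imp_int_independent:
  fixes B :: "'a::real_vector set"
  assumes "finite B" "independent B"
  shows "int_module.independent B"
proof -
  have "\<forall>b\<in>B. u b = 0" if "(\<Sum>b\<in>B. of_int (u b) *\<^sub>R b) = 0" for u :: "'a \<Rightarrow> int"
    using independentD[OF assms(2,1) order_refl that] by simp
  then show ?thesis
    unfolding int_module.dependent_finite[OF assms(1)] by blast
qed

text \<open>Freeness over the integers would not be enough: the later counts bound integer
  coordinates by a norm, so the basis has to be independent over the reals. A basis of the part of
  \<open>G\<close> in the smaller span is extended by an element of \<open>G\<close> whose
  coordinate along the new vector is positive and minimal.\<close>

lemma int_subgroup_basis:
  fixes B :: "'a::real_vector set"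
  assumes "finite B" "independent B" "int_module.subspace G" "G \<subseteq> int_module.span B"
  shows "\<exists>B'. finite B' \<and> independent B' \<and> int_module.span B' = G"
  using assms
proof (induction B arbitrary: G rule: finite_induct)
  case empty
  then have "G = {0}"
    using int_module.subspace_0 by auto
  then show ?case
    by (intro exI[of _ "{}"]) (simp add: independent_empty)
next
  case (insert b B)
  have indB: "independent B" and b: "b \<notin> span B"
    using insert.prems(1) insert.hyps(2) by (auto simp: independent_insert)
  define G0 where "G0 = G \<inter> int_module.span B"
  have "int_module.subspace G0"
    unfolding G0_def using insert.prems(2) by (intro int_module.subspace_inter int_module.subspace_span)
  from insert.IH[OF indB this] obtain B0
    where B0: "finite B0" "independent B0" "int_module.span B0 = G0"
    unfolding G0_def by blast
  \<comment> \<open>The group of \<open>b\<close>-coordinates of \<open>G\<close>. The closure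
    property \<open>A_diff\<close> serves both to change signs and to divide with remainder.\<close>
  define A where "A = {n::int. \<exists>g\<in>G. g - of_int n *\<^sub>R b \<in> int_module.span B}"
  have A_diff: "n - k * m \<in> A" if n: "n \<in> A" and m: "m \<in> A" for n m k
  proof -
    obtain g h where g: "g \<in> G" "g - of_int n *\<^sub>R b \<in> int_module.span B"
      and h: "h \<in> G" "h - of_int m *\<^sub>R b \<in> int_module.span B"
      using n m unfolding A_def by blast
    have "(g - of_int n *\<^sub>R b) - of_int k *\<^sub>R (h - of_int m *\<^sub>R b) \<in> int_module.span B"
      by (rule int_module.span_diff[OF g(2) int_module.span_scale[OF h(2)]])
    moreover have "(g - of_int n *\<^sub>R b) - of_int k *\<^sub>R (h - of_int m *\<^sub>R b)
        = (g - of_int k *\<^sub>R h) - of_int (n - k * m) *\<^sub>R b"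
      by (simp add: algebra_simps)
    moreover have "g - of_int k *\<^sub>R h \<in> G"
      using g h insert.prems(2) int_module.subspace_diff int_module.subspace_scale by blast
    ultimately show ?thesis
      unfolding A_def by auto
  qed
  show ?case
  proof (cases "A \<subseteq> {0}")
    case True
    have "G \<subseteq> int_module.span B"
    proof
      fix g assume g: "g \<in> G"
      then obtain n where "g - of_int n *\<^sub>R b \<in> int_module.span B"
        using insert.prems(3) int_module.span_breakdown_eq by blast
      then show "g \<in> int_module.span B"
        using g True unfolding A_def by force
    qed
    then show ?thesis
      using B0 unfolding G0_def by blast
  next
    case False
    then obtain n where n: "n \<in> A" "n \<noteq> 0" by blast
    \<comment> \<open>Subtracting \<open>n\<close> twice yields \<open>- n\<close>, so a nonzero
      coordinate produces a positive one.\<close>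
    have "n - 1 * n - 1 * n \<in> A"
      using A_diff[OF A_diff[OF n(1) n(1), of 1] n(1), of 1] .
    then have "\<bar>n\<bar> \<in> A"
      using n by (cases "n > 0") auto
    then have ex: "\<exists>k. 0 < k \<and> int k \<in> A"
      using n by (intro exI[of _ "nat \<bar>n\<bar>"]) auto
    define m where "m = (LEAST k. 0 < k \<and> int k \<in> A)"
    have m: "0 < m" "int m \<in> A"
      using LeastI_ex[OF ex] unfolding m_def by auto
    have m_least: "m \<le> k" if "0 < k" "int k \<in> A" for k
      using that unfolding m_def by (auto intro: Least_le)
    obtain g where g: "g \<in> G" "g - of_int (int m) *\<^sub>R b \<in> int_module.span B"
      using m(2) unfolding A_def by blast
    have "g \<notin> span B0"
    proof
      assume "g \<in> span B0"
      moreover have "span B0 \<subseteq> span B"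
        using B0(3) int_span_subset_span[of B] int_module.span_superset[of B0] span_minimal[of B0 "span B"]
        unfolding G0_def by auto
      ultimately have "g - (g - of_int (int m) *\<^sub>R b) \<in> span B"
        using g(2) int_span_subset_span[of B] by (metis span_diff subsetD)
      then have "real m *\<^sub>R b \<in> span B"
        by simp
      from span_scale[OF this, of "inverse (real m)"] show False
        using m b by simp
    qed
    then have ind: "independent (insert g B0)"
      using B0 by (simp add: independent_insert)
    moreover have "int_module.span (insert g B0) = G"
    proof
      show "int_module.span (insert g B0) \<subseteq> G"
        using g B0 int_module.span_superset[of B0] insert.prems(2) unfolding G0_def
        by (intro int_module.span_minimal) auto
      show "G \<subseteq> int_module.span (insert g B0)"
      proof
        fix h assume h: "h \<in> G"
        then obtain n where n: "h - of_int n *\<^sub>R b \<in> int_module.span B"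
          using insert.prems(3) int_module.span_breakdown_eq by blast
        then have nA: "n \<in> A"
          using h unfolding A_def by blast
        \<comment> \<open>Division with remainder: the remainder is again a coordinate, so
          minimality of \<open>m\<close> forces it to vanish.\<close>
        define q where "q = n div int m"
        have "n - q * int m \<in> A"
          by (rule A_diff[OF nA m(2)])
        then have "n mod int m \<in> A"
          by (simp add: q_def minus_div_mult_eq_mod)
        moreover have "0 \<le> n mod int m" "n mod int m < int m"
          using m by auto
        ultimately have "n mod int m = 0"
          using m_least[of "nat (n mod int m)"] by (cases "n mod int m = 0") auto
        then have nq: "n = q * int m"
          using div_mult_mod_eq[of n "int m"] by (simp add: q_def)
        have "(h - of_int n *\<^sub>R b) - of_int q *\<^sub>R (g - of_int (int m) *\<^sub>R b) \<in> int_module.span B"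
          by (rule int_module.span_diff[OF n int_module.span_scale[OF g(2)]])
        also have "(h - of_int n *\<^sub>R b) - of_int q *\<^sub>R (g - of_int (int m) *\<^sub>R b) = h - of_int q *\<^sub>R g"
          by (simp add: nq algebra_simps)
        finally have "h - of_int q *\<^sub>R g \<in> G0"
          using h g insert.prems(2) int_module.subspace_diff int_module.subspace_scale
          unfolding G0_def by blast
        then show "h \<in> int_module.span (insert g B0)"
          unfolding int_module.span_breakdown_eq B0(3) by blast
      qed
    qed
    ultimately show ?thesis
      using B0 by blast
  qed
qed

text \<open>Modulo twice the group, sums over distinct subsets of a basis are distinct, and each is
  determined by the parities of its coordinates in the other basis.\<close>

lemma int_basis_card_le:
  fixes B C :: "'a::real_vector set"
  assumes fin: "finite B" "finite C" and ind: "int_module.independent B"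
    and eq: "int_module.span B = int_module.span C"
  shows "card B \<le> card C"
proof -
  have "\<exists>u. (\<Sum>b\<in>S. b) = (\<Sum>c\<in>C. of_int (u c) *\<^sub>R c)" if "S \<in> Pow B" for S
  proof -
    have "(\<Sum>b\<in>S. b) \<in> int_module.span B"
      using that by (intro int_module.span_sum int_module.span_base) auto
    then show ?thesis
      unfolding eq int_module.span_finite[OF fin(2)] by blast
  qed
  then obtain u :: "'a set \<Rightarrow> 'a \<Rightarrow> int"
    where u: "\<And>S. S \<in> Pow B \<Longrightarrow> (\<Sum>b\<in>S. b) = (\<Sum>c\<in>C. of_int (u S c) *\<^sub>R c)"
    by metis
  have "inj_on (\<lambda>S. {c\<in>C. odd (u S c)}) (Pow B)"
  proof (rule inj_onI)
    fix S S' assume S: "S \<in> Pow B" "S' \<in> Pow B" and "{c\<in>C. odd (u S c)} = {c\<in>C. odd (u S' c)}"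
    then have "\<And>c. c \<in> C \<Longrightarrow> even (u S c - u S' c)"
      by auto
    \<comment> \<open>Halving these coordinates shows that two subset sums of equal parity differ by
      twice an element of the group. Compared in the independent set \<open>B\<close>, the two
      indicator functions then differ by even numbers, hence not at all.\<close>
    then have par: "\<And>c. c \<in> C \<Longrightarrow> u S c - u S' c = 2 * ((u S c - u S' c) div 2)"
      by simp
    have "(\<Sum>c\<in>C. of_int ((u S c - u S' c) div 2) *\<^sub>R c) \<in> int_module.span B"
      unfolding eq by (intro int_module.span_sum int_module.span_scale int_module.span_base)
    then obtain v where v: "(\<Sum>c\<in>C. of_int ((u S c - u S' c) div 2) *\<^sub>R c) = (\<Sum>b\<in>B. of_int (v b) *\<^sub>R b)"
      unfolding int_module.span_finite[OF fin(1)] by blast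
    have ind_sum: "(\<Sum>b\<in>B. of_int (of_bool (b \<in> R)) *\<^sub>R b) = (\<Sum>b\<in>R. b)" if "R \<subseteq> B" for R
      using that fin(1) by (intro sum.mono_neutral_cong_right) auto
    have "(\<Sum>b\<in>S. b) - (\<Sum>b\<in>S'. b) = (\<Sum>c\<in>C. of_int (u S c - u S' c) *\<^sub>R c)"
      using S by (simp add: u algebra_simps sum_subtractf)
    also have "\<dots> = (\<Sum>c\<in>C. 2 *\<^sub>R (of_int ((u S c - u S' c) div 2) *\<^sub>R c))"
    proof (rule sum.cong)
      fix c assume c: "c \<in> C"
      show "of_int (u S c - u S' c) *\<^sub>R c = 2 *\<^sub>R (of_int ((u S c - u S' c) div 2) *\<^sub>R c)"
        by (subst par[OF c]) (simp del: of_int_diff)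
    qed simp
    also have "\<dots> = (\<Sum>b\<in>B. of_int (2 * v b) *\<^sub>R b)"
      unfolding scaleR_sum_right[symmetric] v by (simp add: scaleR_sum_right)
    finally have "(\<Sum>b\<in>B. of_int (of_bool (b \<in> S) - of_bool (b \<in> S') - 2 * v b) *\<^sub>R b) = 0"
      using S ind_sum[of S] ind_sum[of S'] by (simp add: algebra_simps sum_subtractf sum.distrib)
    from int_module.independentD[OF ind fin(1) order_refl this]
    have *: "of_bool (b \<in> S) - of_bool (b \<in> S') = 2 * v b" if "b \<in> B" for b
      using that by simp
    have "b \<in> S \<longleftrightarrow> b \<in> S'" if "b \<in> B" for b
    proof (rule ccontr)
      assume "\<not> (b \<in> S \<longleftrightarrow> b \<in> S')"
      then have "odd (of_bool (b \<in> S) - of_bool (b \<in> S') :: int)" by auto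
      then show False
        using *[OF that] by simp
    qed
    then show "S = S'"
      using S by blast
  qed
  then have "card (Pow B) \<le> card (Pow C)"
    using fin by (intro card_inj_on_le) auto
  then show ?thesis
    using fin by (simp add: card_Pow)
qed

text \<open>\<open>free_rank\<close> admits every basis over the integers, and such a basis is not
  known beforehand to be independent over the reals; the parity count compares it with
  \<open>B\<close> in both directions.\<close>

lemma free_rank_eq_card:
  fixes B :: "'a::real_vector set"
  assumes "finite B" "independent B"
  shows "free_rank (int_module.span B) = card B"
  unfolding free_rank_def
proof (rule the_equality)
  have ind: "int_module.independent B"
    using assms by (rule independent_imp_int_independent)
  show "\<exists>B'. finite B' \<and> card B' = card B \<and> int_module.independent B' \<and>
      int_module.span B' = int_module.span B"
    using assms ind by blast
  fix m assume "\<exists>B'. finite B' \<and> card B' = m \<and> int_module.independent B' \<and>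
      int_module.span B' = int_module.span B"
  then show "m = card B"
    using int_basis_card_le assms(1) ind by (metis le_antisym)
qed

section \<open>Counting lattice points in slabs\<close>

lemma card_le_card_image_times:
  assumes "finite A" and "\<And>y. y \<in> f ` A \<Longrightarrow> card {x \<in> A. f x = y} \<le> K"
  shows "card A \<le> card (f ` A) * K"
proof -
  have "A = (\<Union>y\<in>f ` A. {x \<in> A. f x = y})" by blast
  then have "card A \<le> (\<Sum>y\<in>f ` A. card {x \<in> A. f x = y})"
    using card_UN_le[of "f ` A" "\<lambda>y. {x \<in> A. f x = y}"] assms(1) by simp
  also have "\<dots> \<le> card (f ` A) * K"
    using sum_bounded_above[of "f ` A" "\<lambda>y. card {x \<in> A. f x = y}" K] assms(2) by simp
  finally show ?thesis .
qed

text \<open>Each coordinate extends to a linear functional on the whole space, which is bounded in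
  finite dimension.\<close>

lemma coordinate_bound:
  fixes B :: "'a::euclidean_space set"
  assumes "finite B" "independent B"
  obtains C where "C > 0" "\<And>u b. b \<in> B \<Longrightarrow> \<bar>u b\<bar> \<le> C * norm (\<Sum>b\<in>B. u b *\<^sub>R b)"
proof -
  have "\<exists>K>0. \<forall>u. \<bar>u b\<bar> \<le> K * norm (\<Sum>b\<in>B. u b *\<^sub>R b)" if b: "b \<in> B" for b
  proof -
    obtain g :: "'a \<Rightarrow> real" where g: "linear g" "\<forall>x\<in>B. g x = of_bool (x = b)"
      using linear_independent_extend[OF assms(2), of "\<lambda>x. of_bool (x = b)"] by blast
    obtain K where K: "K > 0" "\<And>x. norm (g x) \<le> K * norm x"
      using linear_bounded_pos[OF g(1)] by blast
    have "g (\<Sum>b\<in>B. u b *\<^sub>R b) = u b" for u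
    proof -
      have "g (\<Sum>b\<in>B. u b *\<^sub>R b) = (\<Sum>x\<in>B. u x * of_bool (x = b))"
        using g by (simp add: linear_sum linear_scale)
      also have "\<dots> = u b"
        using b assms(1) by simp
      finally show ?thesis .
    qed
    then show ?thesis
      using K by (metis real_norm_def)
  qed
  then obtain K where K: "\<And>b. b \<in> B \<Longrightarrow> K b > 0"
    "\<And>b u. b \<in> B \<Longrightarrow> \<bar>u b\<bar> \<le> K b * norm (\<Sum>b\<in>B. u b *\<^sub>R b)"
    by metis
  show ?thesis
  \<comment> \<open>The summand \<open>1\<close> keeps the constant positive when \<open>B\<close>
    is empty.\<close>
  proof (rule that[of "1 + (\<Sum>b\<in>B. K b)"])
    show "1 + (\<Sum>b\<in>B. K b) > 0"
      using K(1) by (simp add: add_pos_nonneg sum_nonneg less_imp_le)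
    fix u b assume b: "b \<in> B"
    have "K b \<le> (\<Sum>b\<in>B. K b)"
      using b K(1) assms(1) by (intro member_le_sum) (auto simp: less_imp_le)
    then have "K b * norm (\<Sum>b\<in>B. u b *\<^sub>R b) \<le> (1 + (\<Sum>b\<in>B. K b)) * norm (\<Sum>b\<in>B. u b *\<^sub>R b)"
      by (intro mult_right_mono) auto
    then show "\<bar>u b\<bar> \<le> (1 + (\<Sum>b\<in>B. K b)) * norm (\<Sum>b\<in>B. u b *\<^sub>R b)"
      using K(2)[OF b, of u] by linarith
  qed
qed

lemma card_int_box: "real (card {- \<lfloor>x\<rfloor>..\<lfloor>x\<rfloor>}) = 2 * real_of_int \<lfloor>x\<rfloor> + 1" if "x \<ge> 0" for x :: real
  using that by simp

text \<open>A negative \<open>x\<close> may round down past \<open>- \<lfloor>y\<rfloor>\<close>,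
  but by no more than one.\<close>

lemma floor_mem_int_box: "\<lfloor>x\<rfloor> \<in> {- \<lfloor>y + 1\<rfloor>..\<lfloor>y + 1\<rfloor>}" if "\<bar>x\<bar> \<le> y" for x y :: real
  using that unfolding atLeastAtMost_iff by linarith

lemma lattice_ball_card_le:
  fixes B :: "'a::euclidean_space set"
  assumes "finite B" "independent B"
  obtains C where "C > 0"
    "\<And>r. r \<ge> 1 \<Longrightarrow> finite {g \<in> int_module.span B. norm g \<le> r}"
    "\<And>r. r \<ge> 1 \<Longrightarrow> real (card {g \<in> int_module.span B. norm g \<le> r}) \<le> C * r ^ card B"
proof -
  obtain K where K: "K > 0" "\<And>u b. b \<in> B \<Longrightarrow> \<bar>u b\<bar> \<le> K * norm (\<Sum>b\<in>B. u b *\<^sub>R b)"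
    using coordinate_bound[OF assms] by blast
  have *: "finite {g \<in> int_module.span B. norm g \<le> r} \<and>
      real (card {g \<in> int_module.span B. norm g \<le> r}) \<le> (2 * K + 1) ^ card B * r ^ card B"
    if r: "r \<ge> 1" for r
  proof -
    define P where "P = (PiE B (\<lambda>_. {- \<lfloor>K * r\<rfloor>..\<lfloor>K * r\<rfloor>}))"
    have finP: "finite P"
      unfolding P_def using assms(1) by (intro finite_PiE) auto
    have sub: "{g \<in> int_module.span B. norm g \<le> r} \<subseteq> (\<lambda>u. \<Sum>b\<in>B. of_int (u b) *\<^sub>R b) ` P"
    proof
      fix g assume "g \<in> {g \<in> int_module.span B. norm g \<le> r}"
      then obtain u where u: "g = (\<Sum>b\<in>B. of_int (u b) *\<^sub>R b)" and g: "norm g \<le> r"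
        unfolding int_module.span_finite[OF assms(1)] by blast
      have "u b \<in> {- \<lfloor>K * r\<rfloor>..\<lfloor>K * r\<rfloor>}" if "b \<in> B" for b
      proof -
        have "\<bar>real_of_int (u b)\<bar> \<le> K * norm g"
          using K(2)[OF that, of "\<lambda>b. real_of_int (u b)"] u by simp
        also have "\<dots> \<le> K * r"
          using g K(1) by simp
        finally have "of_int \<bar>u b\<bar> \<le> K * r" by simp
        then show ?thesis by (auto simp: le_floor_iff abs_le_iff minus_le_iff)
      qed
      then have "restrict u B \<in> P"
        unfolding P_def by auto
      then show "g \<in> (\<lambda>u. \<Sum>b\<in>B. of_int (u b) *\<^sub>R b) ` P"
        using u by (intro image_eqI[of _ _ "restrict u B"]) auto
    qed
    have "card {g \<in> int_module.span B. norm g \<le> r} \<le> card P"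
      using finP sub by (rule surj_card_le)
    moreover have "real (card P) = (2 * real_of_int \<lfloor>K * r\<rfloor> + 1) ^ card B"
      unfolding P_def using K(1) r card_int_box[of "K * r"] assms(1)
      by (simp add: card_PiE del: card_atLeastAtMost_int)
    moreover have "\<dots> \<le> ((2 * K + 1) * r) ^ card B"
    proof (rule power_mono)
      have "real_of_int \<lfloor>K * r\<rfloor> \<le> K * r" by simp
      then show "2 * real_of_int \<lfloor>K * r\<rfloor> + 1 \<le> (2 * K + 1) * r"
        using r distrib_right[of "2 * K" 1 r] by linarith
    qed (use K(1) r in simp)
    ultimately show ?thesis
      using finite_subset[OF sub] finP by (simp add: power_mult_distrib)
  qed
  show ?thesis
    by (rule that[of "(2 * K + 1) ^ card B"]) (use * K(1) in auto)
qed

text \<open>Coefficients of size at most \<open>r / K\<close> give vectors of norm at most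
  \<open>r\<close>, because \<open>K\<close> dominates the sum of the norms of the basis vectors.
  Finiteness is a premise because \<open>card\<close> of an infinite set is
  \<open>0\<close>.\<close>

lemma lattice_ball_card_ge:
  fixes B :: "'a::euclidean_space set"
  assumes "finite B" "independent B"
  obtains c where "c > 0"
    "\<And>r. r > 0 \<Longrightarrow> finite {g \<in> int_module.span B. norm g \<le> r} \<Longrightarrow>
       c * r ^ card B \<le> real (card {g \<in> int_module.span B. norm g \<le> r})"
proof -
  define K where "K = 1 + (\<Sum>b\<in>B. norm b)"
  have K: "K > 0"
    unfolding K_def by (simp add: add_pos_nonneg sum_nonneg)
  show ?thesis
  proof (rule that[of "(1 / K) ^ card B"])
    show "(1 / K) ^ card B > 0"
      using K by simp
    fix r :: real assume r: "r > 0" and fin: "finite {g \<in> int_module.span B. norm g \<le> r}"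
    define P where "P = (PiE B (\<lambda>_. {- \<lfloor>r / K\<rfloor>..\<lfloor>r / K\<rfloor>}))"
    define f where "f = (\<lambda>u::'a \<Rightarrow> int. \<Sum>b\<in>B. of_int (u b) *\<^sub>R b)"
    have "inj_on f P"
    proof (rule inj_onI)
      fix u v assume uv: "u \<in> P" "v \<in> P" "f u = f v"
      then have "(\<Sum>b\<in>B. (of_int (u b) - of_int (v b)) *\<^sub>R b) = 0"
        unfolding f_def by (simp add: algebra_simps sum_subtractf)
      from independentD[OF assms(2,1) order_refl this]
      have "u b = v b" if "b \<in> B" for b
        using that by simp
      then show "u = v"
        using uv unfolding P_def by (intro PiE_ext) auto
    qed
    moreover have "f ` P \<subseteq> {g \<in> int_module.span B. norm g \<le> r}"
    proof
      fix g assume "g \<in> f ` P"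
      then obtain u where u: "u \<in> P" "g = f u" by blast
      have "norm (of_int (u b) *\<^sub>R b) \<le> r / K * norm b" if "b \<in> B" for b
      proof -
        have "u b \<in> {- \<lfloor>r / K\<rfloor>..\<lfloor>r / K\<rfloor>}"
          using u(1) that unfolding P_def by auto
        then have "\<bar>u b\<bar> \<le> \<lfloor>r / K\<rfloor>" by auto
        then have "\<bar>real_of_int (u b)\<bar> \<le> r / K"
          by (simp add: le_floor_iff)
        then have "\<bar>real_of_int (u b)\<bar> * norm b \<le> r / K * norm b"
          by (rule mult_right_mono) simp
        then show ?thesis
          by simp
      qed
      then have "norm g \<le> (\<Sum>b\<in>B. r / K * norm b)"
        unfolding u(2) f_def by (rule sum_norm_le)
      also have "\<dots> = r / K * (K - 1)"
        unfolding K_def by (simp add: sum_distrib_left)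
      also have "\<dots> \<le> r"
        using K r by (simp add: field_simps)
      finally have "norm g \<le> r" .
      moreover have "g \<in> int_module.span B"
        unfolding u(2) f_def by (intro int_module.span_sum int_module.span_scale int_module.span_base)
      ultimately show "g \<in> {g \<in> int_module.span B. norm g \<le> r}" by blast
    qed
    ultimately have "card P \<le> card {g \<in> int_module.span B. norm g \<le> r}"
      using fin by (rule card_inj_on_le)
    moreover have "real (card P) = (2 * real_of_int \<lfloor>r / K\<rfloor> + 1) ^ card B"
      unfolding P_def using K r card_int_box[of "r / K"] assms(1)
      by (simp add: card_PiE del: card_atLeastAtMost_int)
    moreover have "(r / K) ^ card B \<le> (2 * real_of_int \<lfloor>r / K\<rfloor> + 1) ^ card B"
    proof (rule power_mono)
      have "r / K \<ge> 0" using r K by simp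
      then have "real_of_int \<lfloor>r / K\<rfloor> \<ge> 0" by simp
      then show "r / K \<le> 2 * real_of_int \<lfloor>r / K\<rfloor> + 1" by linarith
      show "0 \<le> r / K" using r K by simp
    qed
    ultimately show "(1 / K) ^ card B * r ^ card B \<le> real (card {g \<in> int_module.span B. norm g \<le> r})"
      by (simp add: power_divide)
  qed
qed

text \<open>For \<open>f = intl\<close> these are the lattice vectors with bounded internal part,
  which can be long in physical directions only.\<close>

definition slab :: "'a::real_normed_vector set \<Rightarrow> ('a \<Rightarrow> 'b::real_normed_vector) \<Rightarrow> real \<Rightarrow> real \<Rightarrow> 'a set" where
  "slab G f r c = {g \<in> G. norm g \<le> r \<and> norm (f g) \<le> c}"

text \<open>Pigeonhole on differences. The ball of radius \<open>r / 2\<close> in the lattice is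
  mapped by \<open>f\<close> into a region covered by about \<open>r ^ b\<close> cubes of fixed
  size, with \<open>b\<close> the dimension of the span of the image. Points in one cube differ by
  elements of the slab, so no cube receives more points than the slab has. The argument works
  although the image may be dense in its span.\<close>

lemma slab_card_ge:
  fixes B :: "'a::euclidean_space set" and f :: "'a \<Rightarrow> 'b::euclidean_space"
  assumes "finite B" "independent B" "linear f" "c > 0"
  obtains c1 where "c1 > 0"
    "\<And>r. r \<ge> 1 \<Longrightarrow> c1 * r powr (real (card B) - real (dim (f ` int_module.span B)))
        \<le> real (card (slab (int_module.span B) f r c))"
proof -
  let ?G = "int_module.span B"
  obtain C where C: "C > 0" "\<And>r. r \<ge> 1 \<Longrightarrow> finite {g \<in> ?G. norm g \<le> r}"
    "\<And>r. r \<ge> 1 \<Longrightarrow> real (card {g \<in> ?G. norm g \<le> r}) \<le> C * r ^ card B"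
    by (rule lattice_ball_card_le[OF assms(1,2)]) (erule that; blast)
  obtain c0 where c0: "c0 > 0" "\<And>r. r > 0 \<Longrightarrow> finite {g \<in> ?G. norm g \<le> r} \<Longrightarrow>
       c0 * r ^ card B \<le> real (card {g \<in> ?G. norm g \<le> r})"
    using lattice_ball_card_ge[OF assms(1,2)] by blast
  obtain O' where O: "O' \<subseteq> f ` ?G" "independent O'" "f ` ?G \<subseteq> span O'" "card O' = dim (f ` ?G)"
    by (rule basis_exists)
  have finO: "finite O'"
    using O(2) by (rule independent_imp_finite)
  obtain D where D: "D > 0" "\<And>u b. b \<in> O' \<Longrightarrow> \<bar>u b\<bar> \<le> D * norm (\<Sum>b\<in>O'. u b *\<^sub>R b)"
    using coordinate_bound[OF finO O(2)] by blast
  obtain P where P: "P > 0" "\<And>x. norm (f x) \<le> P * norm x"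
    using linear_bounded_pos[OF assms(3)] by blast
  \<comment> \<open>Side length of the cubes: a vector whose coordinates in \<open>O'\<close> are at
    most \<open>s\<close> in absolute value has norm at most \<open>c\<close>.\<close>
  define s where "s = c / (1 + (\<Sum>b\<in>O'. norm b))"
  have pos: "1 + (\<Sum>b\<in>O'. norm b) > 0"
    by (simp add: add_pos_nonneg sum_nonneg)
  then have s: "s > 0"
    using assms(4) unfolding s_def by simp
  define \<phi> where "\<phi> = (\<lambda>g b. representation O' (f g) b)"
  have rep: "(\<Sum>b\<in>O'. \<phi> g b *\<^sub>R b) = f g" if "g \<in> ?G" for g
    unfolding \<phi>_def using that O finO by (intro sum_representation_eq) auto
  have \<phi>_le: "\<bar>\<phi> g b\<bar> \<le> D * P * norm g" if "g \<in> ?G" "b \<in> O'" for g b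
  proof -
    have "\<bar>\<phi> g b\<bar> \<le> D * norm (f g)"
      using D(2)[OF that(2), of "\<phi> g"] rep[OF that(1)] by simp
    also have "\<dots> \<le> D * (P * norm g)"
      using D(1) P(2) by (intro mult_left_mono) auto
    finally show ?thesis by (simp add: mult.assoc)
  qed
  define cell where "cell = (\<lambda>g. restrict (\<lambda>b. \<lfloor>\<phi> g b / s\<rfloor>) O')"
  \<comment> \<open>\<open>Q * r\<close> bounds the number
    \<open>2 * \<lfloor>D * P * r / s + 1\<rfloor> + 1\<close> of cubes along one axis; the constant
    \<open>3\<close> is absorbed by \<open>r \<ge> 1\<close>.\<close>
  define Q where "Q = 2 * D * P / s + 3"
  have Q: "Q > 0"
    unfolding Q_def using D P s by (simp add: add_pos_pos)
  show ?thesis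
  proof (rule that[of "c0 * (1/2) ^ card B / Q ^ card O'"])
    show "0 < c0 * (1/2) ^ card B / Q ^ card O'"
      using c0(1) Q by simp
    fix r :: real assume r: "r \<ge> 1"
    \<comment> \<open>Half the radius, so that differences have norm at most
      \<open>r\<close>.\<close>
    define A where "A = {g \<in> ?G. norm g \<le> r / 2}"
    have finA: "finite A"
      by (rule finite_subset[OF _ C(2)[OF r]]) (use r in \<open>auto simp: A_def\<close>)
    have fin_slab: "finite (slab ?G f r c)"
      by (rule finite_subset[OF _ C(2)[OF r]]) (auto simp: slab_def)
    have A_ge: "c0 * (r / 2) ^ card B \<le> real (card A)"
      using c0(2)[of "r/2"] finA r unfolding A_def by simp
    have fib: "card {g \<in> A. cell g = y} \<le> card (slab ?G f r c)" if "y \<in> cell ` A" for y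
    proof -
      obtain g0 where g0: "g0 \<in> A" "y = cell g0"
        using \<open>y \<in> cell ` A\<close> by blast
      have "(\<lambda>g. g - g0) ` {g \<in> A. cell g = y} \<subseteq> slab ?G f r c"
      proof
        fix h assume "h \<in> (\<lambda>g. g - g0) ` {g \<in> A. cell g = y}"
        then obtain g where g: "g \<in> A" "cell g = cell g0" "h = g - g0" using g0 by blast
        have inG: "g \<in> ?G" "g0 \<in> ?G" using g g0 unfolding A_def by auto
        have "\<bar>\<phi> g b - \<phi> g0 b\<bar> \<le> s" if "b \<in> O'" for b
        proof -
          have "\<lfloor>\<phi> g b / s\<rfloor> = \<lfloor>\<phi> g0 b / s\<rfloor>"
            using fun_cong[OF g(2), of b] that unfolding cell_def by simp
          then have "\<bar>\<phi> g b / s - \<phi> g0 b / s\<bar> \<le> 1" by linarith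
          then have "\<bar>(\<phi> g b - \<phi> g0 b) / s\<bar> \<le> 1"
            by (simp add: diff_divide_distrib)
          then show ?thesis
            using s by (simp add: abs_divide field_simps)
        qed
        then have *: "norm ((\<phi> g b - \<phi> g0 b) *\<^sub>R b) \<le> s * norm b" if "b \<in> O'" for b
          using that by (simp add: mult_right_mono)
        have "f h = (\<Sum>b\<in>O'. (\<phi> g b - \<phi> g0 b) *\<^sub>R b)"
          using rep[OF inG(1)] rep[OF inG(2)] g(3) assms(3)
          by (simp add: linear_diff scaleR_left_diff_distrib sum_subtractf)
        then have "norm (f h) \<le> (\<Sum>b\<in>O'. s * norm b)"
          using sum_norm_le[of O' "\<lambda>b. (\<phi> g b - \<phi> g0 b) *\<^sub>R b", OF *] by simp
        also have "\<dots> \<le> s * (1 + (\<Sum>b\<in>O'. norm b))"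
          using s by (simp add: sum_distrib_left distrib_left)
        also have "\<dots> = c"
          unfolding s_def using pos by simp
        finally have "norm (f h) \<le> c" .
        moreover have "norm h \<le> r"
          using g g0 norm_triangle_ineq4[of g g0] unfolding A_def by auto
        moreover have "h \<in> ?G"
          using inG g(3) by (simp add: int_module.span_diff)
        ultimately show "h \<in> slab ?G f r c"
          unfolding slab_def by simp
      qed
      then show ?thesis
        using fin_slab by (intro card_inj_on_le[of "\<lambda>g. g - g0"]) auto
    qed
    define R where "R = PiE O' (\<lambda>_. {- \<lfloor>D * P * r / s + 1\<rfloor>..\<lfloor>D * P * r / s + 1\<rfloor>})"
    have "cell ` A \<subseteq> R"
    proof
      fix y assume "y \<in> cell ` A"
      then obtain g where g: "g \<in> A" "y = cell g" by blast
      have "\<lfloor>\<phi> g b / s\<rfloor> \<in> {- \<lfloor>D * P * r / s + 1\<rfloor>..\<lfloor>D * P * r / s + 1\<rfloor>}" if "b \<in> O'" for b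
      proof -
        have "\<bar>\<phi> g b\<bar> \<le> D * P * norm g"
          using \<phi>_le g(1) that unfolding A_def by blast
        also have "\<dots> \<le> D * P * r"
          using g(1) D P r unfolding A_def by (intro mult_left_mono) auto
        finally have "\<bar>\<phi> g b / s\<bar> \<le> D * P * r / s"
          using s by (simp add: abs_divide divide_right_mono)
        then show ?thesis by (rule floor_mem_int_box)
      qed
      then show "y \<in> R"
        unfolding R_def g(2) cell_def by auto
    qed
    moreover have finR: "finite R"
      unfolding R_def using finO by (intro finite_PiE) auto
    ultimately have "card (cell ` A) \<le> card R"
      by (intro card_mono)
    moreover have "real (card R) = (2 * real_of_int \<lfloor>D * P * r / s + 1\<rfloor> + 1) ^ card O'"
      unfolding R_def using D P s r card_int_box[of "D * P * r / s + 1"] finO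
      by (simp add: card_PiE del: card_atLeastAtMost_int floor_add floor_add_int floor_one)
    moreover have "\<dots> \<le> (Q * r) ^ card O'"
    proof (rule power_mono)
      have "real_of_int \<lfloor>D * P * r / s + 1\<rfloor> \<le> D * P * r / s + 1" by linarith
      moreover have "Q * r = 2 * (D * P * r / s) + 3 * r"
        unfolding Q_def by (simp add: algebra_simps)
      ultimately show "2 * real_of_int \<lfloor>D * P * r / s + 1\<rfloor> + 1 \<le> Q * r"
        using r by linarith
      have "0 \<le> D * P * r / s + 1"
        using D P s r by simp
      then have "0 \<le> real_of_int \<lfloor>D * P * r / s + 1\<rfloor>"
        by (simp only: zero_le_floor of_int_0_le_iff)
      then show "0 \<le> 2 * real_of_int \<lfloor>D * P * r / s + 1\<rfloor> + 1"
        by linarith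
    qed
    ultimately have cellle: "real (card (cell ` A)) \<le> (Q * r) ^ card O'"
      by linarith
    have "card A \<le> card (cell ` A) * card (slab ?G f r c)"
      using finA fib by (rule card_le_card_image_times)
    then have "real (card A) \<le> real (card (cell ` A)) * real (card (slab ?G f r c))"
      by (metis of_nat_le_iff of_nat_mult)
    also have "\<dots> \<le> (Q * r) ^ card O' * real (card (slab ?G f r c))"
      using cellle by (intro mult_right_mono) auto
    finally have "c0 * (r / 2) ^ card B \<le> (Q * r) ^ card O' * real (card (slab ?G f r c))"
      using A_ge by linarith
    then have "c0 * (1/2) ^ card B / Q ^ card O' * (r ^ card B / r ^ card O')
        \<le> real (card (slab ?G f r c))"
      using Q r by (simp add: field_simps power_mult_distrib)
    moreover have "r ^ card B / r ^ card O' = r powr (real (card B) - real (dim (f ` ?G)))"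
      using r O(4) by (simp add: powr_diff powr_realpow)
    ultimately show "c0 * (1/2) ^ card B / Q ^ card O' * r powr (real (card B) - real (dim (f ` ?G)))
        \<le> real (card (slab ?G f r c))"
      by simp
  qed
qed

text \<open>Translates of the slab fill a ball. Lattice vectors \<open>h v\<close> lifting a basis
  of the span of the image are added with coefficients from \<open>0\<close> to
  \<open>\<lfloor>r\<rfloor>\<close>. The resulting translates, at least \<open>r ^ b\<close> in
  number, lie in a ball of radius \<open>K * r\<close>, and each point is hit boundedly often
  because its \<open>f\<close>-value nearly determines the coefficients. Dividing the count of the
  ball by \<open>r ^ b\<close> gives the bound.\<close>

lemma slab_card_le:
  fixes B :: "'a::euclidean_space set" and f :: "'a \<Rightarrow> 'b::euclidean_space"
  assumes "finite B" "independent B" "linear f"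
  obtains c2 where "c2 > 0"
    "\<And>r. r \<ge> 1 \<Longrightarrow> finite (slab (int_module.span B) f r c)"
    "\<And>r. r \<ge> 1 \<Longrightarrow> real (card (slab (int_module.span B) f r c))
        \<le> c2 * r powr (real (card B) - real (dim (f ` int_module.span B)))"
proof -
  let ?G = "int_module.span B"
  obtain C where C: "C > 0" "\<And>r. r \<ge> 1 \<Longrightarrow> finite {g \<in> ?G. norm g \<le> r}"
    "\<And>r. r \<ge> 1 \<Longrightarrow> real (card {g \<in> ?G. norm g \<le> r}) \<le> C * r ^ card B"
    by (rule lattice_ball_card_le[OF assms(1,2)]) (erule that; blast)
  obtain O' where O: "O' \<subseteq> f ` ?G" "independent O'" "f ` ?G \<subseteq> span O'" "card O' = dim (f ` ?G)"
    by (rule basis_exists)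
  have finO: "finite O'"
    using O(2) by (rule independent_imp_finite)
  obtain D where D: "D > 0" "\<And>u b. b \<in> O' \<Longrightarrow> \<bar>u b\<bar> \<le> D * norm (\<Sum>b\<in>O'. u b *\<^sub>R b)"
    using coordinate_bound[OF finO O(2)] by blast
  have "\<forall>v\<in>O'. \<exists>g. g \<in> ?G \<and> f g = v"
    using O(1) by fast
  from bchoice[OF this] obtain h where h: "\<And>v. v \<in> O' \<Longrightarrow> h v \<in> ?G" "\<And>v. v \<in> O' \<Longrightarrow> f (h v) = v"
    by auto
  define K where "K = 1 + (\<Sum>v\<in>O'. norm (h v))"
  have K: "K \<ge> 1"
    unfolding K_def by (simp add: sum_nonneg)
  \<comment> \<open>Two representations of one point have slab parts whose \<open>f\<close>-values
    differ by at most \<open>2 * c\<close>, hence coefficients differing by at most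
    \<open>L\<close>.\<close>
  define L where "L = \<lfloor>D * (2 * c)\<rfloor>"
  define M where "M = nat (2 * L + 1) ^ card O'"
  have fin_slab: "finite (slab ?G f r c)" if "r \<ge> 1" for r
    by (rule finite_subset[OF _ C(2)[OF that]]) (auto simp: slab_def)
  \<comment> \<open>The factor is \<open>real M + 1\<close> and not \<open>real M\<close>, since a
    negative \<open>c\<close> can make \<open>M\<close> zero.\<close>
  show ?thesis
  proof (rule that[of "(real M + 1) * C * K ^ card B"])
    show "0 < (real M + 1) * C * K ^ card B"
      using C(1) K by (simp add: add_nonneg_pos)
    fix r :: real assume r: "r \<ge> 1"
    show "finite (slab ?G f r c)"
      using r by (rule fin_slab)
    define N where "N = PiE O' (\<lambda>_. {0..\<lfloor>r\<rfloor>})"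
    define F where "F = (\<lambda>(g, n). g + (\<Sum>v\<in>O'. of_int (n v :: int) *\<^sub>R h v))"
    have finN: "finite N"
      unfolding N_def using finO by (intro finite_PiE) auto
    have Kr: "K * r \<ge> 1"
      using K r by (metis mult_mono' mult_1 zero_le_one)
    have F_sub: "F ` (slab ?G f r c \<times> N) \<subseteq> {g \<in> ?G. norm g \<le> K * r}"
    proof (rule image_subsetI, clarify)
      fix g n assume g: "g \<in> slab ?G f r c" and n: "n \<in> N"
      have "norm (of_int (n v) *\<^sub>R h v) \<le> r * norm (h v)" if "v \<in> O'" for v
      proof -
        have "0 \<le> n v" "n v \<le> \<lfloor>r\<rfloor>" using n that unfolding N_def by auto
        then have "of_int (n v) \<le> r" by (simp add: le_floor_iff)
        then show ?thesis using \<open>0 \<le> n v\<close> by (simp add: mult_right_mono)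
      qed
      then have "norm (\<Sum>v\<in>O'. of_int (n v) *\<^sub>R h v) \<le> (\<Sum>v\<in>O'. r * norm (h v))"
        by (rule sum_norm_le)
      moreover have "norm g \<le> r"
        using g unfolding slab_def by simp
      ultimately have "norm (F (g, n)) \<le> r + (\<Sum>v\<in>O'. r * norm (h v))"
        unfolding F_def using norm_triangle_ineq[of g "\<Sum>v\<in>O'. of_int (n v) *\<^sub>R h v"] by simp
      also have "\<dots> = K * r"
        unfolding K_def by (simp add: algebra_simps sum_distrib_left)
      finally have "norm (F (g, n)) \<le> K * r" .
      moreover have "F (g, n) \<in> ?G"
        using g h(1) unfolding F_def slab_def
        by (auto intro!: int_module.span_add int_module.span_sum int_module.span_scale)
      ultimately show "F (g, n) \<in> ?G \<and> norm (F (g, n)) \<le> K * r"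
        by simp
    qed
    have fF: "f (F (g, n)) = f g + (\<Sum>v\<in>O'. of_int (n v) *\<^sub>R v)" for g n
      unfolding F_def using h(2) assms(3) by (simp add: linear_add linear_sum linear_scale)
    have fib: "card {x \<in> slab ?G f r c \<times> N. F x = y} \<le> M" if "y \<in> F ` (slab ?G f r c \<times> N)" for y
    proof -
      obtain g0 n0 where 0: "g0 \<in> slab ?G f r c" "n0 \<in> N" "y = F (g0, n0)"
        using \<open>y \<in> F ` (slab ?G f r c \<times> N)\<close> by blast
      define R where "R = PiE O' (\<lambda>v. {n0 v - L..n0 v + L})"
      have "card {x \<in> slab ?G f r c \<times> N. F x = y} \<le> card R"
      proof (rule card_inj_on_le[of snd])
        show "finite R"
          unfolding R_def using finO by (intro finite_PiE) auto
        \<comment> \<open>For a fixed value of \<open>F\<close> the coefficients determine the slab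
          point.\<close>
        show "inj_on snd {x \<in> slab ?G f r c \<times> N. F x = y}"
          by (rule inj_onI) (auto simp: F_def)
        show "snd ` {x \<in> slab ?G f r c \<times> N. F x = y} \<subseteq> R"
        proof (rule image_subsetI, clarify)
          fix g n assume g: "g \<in> slab ?G f r c" and n: "n \<in> N" and "y = F (g, n)"
          then have "f (F (g, n)) = f (F (g0, n0))" using 0 by simp
          then have "(\<Sum>v\<in>O'. (of_int (n v) - of_int (n0 v)) *\<^sub>R v) = f g0 - f g"
            unfolding fF by (simp add: algebra_simps sum_subtractf)
          moreover have "norm (f g0 - f g) \<le> 2 * c"
            using g 0(1) norm_triangle_ineq4[of "f g0" "f g"] unfolding slab_def by auto
          ultimately have *: "norm (\<Sum>v\<in>O'. (of_int (n v) - of_int (n0 v)) *\<^sub>R v) \<le> 2 * c"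
            by simp
          have "n v \<in> {n0 v - L..n0 v + L}" if "v \<in> O'" for v
          proof -
            have "\<bar>of_int (n v) - of_int (n0 v)\<bar>
                \<le> D * norm (\<Sum>v\<in>O'. (of_int (n v) - of_int (n0 v)) *\<^sub>R v)"
              by (rule D(2)[OF that])
            also have "\<dots> \<le> D * (2 * c)"
              by (rule mult_left_mono[OF *]) (use D(1) in simp)
            finally have "\<bar>real_of_int (n v) - real_of_int (n0 v)\<bar> \<le> D * (2 * c)" .
            then have "of_int \<bar>n v - n0 v\<bar> \<le> D * (2 * c)" by simp
            then have "\<bar>n v - n0 v\<bar> \<le> L"
              unfolding L_def by (simp only: le_floor_iff)
            then show ?thesis by auto
          qed
          then show "snd (g, n) \<in> R"
            using n unfolding R_def N_def by (auto simp: PiE_def)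
        qed
      qed
      also have "card R = M"
        unfolding R_def M_def using finO by (simp add: card_PiE)
      finally show ?thesis .
    qed
    have "card (slab ?G f r c \<times> N) \<le> card (F ` (slab ?G f r c \<times> N)) * M"
      by (rule card_le_card_image_times) (use fin_slab[OF r] finN fib in auto)
    also have "\<dots> \<le> card {g \<in> ?G. norm g \<le> K * r} * M"
      using card_mono[OF C(2)[OF Kr] F_sub] by simp
    finally have "real (card (slab ?G f r c)) * real (card N) \<le> real (card {g \<in> ?G. norm g \<le> K * r}) * real M"
      unfolding card_cartesian_product of_nat_mult[symmetric] of_nat_le_iff .
    also have "\<dots> \<le> (C * (K * r) ^ card B) * real M"
      using C(3)[OF Kr] by (intro mult_right_mono) auto
    also have "\<dots> \<le> (C * (K * r) ^ card B) * (real M + 1)"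
      using C(1) K r by (intro mult_left_mono) auto
    finally have 1: "real (card (slab ?G f r c)) * real (card N) \<le> (C * (K * r) ^ card B) * (real M + 1)" .
    have "real (card N) = (real_of_int \<lfloor>r\<rfloor> + 1) ^ card O'"
      unfolding N_def using finO r by (simp add: card_PiE)
    moreover have "r ^ card O' \<le> (real_of_int \<lfloor>r\<rfloor> + 1) ^ card O'"
      using r by (intro power_mono) linarith+
    ultimately have "real (card (slab ?G f r c)) * r ^ card O' \<le> real (card (slab ?G f r c)) * real (card N)"
      by (simp add: mult_left_mono)
    with 1 have "real (card (slab ?G f r c)) * r ^ card O' \<le> (C * (K * r) ^ card B) * (real M + 1)"
      by linarith
    then have "real (card (slab ?G f r c)) \<le> (real M + 1) * C * K ^ card B * (r ^ card B / r ^ card O')"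
      using r by (simp add: field_simps power_mult_distrib)
    moreover have "r ^ card B / r ^ card O' = r powr (real (card B) - real (dim (f ` ?G)))"
      using r O(4) by (simp add: powr_diff powr_realpow)
    ultimately show "real (card (slab ?G f r c))
        \<le> (real M + 1) * C * K ^ card B * r powr (real (card B) - real (dim (f ` ?G)))"
      by simp
  qed
qed

section \<open>Projections, norms and offsets of hyperplanes\<close>

lemma complementary_commute: "complementary P Q \<Longrightarrow> complementary Q P"
  unfolding complementary_def by (metis add.commute inf_commute)

lemma proj_eqI:
  assumes "complementary P Q" "p \<in> P" "x - p \<in> Q"
  shows "proj P Q x = p"
  unfolding proj_def
proof (rule the_equality)
  fix p' assume p': "p' \<in> P \<and> x - p' \<in> Q"
  have "subspace P" "subspace Q" "P \<inter> Q = {0}"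
    using assms(1) unfolding complementary_def by auto
  moreover have "p' - p = (x - p) - (x - p')" by simp
  ultimately have "p' - p \<in> P \<inter> Q"
    using assms(2,3) p' by (metis IntI subspace_diff)
  then show "p' = p"
    using \<open>P \<inter> Q = {0}\<close> by simp
qed (use assms in simp)

lemma
  assumes "complementary P Q"
  shows proj_in: "proj P Q x \<in> P" and proj_diff_in: "x - proj P Q x \<in> Q"
proof -
  obtain p q where "p \<in> P" "q \<in> Q" "x = p + q"
    using assms unfolding complementary_def by meson
  then have "proj P Q x = p" "x - p = q"
    using proj_eqI[OF assms, of p x] by simp_all
  then show "proj P Q x \<in> P" "x - proj P Q x \<in> Q"
    using \<open>p \<in> P\<close> \<open>q \<in> Q\<close> by auto
qed

lemma proj_add_proj:
  assumes "complementary P Q"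
  shows "proj P Q x + proj Q P x = x"
proof -
  have "proj Q P x = x - proj P Q x"
    by (rule proj_eqI[OF complementary_commute[OF assms]])
      (simp_all add: proj_in[OF assms] proj_diff_in[OF assms])
  then show ?thesis by simp
qed

lemma linear_proj:
  assumes "complementary P Q"
  shows "linear (proj P Q)"
proof (rule linearI)
  have sub: "subspace P" "subspace Q"
    using assms unfolding complementary_def by auto
  note in_Q = proj_diff_in[OF assms]
  show "proj P Q (x + y) = proj P Q x + proj P Q y" for x y
  proof (rule proj_eqI[OF assms])
    show "proj P Q x + proj P Q y \<in> P"
      using sub assms by (simp add: subspace_add proj_in)
    show "x + y - (proj P Q x + proj P Q y) \<in> Q"
      using subspace_add[OF sub(2) in_Q in_Q, of x y] by (simp add: algebra_simps)
  qed
  show "proj P Q (c *\<^sub>R x) = c *\<^sub>R proj P Q x" for c x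
  proof (rule proj_eqI[OF assms])
    show "c *\<^sub>R proj P Q x \<in> P"
      using sub assms by (simp add: subspace_scale proj_in)
    show "c *\<^sub>R x - c *\<^sub>R proj P Q x \<in> Q"
      using subspace_scale[OF sub(2) in_Q, of c x] by (simp add: algebra_simps)
  qed
qed

lemma proj_ident:
  assumes "complementary P Q" "p \<in> P"
  shows "proj P Q p = p"
  using assms by (intro proj_eqI) (auto simp: complementary_def subspace_0)

lemma range_proj:
  assumes "complementary P Q"
  shows "range (proj P Q) = P"
  using proj_in[OF assms] proj_ident[OF assms] by (metis image_subsetI rangeI subset_antisym subsetI)

lemma dim_complementary:
  fixes P Q :: "'a::euclidean_space set"
  assumes "complementary P Q"
  shows "dim P + dim Q = DIM('a)"
proof -
  have "dim {x + y |x y. x \<in> P \<and> y \<in> Q} + dim (P \<inter> Q) = dim P + dim Q"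
    using assms by (intro dim_sums_Int) (auto simp: complementary_def)
  moreover have "{x + y |x y. x \<in> P \<and> y \<in> Q} = UNIV"
    using assms unfolding complementary_def by blast
  moreover have "P \<inter> Q = {0}"
    using assms unfolding complementary_def by blast
  ultimately show ?thesis by simp
qed

section \<open>Norms on a subspace\<close>

lemma norm_on_zero: "norm_on E N \<Longrightarrow> subspace E \<Longrightarrow> N 0 = 0"
  using subspace_0 unfolding norm_on_def by blast

lemma norm_on_sum_le:
  assumes "norm_on E N" "subspace E" "finite B" "B \<subseteq> E"
  shows "N (\<Sum>b\<in>B. u b *\<^sub>R b) \<le> (\<Sum>b\<in>B. \<bar>u b\<bar> * N b)"
  using assms(3,4)
proof (induction rule: finite_induct)
  case empty
  then show ?case
    using norm_on_zero[OF assms(1,2)] by simp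
next
  case (insert b B)
  have "(\<Sum>b\<in>B. u b *\<^sub>R b) \<in> E" "b \<in> E"
    using insert.prems assms(2) by (auto intro!: subspace_sum subspace_scale)
  then have "N (u b *\<^sub>R b + (\<Sum>b\<in>B. u b *\<^sub>R b)) \<le> \<bar>u b\<bar> * N b + N (\<Sum>b\<in>B. u b *\<^sub>R b)"
    using assms(1,2) subspace_scale unfolding norm_on_def by metis
  then show ?case
    using insert by simp
qed

text \<open>\<open>N\<close> is a norm on \<open>E\<close> only and arbitrary elsewhere. On
  \<open>E\<close> it is Lipschitz, so it attains a positive minimum on the unit sphere of
  \<open>E\<close>; scaling gives the lower constant.\<close>

lemma norm_on_equivalent:
  fixes E :: "'a::euclidean_space set"
  assumes N: "norm_on E N" and E: "subspace E"
  shows "\<exists>c>0. \<exists>C>0. \<forall>x\<in>E. c * norm x \<le> N x \<and> N x \<le> C * norm x"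
proof -
  obtain B where B: "B \<subseteq> E" "independent B" "E \<subseteq> span B"
    by (rule maximal_independent_subset)
  have finB: "finite B"
    using B(2) by (rule independent_imp_finite)
  obtain D where D: "D > 0" "\<And>u b. b \<in> B \<Longrightarrow> \<bar>u b\<bar> \<le> D * norm (\<Sum>b\<in>B. u b *\<^sub>R b)"
    using coordinate_bound[OF finB B(2)] by blast
  define C where "C = 1 + (\<Sum>b\<in>B. D * N b)"
  have Nge: "N x \<ge> 0" if "x \<in> E" for x
    using that N unfolding norm_on_def by blast
  have C: "C > 0"
    unfolding C_def using D(1) B(1) Nge by (simp add: add_pos_nonneg subset_iff sum_nonneg)
  have up: "N x \<le> C * norm x" if x: "x \<in> E" for x
  proof -
    obtain u where u: "x = (\<Sum>b\<in>B. u b *\<^sub>R b)"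
      using x B(3) unfolding span_finite[OF finB] by blast
    have "N x \<le> (\<Sum>b\<in>B. \<bar>u b\<bar> * N b)"
      unfolding u by (rule norm_on_sum_le[OF N E finB B(1)])
    also have "\<dots> \<le> (\<Sum>b\<in>B. (D * norm x) * N b)"
      using D(2)[of _ u] Nge B(1) unfolding u by (intro sum_mono mult_right_mono) auto
    also have "\<dots> = (C - 1) * norm x"
      unfolding C_def by (simp add: sum_distrib_left sum_distrib_right algebra_simps)
    also have "\<dots> \<le> C * norm x"
      by (simp add: mult_right_mono)
    finally show ?thesis .
  qed
  have tri: "N x \<le> N y + N (x - y)" if "x \<in> E" "y \<in> E" for x y
  proof -
    have "N (y + (x - y)) \<le> N y + N (x - y)"
      using that N subspace_diff[OF E] unfolding norm_on_def by blast
    then show ?thesis by simp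
  qed
  have lip: "\<bar>N x - N y\<bar> \<le> C * norm (x - y)" if "x \<in> E" "y \<in> E" for x y
    using tri[OF that] tri[OF that(2,1)] up[of "x - y"] up[of "y - x"] subspace_diff[OF E] that
    by (force simp: norm_minus_commute abs_le_iff)
  have cont: "continuous_on (sphere 0 1 \<inter> E) N"
  proof (rule lipschitz_on_continuous_on)
    show "C-lipschitz_on (sphere 0 1 \<inter> E) N"
      using lip C by (intro lipschitz_onI) (auto simp: dist_norm)
  qed
  show ?thesis
  proof (cases "sphere 0 1 \<inter> E = {}")
    case True
    have "x = 0" if "x \<in> E" for x
    proof (rule ccontr)
      assume "x \<noteq> 0"
      then have "(1 / norm x) *\<^sub>R x \<in> sphere 0 1 \<inter> E"
        using that E by (simp add: subspace_scale)
      then show False using True by blast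
    qed
    then have "E = {0}"
      using subspace_0[OF E] by blast
    then show ?thesis
      using norm_on_zero[OF N E] gt_ex[of "0::real"] by auto
  next
    case False
    have "compact (sphere 0 1 \<inter> E)"
      by (intro compact_Int_closed compact_sphere closed_subspace E)
    then obtain x0 where x0: "x0 \<in> sphere 0 1 \<inter> E" "\<And>y. y \<in> sphere 0 1 \<inter> E \<Longrightarrow> N x0 \<le> N y"
      using continuous_attains_inf[OF _ False cont] by blast
    have "N x0 \<noteq> 0"
      using x0(1) N unfolding norm_on_def by fastforce
    then have pos: "N x0 > 0"
      using Nge[of x0] x0(1) by simp
    have low: "N x0 * norm x \<le> N x" if x: "x \<in> E" for x
    proof (cases "x = 0")
      case True
      then show ?thesis using Nge[OF x] by simp
    next
      case False
      have "(1 / norm x) *\<^sub>R x \<in> sphere 0 1 \<inter> E"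
        using False x E by (simp add: subspace_scale)
      then have "N x0 \<le> N ((1 / norm x) *\<^sub>R x)" by (rule x0(2))
      also have "\<dots> = \<bar>1 / norm x\<bar> * N x"
        using N x unfolding norm_on_def by blast
      finally show ?thesis
        using False by (simp add: field_simps)
    qed
    show ?thesis
      using pos C low up by blast
  qed
qed

section \<open>Lattice counts in a cut and project scheme\<close>

context polytopal_scheme
begin

abbreviation phys :: "'a \<Rightarrow> 'a" where "phys \<equiv> proj E F"
abbreviation intl :: "'a \<Rightarrow> 'a" where "intl \<equiv> proj F E"

lemma complementary': "complementary F E"
  using complementary by (rule complementary_commute)

lemma subspace_physical: "subspace E" and subspace_internal: "subspace F"
  using complementary unfolding complementary_def by auto

lemma phys_in: "phys x \<in> E" and intl_in: "intl x \<in> F"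
  using proj_in complementary complementary' by blast+

lemma linear_phys: "linear phys" and linear_intl: "linear intl"
  using linear_proj complementary complementary' by blast+

lemma lattice_basis:
  obtains B where "finite B" "independent B" "\<Gamma> = int_module.span B" "card B = DIM('a)" "span B = UNIV"
proof -
  obtain B where B: "independent B" "span B = UNIV" "\<Gamma> = int_module.span B"
    using lattice unfolding is_full_lattice_def by blast
  moreover have "card B = DIM('a)"
    using B dim_eq_card[of B UNIV] by (simp add: dim_UNIV)
  ultimately show ?thesis
    using that independent_imp_finite by blast
qed

lemma subspace_lattice: "int_module.subspace \<Gamma>"
  using lattice int_module.subspace_span unfolding is_full_lattice_def by auto

lemma lattice_add: "x \<in> \<Gamma> \<Longrightarrow> y \<in> \<Gamma> \<Longrightarrow> x + y \<in> \<Gamma>"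
  and lattice_diff: "x \<in> \<Gamma> \<Longrightarrow> y \<in> \<Gamma> \<Longrightarrow> x - y \<in> \<Gamma>"
  using subspace_lattice int_module.subspace_add int_module.subspace_diff by blast+

lemma stabiliser_basis:
  assumes "subspace V"
  obtains B where "finite B" "independent B" "stabiliser E F \<Gamma> V = int_module.span B"
    "card B = free_rank (stabiliser E F \<Gamma> V)"
proof -
  obtain B0 where B0: "finite B0" "independent B0" "\<Gamma> = int_module.span B0"
    by (rule lattice_basis)
  have "int_module.subspace (stabiliser E F \<Gamma> V)"
    using subspace_lattice assms linear_intl
    unfolding int_module.subspace_def stabiliser_def
    by (auto simp: linear_0 linear_add linear_scale subspace_0 subspace_add subspace_scale)
  moreover have "stabiliser E F \<Gamma> V \<subseteq> int_module.span B0"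
    unfolding stabiliser_def B0(3)[symmetric] by blast
  ultimately obtain B where "finite B" "independent B" "int_module.span B = stabiliser E F \<Gamma> V"
    using int_subgroup_basis[OF B0(1,2)] by blast
  then show ?thesis
    using that free_rank_eq_card by metis
qed

lemma dim_intl_lattice: "dim (intl ` \<Gamma>) = dim F"
proof -
  obtain B where B: "\<Gamma> = int_module.span B" "span B = UNIV"
    by (rule lattice_basis)
  have "span \<Gamma> = UNIV"
    using B span_mono[OF int_module.span_superset[of B]] by auto
  then have "span (intl ` \<Gamma>) = F"
    using linear_span_image[OF linear_intl] range_proj[OF complementary'] by simp
  then show ?thesis
    by (metis dim_span)
qed

text \<open>The rank of \<Gamma> is the dimension of the total space and its internal projection
  spans \<open>F\<close>, so the difference of the two is \<open>dim E\<close>.\<close>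

lemma slab_lattice_card:
  assumes "c > 0"
  shows "\<exists>c1>0. \<exists>c2>0. \<forall>r\<ge>1. finite (slab \<Gamma> intl r c) \<and>
    c1 * r powr real (dim E) \<le> real (card (slab \<Gamma> intl r c)) \<and>
    real (card (slab \<Gamma> intl r c)) \<le> c2 * r powr real (dim E)"
proof -
  obtain B where B: "finite B" "independent B" "\<Gamma> = int_module.span B" "card B = DIM('a)"
    by (rule lattice_basis)
  have e: "real (card B) - real (dim (intl ` \<Gamma>)) = real (dim E)"
    using B(4) dim_intl_lattice dim_complementary[OF complementary] by simp
  show ?thesis
    by (rule slab_card_ge[OF B(1,2) linear_intl assms], rule slab_card_le[OF B(1,2) linear_intl, of c])
      (unfold B(3)[symmetric] e, blast)
qed

lemma slab_stabiliser_card: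
  assumes "c > 0" "subspace V"
  shows "\<exists>c1>0. \<exists>c2>0. \<forall>r\<ge>1.
    c1 * r powr (real (free_rank (stabiliser E F \<Gamma> V)) - real (beta E F \<Gamma> V))
      \<le> real (card (slab (stabiliser E F \<Gamma> V) intl r c)) \<and>
    real (card (slab (stabiliser E F \<Gamma> V) intl r c))
      \<le> c2 * r powr (real (free_rank (stabiliser E F \<Gamma> V)) - real (beta E F \<Gamma> V))"
proof -
  obtain B where B: "finite B" "independent B" "stabiliser E F \<Gamma> V = int_module.span B"
    "card B = free_rank (stabiliser E F \<Gamma> V)"
    using assms(2) by (rule stabiliser_basis)
  have e: "dim (intl ` stabiliser E F \<Gamma> V) = beta E F \<Gamma> V"
    by (simp add: beta_def)
  show ?thesis
    by (rule slab_card_ge[OF B(1,2) linear_intl assms(1)], rule slab_card_le[OF B(1,2) linear_intl, of c])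
      (unfold B(3)[symmetric] B(4) e, blast)
qed

text \<open>Two lattice points have the same offset exactly if they differ by an element of the
  stabiliser of \<open>V\<close>. A level set, shifted by one of its points, falls into a stabiliser
  slab of twice the size, which gives the lower bound. Conversely, one representative per offset
  plus stabiliser points yields distinct points of a doubled slab of \<Gamma>, which gives the upper
  bound. The quotient of the two counts has the exponent of the hyperplane.\<close>

lemma offsets_card:
  assumes c: "c > 0" and V: "V = {x \<in> F. a \<bullet> x = 0}"
  shows "\<exists>c1>0. \<exists>c2>0. \<forall>r\<ge>1.
    c1 * r powr real_of_int (hyperplane_exponent E F \<Gamma> V)
      \<le> real (card ((\<lambda>\<gamma>. a \<bullet> intl \<gamma>) ` slab \<Gamma> intl r c)) \<and>
    real (card ((\<lambda>\<gamma>. a \<bullet> intl \<gamma>) ` slab \<Gamma> intl r c))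
      \<le> c2 * r powr real_of_int (hyperplane_exponent E F \<Gamma> V)"
proof -
  define G where "G = stabiliser E F \<Gamma> V"
  define e where "e = real (free_rank G) - real (beta E F \<Gamma> V)"
  define T where "T = (\<lambda>r. (\<lambda>\<gamma>. a \<bullet> intl \<gamma>) ` slab \<Gamma> intl r c)"
  have c2: "2 * c > 0"
    using c by simp
  have subV: "subspace V"
    unfolding V using subspace_internal
    by (auto simp: subspace_def inner_add_right)
  have exponent: "real_of_int (hyperplane_exponent E F \<Gamma> V) = real (dim E) - e"
    unfolding hyperplane_exponent_def e_def G_def by simp
  have G_iff: "g \<in> G \<longleftrightarrow> g \<in> \<Gamma> \<and> a \<bullet> intl g = 0" for g
    unfolding G_def stabiliser_def V using intl_in by auto
  obtain p1 where p: "p1 > 0" and "\<forall>r\<ge>1. finite (slab \<Gamma> intl r c) \<and>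
      p1 * r powr real (dim E) \<le> real (card (slab \<Gamma> intl r c))"
    using slab_lattice_card[OF c] by meson
  then have p': "finite (slab \<Gamma> intl r c)"
    "p1 * r powr real (dim E) \<le> real (card (slab \<Gamma> intl r c))" if "r \<ge> 1" for r
    using that by simp_all
  obtain q2 where q: "q2 > 0" and "\<forall>r\<ge>1. finite (slab \<Gamma> intl r (2 * c)) \<and>
      real (card (slab \<Gamma> intl r (2 * c))) \<le> q2 * r powr real (dim E)"
    using slab_lattice_card[OF c2] by meson
  then have q': "finite (slab \<Gamma> intl r (2 * c))"
    "real (card (slab \<Gamma> intl r (2 * c))) \<le> q2 * r powr real (dim E)" if "r \<ge> 1" for r
    using that by simp_all
  obtain s1 where s: "s1 > 0" "\<forall>r\<ge>1. s1 * r powr e \<le> real (card (slab G intl r c))"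
    using slab_stabiliser_card[OF c subV] unfolding e_def G_def by meson
  obtain t2 where t: "t2 > 0" "\<forall>r\<ge>1. real (card (slab G intl r (2 * c))) \<le> t2 * r powr e"
    using slab_stabiliser_card[OF c2 subV] unfolding e_def G_def by meson
  have low: "p1 / (t2 * 2 powr e) * r powr (real (dim E) - e) \<le> real (card (T r))" if r: "r \<ge> 1" for r
  proof -
    have "card (slab \<Gamma> intl r c) \<le> card (T r) * card (slab G intl (2 * r) (2 * c))"
      unfolding T_def
    proof (rule card_le_card_image_times[OF p'(1)[OF r]])
      fix y assume "y \<in> (\<lambda>\<gamma>. a \<bullet> intl \<gamma>) ` slab \<Gamma> intl r c"
      then obtain g0 where g0: "g0 \<in> slab \<Gamma> intl r c" "y = a \<bullet> intl g0" by blast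
      show "card {g \<in> slab \<Gamma> intl r c. a \<bullet> intl g = y} \<le> card (slab G intl (2 * r) (2 * c))"
      proof (rule card_inj_on_le[of "\<lambda>g. g - g0"])
        show "(\<lambda>g. g - g0) ` {g \<in> slab \<Gamma> intl r c. a \<bullet> intl g = y} \<subseteq> slab G intl (2 * r) (2 * c)"
        proof clarify
          fix g assume g: "g \<in> slab \<Gamma> intl r c" "y = a \<bullet> intl g"
          have "norm (g - g0) \<le> 2 * r"
            using g g0 norm_triangle_ineq4[of g g0] unfolding slab_def by auto
          moreover have "norm (intl (g - g0)) \<le> 2 * c"
            using g g0 norm_triangle_ineq4[of "intl g" "intl g0"] linear_intl
            unfolding slab_def by (auto simp: linear_diff)
          moreover have "g - g0 \<in> G"
            using g g0 linear_intl unfolding G_iff slab_def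
            by (auto simp: linear_diff inner_diff_right lattice_diff)
          ultimately show "g - g0 \<in> slab G intl (2 * r) (2 * c)"
            unfolding slab_def by blast
        qed
        have "slab G intl (2 * r) (2 * c) \<subseteq> slab \<Gamma> intl (2 * r) (2 * c)"
          unfolding slab_def using G_iff by blast
        then show "finite (slab G intl (2 * r) (2 * c))"
          using q'(1)[of "2 * r"] r by (auto intro: finite_subset)
      qed simp
    qed
    then have "real (card (slab \<Gamma> intl r c)) \<le> real (card (T r)) * real (card (slab G intl (2 * r) (2 * c)))"
      unfolding of_nat_mult[symmetric] of_nat_le_iff .
    also have "\<dots> \<le> real (card (T r)) * (t2 * (2 * r) powr e)"
      using t(2) r by (intro mult_left_mono) auto
    finally have "p1 * r powr real (dim E) \<le> real (card (T r)) * (t2 * (2 powr e * r powr e))"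
      using p'(2)[OF r] r by (simp add: powr_mult)
    then show ?thesis
      using t(1) r by (simp add: powr_diff field_simps)
  qed
  have up: "real (card (T r)) \<le> q2 * 2 powr real (dim E) / s1 * r powr (real (dim E) - e)"
    if r: "r \<ge> 1" for r
  proof -
    have "\<forall>t\<in>T r. \<exists>g. g \<in> slab \<Gamma> intl r c \<and> a \<bullet> intl g = t"
      unfolding T_def by blast
    from bchoice[OF this] obtain g where g: "\<And>t. t \<in> T r \<Longrightarrow> g t \<in> slab \<Gamma> intl r c"
      "\<And>t. t \<in> T r \<Longrightarrow> a \<bullet> intl (g t) = t"
      by blast
    have "card (T r \<times> slab G intl r c) \<le> card (slab \<Gamma> intl (2 * r) (2 * c))"
    proof (rule card_inj_on_le[of "\<lambda>(t, h). g t + h"])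
      show "inj_on (\<lambda>(t, h). g t + h) (T r \<times> slab G intl r c)"
      proof (rule inj_onI, clarify)
        fix t h t' h' assume *: "t \<in> T r" "h \<in> slab G intl r c" "t' \<in> T r" "h' \<in> slab G intl r c"
          "g t + h = g t' + h'"
        have "a \<bullet> intl (g t + h) = t" "a \<bullet> intl (g t' + h') = t'"
          using g(2)[OF *(1)] g(2)[OF *(3)] *(2,4) linear_intl G_iff unfolding slab_def
          by (simp_all add: linear_add inner_add_right)
        then have "t = t'"
          using *(5) by simp
        then show "t = t' \<and> h = h'"
          using *(5) by simp
      qed
      show "(\<lambda>(t, h). g t + h) ` (T r \<times> slab G intl r c) \<subseteq> slab \<Gamma> intl (2 * r) (2 * c)"
      proof clarify
        fix t h assume *: "t \<in> T r" "h \<in> slab G intl r c"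
        have "norm (g t + h) \<le> 2 * r"
          using g(1)[OF *(1)] *(2) norm_triangle_ineq[of "g t" h] unfolding slab_def by auto
        moreover have "norm (intl (g t + h)) \<le> 2 * c"
          using g(1)[OF *(1)] *(2) norm_triangle_ineq[of "intl (g t)" "intl h"] linear_intl
          unfolding slab_def by (auto simp: linear_add)
        moreover have "g t + h \<in> \<Gamma>"
          using g(1)[OF *(1)] *(2) G_iff lattice_add unfolding slab_def by blast
        ultimately show "g t + h \<in> slab \<Gamma> intl (2 * r) (2 * c)"
          unfolding slab_def by blast
      qed
      show "finite (slab \<Gamma> intl (2 * r) (2 * c))"
        using q'(1)[of "2 * r"] r by simp
    qed
    then have "real (card (T r)) * real (card (slab G intl r c)) \<le> real (card (slab \<Gamma> intl (2 * r) (2 * c)))"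
      unfolding card_cartesian_product of_nat_mult[symmetric] of_nat_le_iff .
    also have "\<dots> \<le> q2 * (2 * r) powr real (dim E)"
      using q'(2)[of "2 * r"] r by simp
    finally have "real (card (T r)) * real (card (slab G intl r c)) \<le> q2 * (2 powr real (dim E) * r powr real (dim E))"
      using r by (simp add: powr_mult)
    moreover have "real (card (T r)) * (s1 * r powr e) \<le> real (card (T r)) * real (card (slab G intl r c))"
      using s(2) r by (intro mult_left_mono) auto
    ultimately have "real (card (T r)) * (s1 * r powr e) \<le> q2 * (2 powr real (dim E) * r powr real (dim E))"
      by linarith
    then show ?thesis
      using s(1) r by (simp add: powr_diff field_simps)
  qed
  have "p1 / (t2 * 2 powr e) > 0" "q2 * 2 powr real (dim E) / s1 > 0"
    using p t(1) q s(1) by auto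
  then show ?thesis
    unfolding exponent using low up unfolding T_def by blast
qed

end

section \<open>Patches as codes\<close>

lemma card_quotient_kernel:
  "card (A // {(x, y). x \<in> A \<and> y \<in> A \<and> f x = f y}) = card (f ` A)"
proof -
  let ?R = "{(x, y). x \<in> A \<and> y \<in> A \<and> f x = f y}"
  have "A // ?R = (\<lambda>x. ?R `` {x}) ` A"
    unfolding quotient_def by (rule UNION_singleton_eq_range)
  also have "\<dots> = (\<lambda>x. {y \<in> A. f y = f x}) ` A"
    by (rule image_cong) auto
  finally have "A // ?R = (\<lambda>c. {x \<in> A. f x = c}) ` (f ` A)"
    by (simp add: image_image)
  moreover have "inj_on (\<lambda>c. {x \<in> A. f x = c}) (f ` A)"
    by (rule inj_onI) blast
  ultimately show ?thesis
    by (simp add: card_image)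
qed

context polytopal_scheme
begin

lemma label_subset: "i \<in> I \<Longrightarrow> Wl i \<subseteq> W"
  and finite_labels: "finite I"
  and label_polytopal: "i \<in> I \<Longrightarrow> polytopal F (Wl i)"
  and window_subset: "W \<subseteq> F"
  and window_compact: "compact W"
  using labelling window unfolding polytopal_labelling_def polytopal_def by auto

lemma label_subset_internal: "i \<in> I \<Longrightarrow> Wl i \<subseteq> F"
  using label_subset window_subset by blast

text \<open>The patch at \<open>phys \<gamma>\<close> as a set of labelled displacements in the
  lattice, with \<open>y = intl \<gamma>\<close>. The base point enters through its internal
  coordinate alone, and for a fixed displacement the condition is membership of \<open>y\<close> in
  a translate of a window piece.\<close>

definition code :: "('a \<Rightarrow> real) \<Rightarrow> real \<Rightarrow> 'a \<Rightarrow> ('a \<times> 'l) set" where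
  "code N r y = {(\<delta>, i). \<delta> \<in> \<Gamma> \<and> N (phys \<delta>) \<le> r \<and> i \<in> I \<and> y + intl \<delta> \<in> Wl i}"

lemma star_phys: "\<gamma> \<in> \<Gamma> \<Longrightarrow> star E F \<Gamma> (phys \<gamma>) = intl \<gamma>"
  unfolding star_def by (simp add: the_inv_into_f_f[OF inj_physical])

lemma cut_and_project_set_eq: "cut_and_project_set E F \<Gamma> W = phys ` {\<gamma> \<in> \<Gamma>. intl \<gamma> \<in> W}"
  unfolding cut_and_project_set_def using star_phys by force

lemma patch_phys:
  assumes "\<gamma> \<in> \<Gamma>"
  shows "patch E F \<Gamma> W I Wl N r (phys \<gamma>) = (\<lambda>(\<delta>, i). (phys (\<gamma> + \<delta>), i)) ` code N r (intl \<gamma>)"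
proof
  show "patch E F \<Gamma> W I Wl N r (phys \<gamma>) \<subseteq> (\<lambda>(\<delta>, i). (phys (\<gamma> + \<delta>), i)) ` code N r (intl \<gamma>)"
  proof clarify
    fix y i assume "(y, i) \<in> patch E F \<Gamma> W I Wl N r (phys \<gamma>)"
    then obtain \<eta> where \<eta>: "\<eta> \<in> \<Gamma>" "y = phys \<eta>" "N (phys \<eta> - phys \<gamma>) \<le> r" "i \<in> I" "intl \<eta> \<in> Wl i"
      unfolding patch_def cut_and_project_set_eq using star_phys by auto
    then have "(\<eta> - \<gamma>, i) \<in> code N r (intl \<gamma>)"
      using assms lattice_diff linear_phys linear_intl unfolding code_def
      by (auto simp: linear_diff)
    then show "(y, i) \<in> (\<lambda>(\<delta>, i). (phys (\<gamma> + \<delta>), i)) ` code N r (intl \<gamma>)"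
      using \<eta>(2) by (intro image_eqI[of _ _ "(\<eta> - \<gamma>, i)"]) auto
  qed
  show "(\<lambda>(\<delta>, i). (phys (\<gamma> + \<delta>), i)) ` code N r (intl \<gamma>) \<subseteq> patch E F \<Gamma> W I Wl N r (phys \<gamma>)"
  proof clarify
    fix \<delta> i assume "(\<delta>, i) \<in> code N r (intl \<gamma>)"
    then have \<delta>: "\<delta> \<in> \<Gamma>" "N (phys \<delta>) \<le> r" "i \<in> I" "intl (\<gamma> + \<delta>) \<in> Wl i"
      using linear_intl unfolding code_def by (auto simp: linear_add)
    moreover have "phys (\<gamma> + \<delta>) - phys \<gamma> = phys \<delta>"
      using linear_phys by (simp add: linear_add)
    moreover have "\<gamma> + \<delta> \<in> \<Gamma>"
      using assms \<delta>(1) by (rule lattice_add)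
    ultimately show "(phys (\<gamma> + \<delta>), i) \<in> patch E F \<Gamma> W I Wl N r (phys \<gamma>)"
      using label_subset star_phys unfolding patch_def cut_and_project_set_eq by auto
  qed
qed

text \<open>The translation between the centres replaces one base point by the other, and
  injectivity of \<open>phys\<close> on \<Gamma> then recovers the code from the patch.\<close>

lemma patch_shift_iff:
  assumes "\<gamma> \<in> \<Gamma>" "\<gamma>' \<in> \<Gamma>"
  shows "(\<lambda>(y, i). (y + (phys \<gamma>' - phys \<gamma>), i)) ` patch E F \<Gamma> W I Wl N r (phys \<gamma>)
      = patch E F \<Gamma> W I Wl N r (phys \<gamma>') \<longleftrightarrow> code N r (intl \<gamma>) = code N r (intl \<gamma>')"
proof -
  let ?s = "\<lambda>(\<delta>, i::'l). (phys (\<gamma>' + \<delta>), i)"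
  have "(\<lambda>(y, i). (y + (phys \<gamma>' - phys \<gamma>), i)) ` patch E F \<Gamma> W I Wl N r (phys \<gamma>)
      = ?s ` code N r (intl \<gamma>)"
    unfolding patch_phys[OF assms(1)] image_image using linear_phys
    by (intro image_cong) (auto simp: linear_add)
  moreover have "inj_on ?s (\<Gamma> \<times> UNIV)"
    using inj_physical lattice_add[OF assms(2)] by (auto simp: inj_on_def) (metis add_left_imp_eq)
  moreover have "code N r y \<subseteq> \<Gamma> \<times> UNIV" for y
    unfolding code_def by blast
  ultimately show ?thesis
    unfolding patch_phys[OF assms(2)] by (metis inj_on_image_eq_iff)
qed

lemma complexity_eq_card_codes:
  "complexity E F \<Gamma> W I Wl N r = card (code N r ` (intl ` \<Gamma> \<inter> W))"
proof -
  let ?A = "cut_and_project_set E F \<Gamma> W"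
  have *: "(\<lambda>(y, i). (y + (x' - x), i)) ` patch E F \<Gamma> W I Wl N r x = patch E F \<Gamma> W I Wl N r x'
      \<longleftrightarrow> code N r (star E F \<Gamma> x) = code N r (star E F \<Gamma> x')" if x: "x \<in> ?A" "x' \<in> ?A" for x x'
  proof -
    obtain \<gamma> \<gamma>' where "\<gamma> \<in> \<Gamma>" "x = phys \<gamma>" "\<gamma>' \<in> \<Gamma>" "x' = phys \<gamma>'"
      using x unfolding cut_and_project_set_eq by blast
    then show ?thesis
      using patch_shift_iff star_phys by simp
  qed
  have "patch_equiv E F \<Gamma> W I Wl N r
      = {(x, y). x \<in> ?A \<and> y \<in> ?A \<and> code N r (star E F \<Gamma> x) = code N r (star E F \<Gamma> y)}"
    unfolding patch_equiv_def by (simp only: * cong: conj_cong)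
  then have "complexity E F \<Gamma> W I Wl N r = card ((\<lambda>x. code N r (star E F \<Gamma> x)) ` ?A)"
    unfolding complexity_def by (simp only: card_quotient_kernel)
  also have "(\<lambda>x. code N r (star E F \<Gamma> x)) ` ?A = code N r ` (intl ` \<Gamma> \<inter> W)"
    unfolding cut_and_project_set_eq using star_phys by (force simp: image_iff)
  finally show ?thesis .
qed

end

section \<open>Cells of hyperplane arrangements\<close>

lemma card_image_le_factor:
  assumes "finite (g ` A)" and eq: "\<And>x y. x \<in> A \<Longrightarrow> y \<in> A \<Longrightarrow> g x = g y \<Longrightarrow> f x = f y"
  shows "finite (f ` A)" "card (f ` A) \<le> card (g ` A)"
proof -
  have "f x = f (SOME y. y \<in> A \<and> g y = g x)" if "x \<in> A" for x
    using someI[of "\<lambda>y. y \<in> A \<and> g y = g x" x] that by (intro eq) auto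
  then have sub: "f ` A \<subseteq> (\<lambda>c. f (SOME y. y \<in> A \<and> g y = c)) ` (g ` A)"
    unfolding image_image by (rule image_subsetI[OF image_eqI])
  show "finite (f ` A)"
    using sub assms(1) by (rule finite_subset[OF _ finite_imageI])
  show "card (f ` A) \<le> card (g ` A)"
    using assms(1) sub by (rule surj_card_le)
qed

text \<open>Avoidance is an open condition, so a point lying on a newly added hyperplane can be
  pushed off along its normal without meeting those already avoided.\<close>

lemma hyperplanes_avoidable:
  fixes F :: "'a::euclidean_space set"
  assumes "subspace F" "finite S" "\<And>a b. (a, b) \<in> S \<Longrightarrow> a \<in> F \<and> a \<noteq> 0" "x \<in> F" "e > 0"
  shows "\<exists>y\<in>F. dist y x < e \<and> (\<forall>(a, b)\<in>S. a \<bullet> y \<noteq> b)"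
  using assms(2,3)
proof (induction rule: finite_induct)
  case empty
  then show ?case using assms(4,5) by (auto intro!: bexI[of _ x])
next
  case (insert ab S)
  obtain a b where ab: "ab = (a, b)" by (cases ab)
  have a: "a \<in> F" "a \<noteq> 0"
    using insert.prems[of a b] ab by auto
  obtain y where y: "y \<in> F" "dist y x < e" "\<forall>(a, b)\<in>S. a \<bullet> y \<noteq> b"
    using insert by auto
  show ?case
  proof (cases "a \<bullet> y = b")
    case False
    then show ?thesis using y ab by auto
  next
    case True
    have "open (ball x e \<inter> (\<Inter>(a, b)\<in>S. {z. a \<bullet> z \<noteq> b}))"
      using insert.hyps(1) by (intro open_Int open_ball open_INT) (auto intro!: open_Collect_neq continuous_intros)
    moreover have "y \<in> ball x e \<inter> (\<Inter>(a, b)\<in>S. {z. a \<bullet> z \<noteq> b})"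
      using y by (auto simp: dist_commute)
    ultimately obtain \<delta> where \<delta>: "\<delta> > 0" "ball y \<delta> \<subseteq> ball x e \<inter> (\<Inter>(a, b)\<in>S. {z. a \<bullet> z \<noteq> b})"
      by (meson open_contains_ball)
    \<comment> \<open>A step of length \<open>\<delta> / 2\<close> along \<open>a\<close>: it stays
      in the ball and raises \<open>a \<bullet> y\<close> by a positive amount.\<close>
    define z where "z = y + (\<delta> / (2 * norm a)) *\<^sub>R a"
    have "z \<in> ball y \<delta>"
      unfolding z_def using a \<delta>(1) by (simp add: dist_norm)
    then have "z \<in> ball x e \<inter> (\<Inter>(a, b)\<in>S. {z. a \<bullet> z \<noteq> b})"
      using \<delta>(2) by blast
    then have "dist z x < e" "\<forall>(a, b)\<in>S. a \<bullet> z \<noteq> b"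
      by (auto simp: dist_commute)
    moreover have "a \<bullet> z \<noteq> b"
      unfolding z_def using True a \<delta>(1) by (simp add: inner_add_right)
    moreover have "z \<in> F"
      unfolding z_def using a y assms(1) by (simp add: subspace_add subspace_scale)
    ultimately show ?thesis
      using ab by auto
  qed
qed

section \<open>Separating families of normals and vertices of cells\<close>

lemma span_eq_subspace_if_separating:
  fixes F :: "'a::euclidean_space set"
  assumes F: "subspace F" and "J \<subseteq> F" and sep: "\<forall>u\<in>F. (\<forall>a\<in>J. a \<bullet> u = 0) \<longrightarrow> u = 0"
  shows "span J = F"
proof (rule ccontr)
  assume "span J \<noteq> F"
  moreover have "span J \<subseteq> F"
    using assms(1,2) by (rule span_minimal[rotated])
  ultimately have "span J \<subset> span F"
    using span_eq_iff[of F] assms(1) by blast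
  then obtain u where u: "u \<noteq> 0" "u \<in> span F" "\<And>y. y \<in> span J \<Longrightarrow> orthogonal u y"
    using orthogonal_to_subspace_exists_gen by blast
  then show False
    using sep F span_base[of _ J] by (metis inner_commute orthogonal_def span_eq_iff)
qed

text \<open>Separation makes the sum of absolute values a norm on \<open>F\<close>, so equivalence
  of norms applies.\<close>

lemma norm_le_sum_inner:
  fixes F :: "'a::euclidean_space set"
  assumes F: "subspace F" and "finite D"
    and sep: "\<forall>u\<in>F. (\<forall>a\<in>D. a \<bullet> u = 0) \<longrightarrow> u = 0"
  shows "\<exists>K>0. \<forall>z\<in>F. norm z \<le> K * (\<Sum>a\<in>D. \<bar>a \<bullet> z\<bar>)"
proof -
  have "norm_on F (\<lambda>z. \<Sum>a\<in>D. \<bar>a \<bullet> z\<bar>)"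
    unfolding norm_on_def
  proof (intro conjI ballI allI)
    fix x assume x: "x \<in> F"
    show "((\<Sum>a\<in>D. \<bar>a \<bullet> x\<bar>) = 0) = (x = 0)"
      using sep x assms(2) by (auto simp: sum_nonneg_eq_0_iff)
    show "(\<Sum>a\<in>D. \<bar>a \<bullet> (c *\<^sub>R x)\<bar>) = \<bar>c\<bar> * (\<Sum>a\<in>D. \<bar>a \<bullet> x\<bar>)" for c
      by (simp add: abs_mult sum_distrib_left)
    show "(\<Sum>a\<in>D. \<bar>a \<bullet> (x + y)\<bar>) \<le> (\<Sum>a\<in>D. \<bar>a \<bullet> x\<bar>) + (\<Sum>a\<in>D. \<bar>a \<bullet> y\<bar>)" for y
      unfolding sum.distrib[symmetric] by (intro sum_mono) (simp add: inner_add_right abs_triangle_ineq)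
  qed (simp add: sum_nonneg)
  from norm_on_equivalent[OF this F] obtain c where
    c: "c > 0" "\<forall>z\<in>F. c * norm z \<le> (\<Sum>a\<in>D. \<bar>a \<bullet> z\<bar>)"
    by meson
  then show ?thesis
    by (intro exI[of _ "1 / c"]) (auto simp: field_simps)
qed

text \<open>The closure of the cell containing \<open>y\<close> is a polytope, and its extreme points lie on enough
  hyperplanes to be determined by them.\<close>

lemma cell_vertex:
  fixes F :: "'a::euclidean_space set"
  assumes F: "subspace F" and D: "finite D" "D \<subseteq> F"
    and sep: "\<forall>u\<in>F. (\<forall>a\<in>D. a \<bullet> u = 0) \<longrightarrow> u = 0"
    and T: "\<forall>a\<in>D. finite (T a)"
    and y: "y \<in> F" "\<forall>a\<in>D. \<exists>t\<in>T a. t < a \<bullet> y" "\<forall>a\<in>D. \<exists>t\<in>T a. a \<bullet> y < t"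
  obtains z J where "z \<in> F" "J \<subseteq> D" "card J = dim F" "\<forall>u\<in>F. (\<forall>a\<in>J. a \<bullet> u = 0) \<longrightarrow> u = 0"
    "\<forall>a\<in>J. a \<bullet> z \<in> T a"
    "\<forall>a\<in>D. \<forall>t\<in>T a. (t < a \<bullet> y \<longrightarrow> t \<le> a \<bullet> z) \<and> (a \<bullet> y < t \<longrightarrow> a \<bullet> z \<le> t)"
proof -
  \<comment> \<open>The nearest walls strictly below and strictly above \<open>y\<close> in each
    direction; together they cut out the polytope \<open>P\<close>.\<close>
  define lo where "lo = (\<lambda>a. Max {t \<in> T a. t < a \<bullet> y})"
  define hi where "hi = (\<lambda>a. Min {t \<in> T a. a \<bullet> y < t})"
  have lo: "lo a \<in> T a" "lo a < a \<bullet> y" "\<And>t. t \<in> T a \<Longrightarrow> t < a \<bullet> y \<Longrightarrow> t \<le> lo a" if "a \<in> D" for a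
  proof -
    have "finite {t \<in> T a. t < a \<bullet> y}" "{t \<in> T a. t < a \<bullet> y} \<noteq> {}"
      using T y(2) that by auto
    from Max_in[OF this] Max_ge[OF this(1)] show "lo a \<in> T a" "lo a < a \<bullet> y"
      "\<And>t. t \<in> T a \<Longrightarrow> t < a \<bullet> y \<Longrightarrow> t \<le> lo a"
      unfolding lo_def by auto
  qed
  have hi: "hi a \<in> T a" "a \<bullet> y < hi a" "\<And>t. t \<in> T a \<Longrightarrow> a \<bullet> y < t \<Longrightarrow> hi a \<le> t" if "a \<in> D" for a
  proof -
    have "finite {t \<in> T a. a \<bullet> y < t}" "{t \<in> T a. a \<bullet> y < t} \<noteq> {}"
      using T y(3) that by auto
    from Min_in[OF this] Min_le[OF this(1)] show "hi a \<in> T a" "a \<bullet> y < hi a"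
      "\<And>t. t \<in> T a \<Longrightarrow> a \<bullet> y < t \<Longrightarrow> hi a \<le> t"
      unfolding hi_def by auto
  qed
  define P where "P = F \<inter> (\<Inter>a\<in>D. {z. lo a \<le> a \<bullet> z} \<inter> {z. a \<bullet> z \<le> hi a})"
  have P_iff: "z \<in> P \<longleftrightarrow> z \<in> F \<and> (\<forall>a\<in>D. lo a \<le> a \<bullet> z \<and> a \<bullet> z \<le> hi a)" for z
    unfolding P_def by auto
  have "convex P"
    unfolding P_def
    by (intro convex_Int convex_INT subspace_imp_convex F convex_halfspace_ge convex_halfspace_le)
  have "closed P"
    unfolding P_def by (intro closed_Int closed_INT ballI closed_subspace F closed_halfspace_le closed_halfspace_ge)
  obtain K where K: "K > 0" "\<forall>z\<in>F. norm z \<le> K * (\<Sum>a\<in>D. \<bar>a \<bullet> z\<bar>)"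
    using norm_le_sum_inner[OF F D(1) sep] by meson
  have "norm z \<le> K * (\<Sum>a\<in>D. \<bar>lo a\<bar> + \<bar>hi a\<bar>)" if "z \<in> P" for z
  proof -
    have "(\<Sum>a\<in>D. \<bar>a \<bullet> z\<bar>) \<le> (\<Sum>a\<in>D. \<bar>lo a\<bar> + \<bar>hi a\<bar>)"
      using that unfolding P_iff by (intro sum_mono) force
    then have "K * (\<Sum>a\<in>D. \<bar>a \<bullet> z\<bar>) \<le> K * (\<Sum>a\<in>D. \<bar>lo a\<bar> + \<bar>hi a\<bar>)"
      using K(1) by (intro mult_left_mono) auto
    then show ?thesis
      using K(2) that unfolding P_iff by force
  qed
  then have "bounded P"
    by (auto simp: bounded_iff)
  with \<open>closed P\<close> have "compact P"
    by (simp add: compact_eq_bounded_closed)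
  moreover have "y \<in> P"
    unfolding P_iff using y(1) lo(2) hi(2) by (auto simp: less_imp_le)
  ultimately obtain z where z: "z extreme_point_of P"
    using extreme_point_exists_convex[of P] \<open>convex P\<close> by blast
  then have zP: "z \<in> P"
    unfolding extreme_point_of_def by blast
  \<comment> \<open>The normals of the walls through \<open>z\<close>. A nonzero vector of
    \<open>F\<close> orthogonal to all of them could be added to \<open>z\<close> and subtracted
    from it, suitably scaled, without leaving \<open>P\<close>; an extreme point forbids
    this.\<close>
  define A where "A = {a \<in> D. a \<bullet> z \<in> T a}"
  have sepA: "u = 0" if u: "u \<in> F" "\<And>a. a \<in> A \<Longrightarrow> a \<bullet> u = 0" for u
  proof (rule ccontr)
    assume "u \<noteq> 0"
    have ev: "\<forall>\<^sub>F s in at_right 0. \<forall>a\<in>D. lo a \<le> a \<bullet> (z + (c * s) *\<^sub>R u) \<and> a \<bullet> (z + (c * s) *\<^sub>R u) \<le> hi a"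
      for c
    proof (rule eventually_ball_finite[OF D(1)], rule ballI)
      fix a assume a: "a \<in> D"
      show "\<forall>\<^sub>F s in at_right 0. lo a \<le> a \<bullet> (z + (c * s) *\<^sub>R u) \<and> a \<bullet> (z + (c * s) *\<^sub>R u) \<le> hi a"
      proof (cases "a \<in> A")
        case True
        then have "a \<bullet> (z + (c * s) *\<^sub>R u) = a \<bullet> z" for s
          using u(2) by (simp add: inner_add_right)
        then show ?thesis
          using zP a unfolding P_iff by simp
      next
        case False
        then have "a \<bullet> z \<notin> T a"
          using a unfolding A_def by blast
        then have "a \<bullet> z \<noteq> lo a" "a \<bullet> z \<noteq> hi a"
          using lo(1)[OF a] hi(1)[OF a] by auto
        then have strict: "lo a < a \<bullet> z" "a \<bullet> z < hi a"
          using zP a unfolding P_iff by force+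
        have "((\<lambda>s. a \<bullet> (z + (c * s) *\<^sub>R u)) \<longlongrightarrow> a \<bullet> (z + (c * 0) *\<^sub>R u)) (at_right 0)"
          by (intro tendsto_intros)
        then have "((\<lambda>s. a \<bullet> (z + (c * s) *\<^sub>R u)) \<longlongrightarrow> a \<bullet> z) (at_right 0)"
          by simp
        from order_tendstoD(1)[OF this strict(1)] order_tendstoD(2)[OF this strict(2)]
        show ?thesis
          by eventually_elim auto
      qed
    qed
    have "\<forall>\<^sub>F s in at_right (0::real). 0 < s \<and>
        (\<forall>a\<in>D. lo a \<le> a \<bullet> (z + (1 * s) *\<^sub>R u) \<and> a \<bullet> (z + (1 * s) *\<^sub>R u) \<le> hi a) \<and>
        (\<forall>a\<in>D. lo a \<le> a \<bullet> (z + (-1 * s) *\<^sub>R u) \<and> a \<bullet> (z + (-1 * s) *\<^sub>R u) \<le> hi a)"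
      by (intro eventually_conj ev eventually_at_right_less)
    from eventually_happens'[OF _ this] obtain s where s: "0 < s"
      "\<forall>a\<in>D. lo a \<le> a \<bullet> (z + (1 * s) *\<^sub>R u) \<and> a \<bullet> (z + (1 * s) *\<^sub>R u) \<le> hi a"
      "\<forall>a\<in>D. lo a \<le> a \<bullet> (z + (-1 * s) *\<^sub>R u) \<and> a \<bullet> (z + (-1 * s) *\<^sub>R u) \<le> hi a"
      by (auto simp: trivial_limit_at_right_real)
    have inF: "z + c *\<^sub>R u \<in> F" for c
      using zP u(1) F unfolding P_iff by (simp add: subspace_add subspace_scale)
    have "z + s *\<^sub>R u \<in> P" "z + (-s) *\<^sub>R u \<in> P"
      unfolding P_iff using s(2,3) inF[of s] inF[of "- s"] by simp_all
    moreover have "z \<in> open_segment (z + s *\<^sub>R u) (z + (-s) *\<^sub>R u)"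
    proof -
      have "z = midpoint (z + s *\<^sub>R u) (z + (-s) *\<^sub>R u)"
        by (simp add: midpoint_def algebra_simps flip: scaleR_2)
      moreover have "z + s *\<^sub>R u \<noteq> z + (-s) *\<^sub>R u"
      proof
        assume "z + s *\<^sub>R u = z + (-s) *\<^sub>R u"
        then have "s *\<^sub>R u + s *\<^sub>R u = 0"
          by (simp flip: eq_neg_iff_add_eq_0)
        then have "(s + s) *\<^sub>R u = 0" by (simp only: scaleR_left_distrib)
        then show False using s(1) \<open>u \<noteq> 0\<close> by simp
      qed
      ultimately show ?thesis
        by (metis midpoint_in_open_segment)
    qed
    ultimately show False
      using z unfolding extreme_point_of_def by blast
  qed
  \<comment> \<open>More than \<open>dim F\<close> walls may pass through the vertex; a basis of
    their normals still determines it.\<close>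
  obtain J where J: "J \<subseteq> A" "independent J" "A \<subseteq> span J"
    by (rule maximal_independent_subset)
  have JD: "J \<subseteq> D"
    using J(1) unfolding A_def by blast
  have sepJ: "u = 0" if u: "u \<in> F" "\<And>a. a \<in> J \<Longrightarrow> a \<bullet> u = 0" for u
  proof (rule sepA[OF u(1)])
    have "orthogonal u a" if "a \<in> span J" for a
      by (rule orthogonal_to_span[OF that]) (metis u(2) orthogonal_def inner_commute)
    then show "a \<bullet> u = 0" if "a \<in> A" for a
      using that J(3) by (metis inner_commute orthogonal_def subsetD)
  qed
  have "span J = F"
    using F JD D(2) sepJ by (intro span_eq_subspace_if_separating) auto
  then have "card J = dim F"
    using J(2) dim_span_eq_card_independent by metis
  moreover have "(t < a \<bullet> y \<longrightarrow> t \<le> a \<bullet> z) \<and> (a \<bullet> y < t \<longrightarrow> a \<bullet> z \<le> t)" if "a \<in> D" "t \<in> T a" for a t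
    using zP that lo(3)[OF that] hi(3)[OF that] unfolding P_iff by force
  moreover have "z \<in> F"
    using zP unfolding P_iff by blast
  moreover have "\<forall>a\<in>J. a \<bullet> z \<in> T a"
    using J(1) unfolding A_def by blast
  ultimately show ?thesis
    using that[of z J] JD sepJ by blast
qed

text \<open>Candidate sets of walls through a vertex, the analogue of \<open>flags\<close> for
  normal vectors: the last condition makes the vertex unique.\<close>

definition flag_normals :: "'a::euclidean_space set \<Rightarrow> 'a set \<Rightarrow> 'a set set" where
  "flag_normals F D = {J. J \<subseteq> D \<and> card J = dim F \<and> (\<forall>u\<in>F. (\<forall>a\<in>J. a \<bullet> u = 0) \<longrightarrow> u = 0)}"

text \<open>A sign pattern is encoded by a vertex of its cell, given as a set \<open>J\<close> of
  normals with the offsets of their walls, and one bit per direction. All walls that miss the vertex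
  lie on the same side of the vertex as of the cell. In each direction at most one wall passes
  through the vertex, so one bit tells its side.\<close>

lemma card_cells_le:
  fixes F :: "'a::euclidean_space set"
  assumes F: "subspace F" and D: "finite D" "D \<subseteq> F"
    and sep: "\<forall>u\<in>F. (\<forall>a\<in>D. a \<bullet> u = 0) \<longrightarrow> u = 0"
    and T: "\<forall>a\<in>D. finite (T a)"
    and S: "\<forall>y\<in>S. \<forall>a\<in>D.
        a \<bullet> y \<notin> T a \<and> (\<exists>t\<in>T a. t < a \<bullet> y) \<and> (\<exists>t\<in>T a. a \<bullet> y < t)" "S \<subseteq> F"
  defines "\<sigma> \<equiv> \<lambda>y. {(a, t). a \<in> D \<and> t \<in> T a \<and> t < a \<bullet> y}"
  shows "finite (\<sigma> ` S)" "card (\<sigma> ` S) \<le> (\<Sum>J\<in>flag_normals F D. \<Prod>a\<in>J. card (T a)) * 2 ^ card D"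
proof -
  define X where "X = (SIGMA J:flag_normals F D. PiE J T) \<times> Pow D"
  define vtx where "vtx = (\<lambda>(J :: 'a set) v. SOME z. z \<in> F \<and> (\<forall>a\<in>J. a \<bullet> z = v a))"
  \<comment> \<open>A wall through the vertex counts as lying below the cell exactly when its
    direction is not in \<open>B\<close>.\<close>
  define dec where "dec = (\<lambda>((J, v), B). {(a, t). a \<in> D \<and> t \<in> T a \<and>
      (if a \<in> B then t < a \<bullet> vtx J v else t \<le> a \<bullet> vtx J v)})"
  have fin: "finite (flag_normals F D)"
    using D(1) unfolding flag_normals_def by auto
  have finJ: "finite J" if "J \<in> flag_normals F D" for J
    using that D(1) unfolding flag_normals_def by (auto intro: finite_subset)
  have finPi: "finite (PiE J T)" if "J \<in> flag_normals F D" for J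
    using that T finJ[OF that] unfolding flag_normals_def by (intro finite_PiE) auto
  have finX: "finite X"
    unfolding X_def using fin finPi D(1) by auto
  have cardX: "card X = (\<Sum>J\<in>flag_normals F D. \<Prod>a\<in>J. card (T a)) * 2 ^ card D"
    unfolding X_def using fin finPi finJ D(1) by (simp add: card_PiE card_Pow card_cartesian_product)
  have sub: "\<sigma> ` S \<subseteq> dec ` X"
  proof
    fix c assume "c \<in> \<sigma> ` S"
    then obtain y where y: "y \<in> S" "c = \<sigma> y" by blast
    have yS: "y \<in> F" "\<forall>a\<in>D. \<exists>t\<in>T a. t < a \<bullet> y" "\<forall>a\<in>D. \<exists>t\<in>T a. a \<bullet> y < t"
      using S y(1) y(1) by auto
    obtain z J where zJ: "z \<in> F" "J \<subseteq> D" "card J = dim F" "\<forall>u\<in>F. (\<forall>a\<in>J. a \<bullet> u = 0) \<longrightarrow> u = 0"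
      "\<forall>a\<in>J. a \<bullet> z \<in> T a"
      "\<forall>a\<in>D. \<forall>t\<in>T a. (t < a \<bullet> y \<longrightarrow> t \<le> a \<bullet> z) \<and> (a \<bullet> y < t \<longrightarrow> a \<bullet> z \<le> t)"
      by (rule cell_vertex[OF F D sep T yS], rule that)
    define v where "v = restrict (\<lambda>a. a \<bullet> z) J"
    \<comment> \<open>Such a \<open>t\<close> is above \<open>y\<close> and not above the vertex, so
      it equals \<open>a \<bullet> z\<close>: the cell lies on the lower side of this wall.\<close>
    define B where "B = {a \<in> D. \<exists>t\<in>T a. a \<bullet> y < t \<and> t \<le> a \<bullet> z}"
    have "((J, v), B) \<in> X"
      unfolding X_def v_def B_def flag_normals_def using zJ by auto
    have "vtx J v \<in> F \<and> (\<forall>a\<in>J. a \<bullet> vtx J v = v a)"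
      unfolding vtx_def by (rule someI[of _ z]) (use zJ in \<open>auto simp: v_def\<close>)
    then have "vtx J v - z \<in> F" "\<forall>a\<in>J. a \<bullet> (vtx J v - z) = 0"
      using F zJ(1) by (auto simp: subspace_diff inner_diff_right v_def)
    then have vtx: "vtx J v = z"
      using zJ(4) by force
    have "t < a \<bullet> y \<longleftrightarrow> (if a \<in> B then t < a \<bullet> z else t \<le> a \<bullet> z)" if at: "a \<in> D" "t \<in> T a" for a t
    proof -
      have z: "t < a \<bullet> y \<longrightarrow> t \<le> a \<bullet> z" "a \<bullet> y < t \<longrightarrow> a \<bullet> z \<le> t" and ne: "t \<noteq> a \<bullet> y"
        using zJ(6) S(1) y(1) at by blast+
      show ?thesis
      proof (cases "a \<in> B")
        case True
        then obtain t0 where t0: "t0 \<in> T a" "a \<bullet> y < t0" "t0 \<le> a \<bullet> z"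
          unfolding B_def by blast
        then have "a \<bullet> z \<le> t0"
          using zJ(6) at(1) by blast
        then show ?thesis
          using True t0 z ne by auto
      next
        case False
        then have "\<not> (a \<bullet> y < t \<and> t \<le> a \<bullet> z)"
          using at unfolding B_def by blast
        then show ?thesis
          using False z ne by auto
      qed
    qed
    then have "c = dec ((J, v), B)"
      unfolding y(2) \<sigma>_def dec_def prod.case vtx by blast
    then show "c \<in> dec ` X"
      using \<open>((J, v), B) \<in> X\<close> by blast
  qed
  show "finite (\<sigma> ` S)"
    using finX by (rule finite_subset[OF sub finite_imageI])
  show "card (\<sigma> ` S) \<le> (\<Sum>J\<in>flag_normals F D. \<Prod>a\<in>J. card (T a)) * 2 ^ card D"
    unfolding cardX[symmetric] using finX sub by (rule surj_card_le)
qed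

section \<open>The arrangement of supporting hyperplanes\<close>

lemma hyperplane_direction:
  fixes F :: "'a::euclidean_space set"
  assumes "subspace F" "a \<in> F" "a \<noteq> 0"
  shows "{x - y |x y. x \<in> hyperplane F a b \<and> y \<in> hyperplane F a b} = {x \<in> F. a \<bullet> x = 0}"
proof
  show "{x - y |x y. x \<in> hyperplane F a b \<and> y \<in> hyperplane F a b} \<subseteq> {x \<in> F. a \<bullet> x = 0}"
    using assms(1) by (auto simp: hyperplane_def subspace_diff inner_diff_right)
  show "{x \<in> F. a \<bullet> x = 0} \<subseteq> {x - y |x y. x \<in> hyperplane F a b \<and> y \<in> hyperplane F a b}"
  proof clarify
    fix v assume v: "v \<in> F" "a \<bullet> v = 0"
    define h where "h = (b / (a \<bullet> a)) *\<^sub>R a"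
    have "h \<in> hyperplane F a b" "v + h \<in> hyperplane F a b"
      using assms v unfolding hyperplane_def h_def
      by (simp_all add: subspace_scale subspace_add inner_add_right)
    then show "\<exists>x y. v = x - y \<and> x \<in> hyperplane F a b \<and> y \<in> hyperplane F a b"
      by (intro exI[of _ "v + h"] exI[of _ h]) simp
  qed
qed

text \<open>Off the frontier a point is interior or exterior to \<open>S\<close>, and both are open
  conditions.\<close>

lemma eventually_mem_iff_off_frontier:
  assumes "p \<in> F" "S \<subseteq> F" "p \<notin> top_of_set F frontier_of S"
  shows "\<forall>\<^sub>F q in nhds p. q \<in> F \<longrightarrow> (q \<in> S \<longleftrightarrow> p \<in> S)"
proof -
  let ?X = "top_of_set F"
  have ev: "\<forall>\<^sub>F q in nhds p. q \<in> F \<longrightarrow> q \<in> U" if U: "openin ?X U" "p \<in> U" for U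
  proof -
    obtain T where T: "open T" "U = F \<inter> T"
      using U(1) by (auto simp: openin_open)
    show ?thesis
      unfolding eventually_nhds using T U(2) by (intro exI[of _ T]) auto
  qed
  show ?thesis
  proof (cases "p \<in> S")
    case True
    then have "p \<in> ?X interior_of S"
      using assms closure_of_subset[of S ?X] unfolding frontier_of_def by auto
    from ev[OF openin_interior_of this] show ?thesis
      using True interior_of_subset[of ?X S] by (auto elim!: eventually_mono)
  next
    case False
    then have "p \<notin> ?X closure_of S"
      using assms(3) interior_of_subset[of ?X S] unfolding frontier_of_def by auto
    then have "\<forall>\<^sub>F q in nhds p. q \<in> F \<longrightarrow> q \<in> F - ?X closure_of S"
      using assms(1) closedin_closure_of[of ?X S] by (intro ev) (auto simp: closedin_def)
    then show ?thesis
      using False assms(2) closure_of_subset[of S ?X] by (auto elim!: eventually_mono)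
  qed
qed

context polytopal_scheme
begin

text \<open>Parallel hyperplanes come with normals of arbitrary length and sign. One choice per
  direction makes their offsets comparable and gives distinct chosen normals distinct
  directions.\<close>

definition normal :: "'a set \<Rightarrow> 'a" where
  "normal V = (SOME a. a \<in> F \<and> a \<noteq> 0 \<and> V = {x \<in> F. a \<bullet> x = 0})"

lemma supporting_hyperplaneE:
  assumes "H \<in> supporting_hyperplanes F I Wl"
  obtains a b where "a \<in> F" "a \<noteq> 0" "H = hyperplane F a b"
  using assms unfolding supporting_hyperplanes_def properly_supporting_def by blast

lemma normal:
  assumes "V \<in> directions F I Wl"
  shows "normal V \<in> F" "normal V \<noteq> 0" "V = {x \<in> F. normal V \<bullet> x = 0}"
proof -
  obtain H where H: "H \<in> supporting_hyperplanes F I Wl" "V = {x - y |x y. x \<in> H \<and> y \<in> H}"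
    using assms unfolding directions_def by blast
  obtain a b where "a \<in> F" "a \<noteq> 0" "H = hyperplane F a b"
    using H(1) by (rule supporting_hyperplaneE)
  then have "a \<in> F \<and> a \<noteq> 0 \<and> V = {x \<in> F. a \<bullet> x = 0}"
    using hyperplane_direction[OF subspace_internal] H(2) by simp
  then have "normal V \<in> F \<and> normal V \<noteq> 0 \<and> V = {x \<in> F. normal V \<bullet> x = 0}"
    unfolding normal_def by (rule someI)
  then show "normal V \<in> F" "normal V \<noteq> 0" "V = {x \<in> F. normal V \<bullet> x = 0}"
    by blast+
qed

lemma supporting_hyperplane_offset:
  assumes H: "H \<in> supporting_hyperplanes F I Wl" and V: "V = {x - y |x y. x \<in> H \<and> y \<in> H}"
    and x: "x \<in> H" "y \<in> H"
  shows "normal V \<bullet> x = normal V \<bullet> y"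
proof -
  have "x - y \<in> V" "V \<in> directions F I Wl"
    using H x unfolding V directions_def by blast+
  then have "normal V \<bullet> (x - y) = 0"
    using normal(3)[of V] by blast
  then show ?thesis
    by (simp add: inner_diff_right)
qed

lemma supporting_hyperplanes_cover:
  obtains \<H> where "finite \<H>" "\<H> \<subseteq> supporting_hyperplanes F I Wl"
    "\<And>i. i \<in> I \<Longrightarrow> top_of_set F frontier_of Wl i \<subseteq> \<Union>\<H>"
proof -
  have "\<forall>i\<in>I. \<exists>\<H>. finite \<H> \<and> (\<forall>H\<in>\<H>. properly_supporting F (Wl i) H) \<and>
      top_of_set F frontier_of Wl i \<subseteq> \<Union>\<H>"
    using label_polytopal unfolding polytopal_def by blast
  from bchoice[OF this] obtain h where h: "\<forall>i\<in>I. finite (h i) \<and> (\<forall>H\<in>h i. properly_supporting F (Wl i) H) \<and>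
      top_of_set F frontier_of Wl i \<subseteq> \<Union>(h i)"
    by blast
  show ?thesis
  proof (rule that[of "\<Union>i\<in>I. h i"])
    show "finite (\<Union>i\<in>I. h i)"
      using h finite_labels by blast
    show "(\<Union>i\<in>I. h i) \<subseteq> supporting_hyperplanes F I Wl"
      using h unfolding supporting_hyperplanes_def by blast
    show "top_of_set F frontier_of Wl i \<subseteq> \<Union>(\<Union>i\<in>I. h i)" if i: "i \<in> I" for i
    proof -
      have "top_of_set F frontier_of Wl i \<subseteq> \<Union>(h i)"
        using h i by simp
      also have "\<dots> \<subseteq> \<Union>(\<Union>i\<in>I. h i)"
        using i by auto
      finally show ?thesis .
    qed
  qed
qed

text \<open>Injectivity of the map to directions lets a set of normals become a flag of the same
  size. Finiteness of \<open>D\<close> and of each \<open>Q a\<close> comes from taking only a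
  finite covering family of supporting hyperplanes.\<close>

lemma arrangement:
  obtains D Q where "finite D" "D \<subseteq> F" "0 \<notin> D"
    "\<forall>a\<in>D. {x \<in> F. a \<bullet> x = 0} \<in> directions F I Wl"
    "inj_on (\<lambda>a. {x \<in> F. a \<bullet> x = 0}) D"
    "\<forall>a\<in>D. finite (Q a)"
    "\<forall>i\<in>I. \<forall>x\<in>top_of_set F frontier_of Wl i. \<exists>a\<in>D. a \<bullet> x \<in> Q a"
proof -
  obtain \<H> where \<H>: "finite \<H>" "\<H> \<subseteq> supporting_hyperplanes F I Wl"
    "\<And>i. i \<in> I \<Longrightarrow> top_of_set F frontier_of Wl i \<subseteq> \<Union>\<H>"
    by (rule supporting_hyperplanes_cover) (rule that)
  define dir where "dir = (\<lambda>H :: 'a set. {x - y |x y. x \<in> H \<and> y \<in> H})"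
  define D where "D = (\<lambda>H. normal (dir H)) ` \<H>"
  define Q where "Q = (\<lambda>a. (\<lambda>H. a \<bullet> (SOME h. h \<in> H)) ` \<H>)"
  have dir: "dir H \<in> directions F I Wl" if "H \<in> \<H>" for H
    using that \<H>(2) unfolding dir_def directions_def by blast
  have nD: "\<exists>V\<in>directions F I Wl. a = normal V" if "a \<in> D" for a
    using that dir unfolding D_def by blast
  show ?thesis
  proof (rule that[of D Q])
    show "finite D" "\<forall>a\<in>D. finite (Q a)"
      unfolding D_def Q_def using \<H>(1) by auto
    show "D \<subseteq> F" "0 \<notin> D"
      using nD normal(1,2) by fastforce+
    show "\<forall>a\<in>D. {x \<in> F. a \<bullet> x = 0} \<in> directions F I Wl"
      using nD normal(3) by metis
    show "inj_on (\<lambda>a. {x \<in> F. a \<bullet> x = 0}) D"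
      using nD normal(3) by (intro inj_onI) metis
    show "\<forall>i\<in>I. \<forall>x\<in>top_of_set F frontier_of Wl i. \<exists>a\<in>D. a \<bullet> x \<in> Q a"
    proof (intro ballI)
      fix i x assume "i \<in> I" "x \<in> top_of_set F frontier_of Wl i"
      then obtain H where H: "H \<in> \<H>" "x \<in> H"
        using \<H>(3) by blast
      then have "normal (dir H) \<bullet> x = normal (dir H) \<bullet> (SOME h. h \<in> H)"
        using \<H>(2) supporting_hyperplane_offset[OF _ dir_def[THEN fun_cong], of H x]
        by (metis (mono_tags, lifting) someI subsetD)
      then show "\<exists>a\<in>D. a \<bullet> x \<in> Q a"
        using H(1) unfolding D_def Q_def by blast
    qed
  qed
qed

lemma window_interior:
  obtains i x e where "i \<in> I" "x \<in> F" "e > 0" "ball x e \<inter> F \<subseteq> Wl i"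
proof -
  obtain i where i: "i \<in> I" "Wl i \<noteq> {}"
    using window(2) labelling unfolding polytopal_labelling_def by auto
  have "Wl i = top_of_set F closure_of (top_of_set F interior_of Wl i)"
    using label_polytopal[OF i(1)] unfolding polytopal_def by blast
  then have "top_of_set F interior_of Wl i \<noteq> {}"
    using i(2) by (metis closure_of_empty)
  then obtain x where x: "x \<in> top_of_set F interior_of Wl i" by blast
  have "openin (top_of_set F) (top_of_set F interior_of Wl i)"
    by simp
  with x obtain e where "e > 0" "ball x e \<inter> F \<subseteq> top_of_set F interior_of Wl i"
    by (metis openin_contains_ball)
  moreover have "top_of_set F interior_of Wl i \<subseteq> Wl i"
    by (rule interior_of_subset)
  moreover have "x \<in> F"
    using x calculation(3) label_subset_internal[OF i(1)] by blast
  ultimately show ?thesis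
    using that i(1) by blast
qed

text \<open>A line orthogonal to all normals that misses the hyperplanes could not leave the window.\<close>

lemma normals_separating:
  assumes D: "finite D" "D \<subseteq> F" "0 \<notin> D" "\<forall>a\<in>D. finite (Q a)"
    and cover: "\<forall>i\<in>I. \<forall>x\<in>top_of_set F frontier_of Wl i. \<exists>a\<in>D. a \<bullet> x \<in> Q a"
  shows "\<forall>u\<in>F. (\<forall>a\<in>D. a \<bullet> u = 0) \<longrightarrow> u = 0"
proof (intro ballI impI, rule ccontr)
  fix u assume u: "u \<in> F" "\<forall>a\<in>D. a \<bullet> u = 0" "u \<noteq> 0"
  obtain i x e where i: "i \<in> I" "x \<in> F" "e > 0" "ball x e \<inter> F \<subseteq> Wl i"
    by (rule window_interior)
  have "\<exists>y\<in>F. dist y x < e \<and> (\<forall>(a, b)\<in>Sigma D Q. a \<bullet> y \<noteq> b)"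
    using D i(2,3) by (intro hyperplanes_avoidable[OF subspace_internal]) auto
  then obtain y where y: "y \<in> F" "dist y x < e" "\<forall>a\<in>D. a \<bullet> y \<notin> Q a"
    by blast
  define L where "L = range (\<lambda>t. y + t *\<^sub>R u)"
  have "y \<in> Wl i"
    using y i(4) by (auto simp: dist_commute)
  moreover have "y \<in> L"
    unfolding L_def by (rule range_eqI[of _ _ 0]) simp
  moreover have "\<not> L \<subseteq> Wl i"
  proof
    assume "L \<subseteq> Wl i"
    then have "L \<subseteq> W"
      using label_subset[OF i(1)] by blast
    then have "bounded L"
      using window_compact compact_imp_bounded bounded_subset by blast
    then obtain M where M: "\<And>t. norm (y + t *\<^sub>R u) \<le> M"
      unfolding L_def bounded_iff by blast
    \<comment> \<open>Chosen so that \<open>t *\<^sub>R u\<close> is longer than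
      \<open>M + norm y\<close>, which contradicts the bound \<open>M\<close> along the
      line.\<close>
    define t where "t = (M + norm y + 1) / norm u"
    have "norm (t *\<^sub>R u) \<le> norm (y + t *\<^sub>R u) + norm y"
      using norm_triangle_ineq4[of "y + t *\<^sub>R u" y] by simp
    moreover have "norm (t *\<^sub>R u) = \<bar>M + norm y + 1\<bar>"
      unfolding t_def using u(3) by simp
    ultimately show False
      using M[of t] by linarith
  qed
  moreover have "connected L"
    unfolding L_def by (intro connected_continuous_image continuous_intros connected_UNIV)
  moreover have "L \<subseteq> F"
    unfolding L_def using y(1) u(1) subspace_internal by (auto simp: subspace_add subspace_scale)
  ultimately have "L \<inter> top_of_set F frontier_of Wl i \<noteq> {}"
    by (intro connectedin_Int_frontier_of) (auto simp: connectedin_subtopology)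
  then obtain t where "y + t *\<^sub>R u \<in> top_of_set F frontier_of Wl i"
    unfolding L_def by blast
  then obtain a where "a \<in> D" "a \<bullet> (y + t *\<^sub>R u) \<in> Q a"
    using cover i(1) by blast
  then show False
    using u(2) y(3) by (simp add: inner_add_right)
qed

text \<open>Patches are cut out by \<open>N\<close> in physical space, while lattice points are
  counted by \<open>norm\<close> in the total space. For bounded internal part the first controls
  the second up to a factor, and \<open>r \<ge> 1\<close> lets the internal bound \<open>c\<close>
  be absorbed into it.\<close>

lemma phys_ball_subset_slab:
  assumes N: "norm_on E N" and c: "c > 0"
  shows "\<exists>A\<ge>1. \<forall>r\<ge>1. {\<delta> \<in> \<Gamma>. N (phys \<delta>) \<le> r \<and> norm (intl \<delta>) \<le> c} \<subseteq> slab \<Gamma> intl (A * r) c"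
proof -
  obtain k where k: "k > 0" "\<forall>x\<in>E. k * norm x \<le> N x"
    using norm_on_equivalent[OF N subspace_physical] by meson
  define A where "A = 1 + 1 / k + c"
  have "A \<ge> 1"
    unfolding A_def using k c by simp
  moreover have "norm \<delta> \<le> A * r" if r: "r \<ge> 1" and \<delta>: "N (phys \<delta>) \<le> r" "norm (intl \<delta>) \<le> c" for r \<delta>
  proof -
    have "k * norm (phys \<delta>) \<le> r"
      using k(2) phys_in[of \<delta>] \<delta>(1) by force
    then have "norm (phys \<delta>) \<le> 1 / k * r"
      using k(1) by (simp add: field_simps)
    moreover have "norm \<delta> \<le> norm (phys \<delta>) + norm (intl \<delta>)"
      using norm_triangle_ineq[of "phys \<delta>" "intl \<delta>"] proj_add_proj[OF complementary, of \<delta>] by simp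
    moreover have "c \<le> c * r" "A * r = r + 1 / k * r + c * r"
      unfolding A_def using c r by (simp_all add: algebra_simps)
    ultimately show ?thesis
      using \<delta>(2) r by linarith
  qed
  ultimately show ?thesis
    unfolding slab_def by blast
qed

text \<open>The converse comparison: boundedness of the linear map \<open>phys\<close> controls
  \<open>N (phys \<delta>)\<close> by \<open>norm \<delta>\<close>, whatever the internal
  part.\<close>

lemma slab_subset_phys_ball:
  assumes N: "norm_on E N"
  shows "\<exists>A\<ge>1. \<forall>r c. slab \<Gamma> intl (r / A) c \<subseteq> {\<delta> \<in> \<Gamma>. N (phys \<delta>) \<le> r \<and> norm (intl \<delta>) \<le> c}"
proof -
  obtain K where K: "K > 0" "\<forall>x\<in>E. N x \<le> K * norm x"
    using norm_on_equivalent[OF N subspace_physical] by meson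
  obtain P where P: "P > 0" "\<And>x. norm (phys x) \<le> P * norm x"
    using linear_bounded_pos[OF linear_phys] by blast
  define A where "A = 1 + K * P"
  have A: "A \<ge> 1" "K * P \<le> A"
    unfolding A_def using K P by simp_all
  moreover have "N (phys \<delta>) \<le> r" if "norm \<delta> \<le> r / A" for r \<delta>
  proof -
    have "N (phys \<delta>) \<le> K * norm (phys \<delta>)"
      using K(2) phys_in by blast
    also have "\<dots> \<le> K * (P * norm \<delta>)"
      using K(1) P(2) by (intro mult_left_mono) auto
    also have "\<dots> \<le> A * norm \<delta>"
      using A(2) mult_right_mono[of "K * P" A "norm \<delta>"] by (simp add: mult.assoc)
    also have "\<dots> \<le> r"
      using that A(1) by (simp add: field_simps)
    finally show ?thesis .
  qed
  ultimately show ?thesis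
    unfolding slab_def by blast
qed

end

section \<open>Upper bound\<close>

context polytopal_scheme
begin

lemma lattice_point_off_frontier:
  assumes "y \<in> intl ` \<Gamma>" "\<delta> \<in> \<Gamma>" "i \<in> I"
  shows "y + intl \<delta> \<notin> top_of_set F frontier_of Wl i"
proof -
  obtain \<gamma> where "\<gamma> \<in> \<Gamma>" "y = intl \<gamma>" using assms(1) by blast
  then have "y + intl \<delta> = intl (\<gamma> + \<delta>)" "\<gamma> + \<delta> \<in> \<Gamma>"
    using linear_intl assms(2) by (simp_all add: linear_add lattice_add)
  then show ?thesis
    using non_singular assms(3) by metis
qed

text \<open>Non-singularity keeps \<open>y\<close> off the translated frontiers, but not off the
  full hyperplanes carrying them. Near \<open>y\<close> the finitely many memberships do not change,
  and in that neighbourhood the hyperplanes can be avoided. The distance bound \<open>1\<close>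
  later keeps the perturbed points in a fixed ball.\<close>

lemma generic_point:
  assumes y: "y \<in> intl ` \<Gamma>" and \<Delta>: "finite \<Delta>" "\<Delta> \<subseteq> \<Gamma>"
    and S: "finite S" "\<And>a b. (a, b) \<in> S \<Longrightarrow> a \<in> F \<and> a \<noteq> 0"
  shows "\<exists>y'\<in>F. dist y' y < 1 \<and> (\<forall>(a, b)\<in>S. a \<bullet> y' \<noteq> b) \<and>
    (\<forall>\<delta>\<in>\<Delta>. \<forall>i\<in>I. y' + intl \<delta> \<in> Wl i \<longleftrightarrow> y + intl \<delta> \<in> Wl i)"
proof -
  have yF: "y \<in> F"
    using y intl_in by blast
  have "\<forall>\<^sub>F q in nhds y. \<forall>\<delta>\<in>\<Delta>. \<forall>i\<in>I. q \<in> F \<longrightarrow> (q + intl \<delta> \<in> Wl i \<longleftrightarrow> y + intl \<delta> \<in> Wl i)"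
  proof (intro eventually_ball_finite ballI \<Delta>(1) finite_labels)
    fix \<delta> i assume "\<delta> \<in> \<Delta>" and i: "i \<in> I"
    then have \<delta>: "\<delta> \<in> \<Gamma>" using \<Delta>(2) by blast
    have "((\<lambda>q. q + intl \<delta>) \<longlongrightarrow> y + intl \<delta>) (nhds y)"
      by (intro tendsto_intros filterlim_ident)
    moreover have "\<forall>\<^sub>F q in nhds (y + intl \<delta>). q \<in> F \<longrightarrow> (q \<in> Wl i \<longleftrightarrow> y + intl \<delta> \<in> Wl i)"
      using yF intl_in subspace_internal label_subset_internal[OF i] lattice_point_off_frontier[OF y \<delta> i]
      by (intro eventually_mem_iff_off_frontier) (auto simp: subspace_add)
    ultimately have "\<forall>\<^sub>F q in nhds y. q + intl \<delta> \<in> F \<longrightarrow> (q + intl \<delta> \<in> Wl i \<longleftrightarrow> y + intl \<delta> \<in> Wl i)"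
      by (rule eventually_compose_filterlim[rotated])
    then show "\<forall>\<^sub>F q in nhds y. q \<in> F \<longrightarrow> (q + intl \<delta> \<in> Wl i \<longleftrightarrow> y + intl \<delta> \<in> Wl i)"
      using intl_in subspace_internal by (auto elim!: eventually_mono simp: subspace_add)
  qed
  then obtain e where e: "e > 0" "\<forall>q. dist q y < e \<longrightarrow>
      (\<forall>\<delta>\<in>\<Delta>. \<forall>i\<in>I. q \<in> F \<longrightarrow> (q + intl \<delta> \<in> Wl i \<longleftrightarrow> y + intl \<delta> \<in> Wl i))"
    unfolding eventually_nhds_metric by blast
  have "\<exists>y'\<in>F. dist y' y < min e 1 \<and> (\<forall>(a, b)\<in>S. a \<bullet> y' \<noteq> b)"
    using S yF e(1) by (intro hyperplanes_avoidable[OF subspace_internal]) auto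
  then show ?thesis
    using e(2) by auto
qed

text \<open>A segment leaving \<open>Wl i\<close> meets its frontier and hence a wall. Along the
  segment the value of the normal of that wall is a convex combination of two values strictly on one
  side of the wall, so the wall cannot be met.\<close>

lemma label_constant_on_cell:
  assumes i: "i \<in> I" and cover: "\<forall>x\<in>top_of_set F frontier_of Wl i. \<exists>a\<in>D. a \<bullet> x \<in> Q a"
    and F: "z1 \<in> F" "z2 \<in> F" "d \<in> F"
    and same: "\<forall>a\<in>D. \<forall>q\<in>Q a. a \<bullet> z1 \<noteq> q - a \<bullet> d \<and> a \<bullet> z2 \<noteq> q - a \<bullet> d \<and>
      (q - a \<bullet> d < a \<bullet> z1 \<longleftrightarrow> q - a \<bullet> d < a \<bullet> z2)"
    and mem: "z1 + d \<in> Wl i"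
  shows "z2 + d \<in> Wl i"
proof (rule ccontr)
  assume "z2 + d \<notin> Wl i"
  moreover have "closed_segment (z1 + d) (z2 + d) \<subseteq> F"
    using F subspace_internal by (intro closed_segment_subset subspace_imp_convex) (auto simp: subspace_add)
  ultimately have "closed_segment (z1 + d) (z2 + d) \<inter> top_of_set F frontier_of Wl i \<noteq> {}"
    using mem ends_in_segment by (intro connectedin_Int_frontier_of) (auto simp: connectedin_subtopology)
  then obtain p where p: "p \<in> closed_segment (z1 + d) (z2 + d)" "p \<in> top_of_set F frontier_of Wl i"
    by blast
  obtain u where u: "0 \<le> u" "u \<le> 1" "p = (1 - u) *\<^sub>R (z1 + d) + u *\<^sub>R (z2 + d)"
    using p(1) unfolding closed_segment_def by blast
  obtain a where a: "a \<in> D" "a \<bullet> p \<in> Q a"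
    using cover p(2) by blast
  define t where "t = a \<bullet> p - a \<bullet> d"
  have t: "t = (1 - u) * (a \<bullet> z1) + u * (a \<bullet> z2)"
    unfolding t_def u(3) by (simp add: inner_add_right algebra_simps)
  have s: "a \<bullet> z1 \<noteq> t" "a \<bullet> z2 \<noteq> t" "t < a \<bullet> z1 \<longleftrightarrow> t < a \<bullet> z2"
    using same a unfolding t_def by blast+
  show False
  proof (cases "t < a \<bullet> z1")
    case True
    then have "(1 - u) * (- (a \<bullet> z1)) + u * (- (a \<bullet> z2)) < - t"
      using s u(1,2) by (intro convex_bound_lt) auto
    then show False using t by simp
  next
    case False
    then have "(1 - u) * (a \<bullet> z1) + u * (a \<bullet> z2) < t"
      using s u(1,2) by (intro convex_bound_lt) auto
    then show False using t by simp
  qed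
qed

lemma flag_exponent_image:
  assumes "inj_on (\<lambda>a. {x \<in> F. a \<bullet> x = 0}) J"
  shows "flag_exponent E F \<Gamma> ((\<lambda>a. {x \<in> F. a \<bullet> x = 0}) ` J)
    = (\<Sum>a\<in>J. hyperplane_exponent E F \<Gamma> {x \<in> F. a \<bullet> x = 0})"
  unfolding flag_exponent_def using assms by (simp add: sum.reindex)

text \<open>Extending faces to whole walls only refines the partition according to codes, so the
  number of cells is an upper bound; counting cells by vertices turns it into a sum over
  flags.\<close>

lemma codes_upper:
  assumes N: "norm_on E N"
    and D: "finite D" "D \<subseteq> F" "0 \<notin> D" "inj_on (\<lambda>a. {x \<in> F. a \<bullet> x = 0}) D" "\<forall>a\<in>D. finite (Q a)"
    and cover: "\<forall>i\<in>I. \<forall>x\<in>top_of_set F frontier_of Wl i. \<exists>a\<in>D. a \<bullet> x \<in> Q a"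
  shows "\<exists>C>0. \<forall>r\<ge>1. finite (code N r ` (intl ` \<Gamma> \<inter> W)) \<and>
    real (card (code N r ` (intl ` \<Gamma> \<inter> W))) \<le> C * (\<Sum>J\<in>flag_normals F D.
      r powr real_of_int (flag_exponent E F \<Gamma> ((\<lambda>a. {x \<in> F. a \<bullet> x = 0}) ` J)))"
proof -
  define \<alpha> where "\<alpha> = (\<lambda>a. real_of_int (hyperplane_exponent E F \<Gamma> {x \<in> F. a \<bullet> x = 0}))"
  obtain R where R: "R > 0" "\<forall>w\<in>W. norm w \<le> R"
    using compact_imp_bounded[OF window_compact] unfolding bounded_pos by blast
  \<comment> \<open>If \<open>y\<close> and \<open>y + intl \<delta>\<close> both lie in the window,
    then \<open>intl \<delta>\<close> has norm at most \<open>2 * R\<close>.\<close>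
  define c where "c = 2 * R"
  have c: "c > 0" using R unfolding c_def by simp
  obtain A where A: "A \<ge> 1"
    "\<forall>r\<ge>1. {\<delta> \<in> \<Gamma>. N (phys \<delta>) \<le> r \<and> norm (intl \<delta>) \<le> c} \<subseteq> slab \<Gamma> intl (A * r) c"
    using phys_ball_subset_slab[OF N c] by meson
  have Ar: "A * r \<ge> 1" if "r \<ge> 1" for r
    using A(1) that by (metis mult_mono' mult_1 zero_le_one)
  define \<Delta> where "\<Delta> = (\<lambda>r. slab \<Gamma> intl (A * r) c)"
  have fin\<Delta>: "finite (\<Delta> r)" if "r \<ge> 1" for r
    using slab_lattice_card[OF c] Ar[OF that] unfolding \<Delta>_def by blast
  \<comment> \<open>Artificial outer walls at \<open>- M a\<close> and \<open>M a\<close> enclose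
    all points considered, so that walls exist on both sides. Perturbed points have norm at most
    \<open>R + 1\<close>, and the final \<open>1\<close> keeps them strictly inside.\<close>
  define M where "M = (\<lambda>a :: 'a. norm a * (R + 1) + 1)"
  define T where "T = (\<lambda>r a. (\<lambda>(q, t). q - t) ` (Q a \<times> (\<lambda>\<delta>. a \<bullet> intl \<delta>) ` \<Delta> r) \<union> {- M a, M a})"
  have finT: "\<forall>a\<in>D. finite (T r a)" if "r \<ge> 1" for r
    unfolding T_def using D(5) fin\<Delta>[OF that] by auto
  have "\<forall>a\<in>D. \<exists>b>0. \<forall>r\<ge>1. real (card (T r a)) \<le> b * r powr \<alpha> a"
  proof
    fix a assume a: "a \<in> D"
    obtain k where k: "k > 0" "\<forall>r\<ge>1. real (card ((\<lambda>\<gamma>. a \<bullet> intl \<gamma>) ` slab \<Gamma> intl r c)) \<le> k * r powr \<alpha> a"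
      using offsets_card[OF c refl, of a] unfolding \<alpha>_def by meson
    define q where "q = card (Q a) + 2"
    have "real (card (T r a)) \<le> (real q * k * A powr \<alpha> a) * r powr \<alpha> a" if r: "r \<ge> 1" for r
    proof -
      let ?O = "(\<lambda>\<delta>. a \<bullet> intl \<delta>) ` \<Delta> r"
      have finO: "finite ?O"
        using fin\<Delta>[OF r] by simp
      \<comment> \<open>This makes the set of offsets nonempty, so the two outer walls can be
        charged to it; hence \<open>q = card (Q a) + 2\<close>.\<close>
      have "0 \<in> \<Delta> r"
        unfolding \<Delta>_def slab_def using subspace_lattice int_module.subspace_0 linear_intl c Ar[OF r]
        by (auto simp: linear_0)
      then have "card ?O > 0"
        using finO by (auto simp: card_gt_0_iff)
      have "card (T r a) \<le> card ((\<lambda>(q, t). q - t) ` (Q a \<times> ?O)) + card {- M a, M a}"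
        unfolding T_def by (rule card_Un_le)
      also have "\<dots> \<le> card (Q a \<times> ?O) + 2"
        using D(5) a finO by (intro add_mono card_image_le) (auto simp: card_insert_if)
      also have "\<dots> \<le> q * card ?O"
        unfolding q_def card_cartesian_product add_mult_distrib using \<open>card ?O > 0\<close> by simp
      finally have "real (card (T r a)) \<le> real q * real (card ?O)"
        unfolding of_nat_mult[symmetric] of_nat_le_iff .
      also have "\<dots> \<le> real q * (k * (A * r) powr \<alpha> a)"
        using k(2) Ar[OF r] unfolding \<Delta>_def by (intro mult_left_mono) auto
      finally show ?thesis
        using A(1) r by (simp add: powr_mult mult_ac)
    qed
    moreover have "real q * k * A powr \<alpha> a > 0"
      using k(1) A(1) unfolding q_def by simp
    ultimately show "\<exists>b>0. \<forall>r\<ge>1. real (card (T r a)) \<le> b * r powr \<alpha> a"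
      by blast
  qed
  from bchoice[OF this] obtain b where b: "\<forall>a\<in>D. b a > 0 \<and> (\<forall>r\<ge>1. real (card (T r a)) \<le> b a * r powr \<alpha> a)"
    by blast
  define B where "B = 1 + (\<Sum>a\<in>D. b a)"
  have B: "B > 0"
    unfolding B_def using b by (intro add_pos_nonneg sum_nonneg) (auto simp: less_imp_le)
  have bB: "b a \<le> B" if "a \<in> D" for a
  proof -
    have "b a \<le> (\<Sum>a\<in>D. b a)"
      using that b D(1) by (intro member_le_sum) (auto simp: less_imp_le)
    then show ?thesis unfolding B_def by simp
  qed
  have prod_le: "real (\<Prod>a\<in>J. card (T r a)) \<le> B ^ dim F *
      r powr real_of_int (flag_exponent E F \<Gamma> ((\<lambda>a. {x \<in> F. a \<bullet> x = 0}) ` J))"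
    if J: "J \<in> flag_normals F D" and r: "r \<ge> 1" for J r
  proof -
    have JD: "J \<subseteq> D" "card J = dim F"
      using J unfolding flag_normals_def by auto
    have "real (\<Prod>a\<in>J. card (T r a)) \<le> (\<Prod>a\<in>J. B * r powr \<alpha> a)"
      unfolding of_nat_prod
    proof (rule prod_mono, rule conjI)
      fix a assume a: "a \<in> J"
      have "real (card (T r a)) \<le> b a * r powr \<alpha> a"
        using b a JD(1) r by blast
      also have "\<dots> \<le> B * r powr \<alpha> a"
        using bB a JD(1) by (intro mult_right_mono) auto
      finally show "real (card (T r a)) \<le> B * r powr \<alpha> a" .
    qed simp
    also have "\<dots> = B ^ dim F * r powr (\<Sum>a\<in>J. \<alpha> a)"
      using r JD(2) D(1) JD(1) by (simp add: prod.distrib powr_sum finite_subset)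
    also have "(\<Sum>a\<in>J. \<alpha> a) = real_of_int (flag_exponent E F \<Gamma> ((\<lambda>a. {x \<in> F. a \<bullet> x = 0}) ` J))"
      unfolding \<alpha>_def using flag_exponent_image[OF inj_on_subset[OF D(4) JD(1)]] by simp
    finally show ?thesis .
  qed
  have main: "finite (code N r ` (intl ` \<Gamma> \<inter> W)) \<and> real (card (code N r ` (intl ` \<Gamma> \<inter> W)))
      \<le> (2 ^ card D * B ^ dim F) * (\<Sum>J\<in>flag_normals F D.
      r powr real_of_int (flag_exponent E F \<Gamma> ((\<lambda>a. {x \<in> F. a \<bullet> x = 0}) ` J)))" if r: "r \<ge> 1" for r
  proof -
    let ?Y = "intl ` \<Gamma> \<inter> W"
    have "\<forall>y\<in>?Y. \<exists>y'. y' \<in> F \<and> dist y' y < 1 \<and> (\<forall>(a, b)\<in>Sigma D (T r). a \<bullet> y' \<noteq> b) \<and>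
        (\<forall>\<delta>\<in>\<Delta> r. \<forall>i\<in>I. y' + intl \<delta> \<in> Wl i \<longleftrightarrow> y + intl \<delta> \<in> Wl i)"
    proof
      fix y assume y: "y \<in> ?Y"
      have "\<Delta> r \<subseteq> \<Gamma>"
        unfolding \<Delta>_def slab_def by blast
      moreover have "finite (Sigma D (T r))"
        using D(1) finT[OF r] by auto
      ultimately have "\<exists>y'\<in>F. dist y' y < 1 \<and> (\<forall>(a, b)\<in>Sigma D (T r). a \<bullet> y' \<noteq> b) \<and>
        (\<forall>\<delta>\<in>\<Delta> r. \<forall>i\<in>I. y' + intl \<delta> \<in> Wl i \<longleftrightarrow> y + intl \<delta> \<in> Wl i)"
        using y D(2,3) by (intro generic_point fin\<Delta>[OF r]) auto
      then show "\<exists>y'. y' \<in> F \<and> dist y' y < 1 \<and> (\<forall>(a, b)\<in>Sigma D (T r). a \<bullet> y' \<noteq> b) \<and>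
        (\<forall>\<delta>\<in>\<Delta> r. \<forall>i\<in>I. y' + intl \<delta> \<in> Wl i \<longleftrightarrow> y + intl \<delta> \<in> Wl i)"
        by blast
    qed
    \<comment> \<open>\<open>\<phi> y\<close> has the same memberships as \<open>y\<close> for every
      displacement in \<open>\<Delta> r\<close>, but it lies in an open cell.\<close>
    from bchoice[OF this] obtain \<phi> where \<phi>: "\<forall>y\<in>?Y. \<phi> y \<in> F \<and> dist (\<phi> y) y < 1 \<and>
        (\<forall>(a, b)\<in>Sigma D (T r). a \<bullet> \<phi> y \<noteq> b) \<and>
        (\<forall>\<delta>\<in>\<Delta> r. \<forall>i\<in>I. \<phi> y + intl \<delta> \<in> Wl i \<longleftrightarrow> y + intl \<delta> \<in> Wl i)"
      by blast
    define \<sigma> where "\<sigma> = (\<lambda>y. {(a, t). a \<in> D \<and> t \<in> T r a \<and> t < a \<bullet> y})"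
    \<comment> \<open>Every displacement in the code of a window point lies in the finite set
      \<open>\<Delta> r\<close>, so agreement of memberships over \<open>\<Delta> r\<close> forces
      equal codes.\<close>
    have mem_code: "(\<delta>, i) \<in> code N r y \<longleftrightarrow> \<delta> \<in> \<Delta> r \<and> N (phys \<delta>) \<le> r \<and> i \<in> I \<and> y + intl \<delta> \<in> Wl i"
      if y: "y \<in> ?Y" for y \<delta> i
    proof -
      have "norm (intl \<delta>) \<le> c" if "i \<in> I" "y + intl \<delta> \<in> Wl i"
      proof -
        have "norm (y + intl \<delta>) \<le> R" "norm y \<le> R"
          using that label_subset R(2) y by blast+
        then show ?thesis
          using norm_triangle_ineq4[of "y + intl \<delta>" y] unfolding c_def by simp
      qed
      then have "i \<in> I \<Longrightarrow> y + intl \<delta> \<in> Wl i \<Longrightarrow> \<delta> \<in> \<Gamma> \<Longrightarrow> N (phys \<delta>) \<le> r \<Longrightarrow> \<delta> \<in> \<Delta> r"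
        using A(2) r unfolding \<Delta>_def by blast
      moreover have "\<Delta> r \<subseteq> \<Gamma>"
        unfolding \<Delta>_def slab_def by blast
      ultimately show ?thesis
        unfolding code_def by blast
    qed
    have step: "\<phi> y2 + intl \<delta> \<in> Wl i"
      if y: "y1 \<in> ?Y" "y2 \<in> ?Y" "\<sigma> (\<phi> y1) = \<sigma> (\<phi> y2)" and \<delta>: "\<delta> \<in> \<Delta> r" and i: "i \<in> I"
        and mem: "\<phi> y1 + intl \<delta> \<in> Wl i" for y1 y2 \<delta> i
    proof (rule label_constant_on_cell[OF i _ _ _ _ _ mem])
      show "\<forall>x\<in>top_of_set F frontier_of Wl i. \<exists>a\<in>D. a \<bullet> x \<in> Q a"
        using cover i by blast
      show "\<phi> y1 \<in> F" "\<phi> y2 \<in> F" "intl \<delta> \<in> F"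
        using \<phi> y intl_in by blast+
      show "\<forall>a\<in>D. \<forall>q\<in>Q a. a \<bullet> \<phi> y1 \<noteq> q - a \<bullet> intl \<delta> \<and> a \<bullet> \<phi> y2 \<noteq> q - a \<bullet> intl \<delta> \<and>
          (q - a \<bullet> intl \<delta> < a \<bullet> \<phi> y1 \<longleftrightarrow> q - a \<bullet> intl \<delta> < a \<bullet> \<phi> y2)"
      proof (intro ballI)
        fix a q assume a: "a \<in> D" and q: "q \<in> Q a"
        define t where "t = q - a \<bullet> intl \<delta>"
        have t: "t \<in> T r a"
          unfolding t_def T_def using q \<delta> by (intro UnI1 image_eqI[of _ _ "(q, a \<bullet> intl \<delta>)"]) auto
        then have "a \<bullet> \<phi> y1 \<noteq> t" "a \<bullet> \<phi> y2 \<noteq> t"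
          using \<phi> y a by fast+
        moreover have "(a, t) \<in> \<sigma> (\<phi> y1) \<longleftrightarrow> (a, t) \<in> \<sigma> (\<phi> y2)"
          using y(3) by simp
        then have "t < a \<bullet> \<phi> y1 \<longleftrightarrow> t < a \<bullet> \<phi> y2"
          using a t unfolding \<sigma>_def by simp
        ultimately show "a \<bullet> \<phi> y1 \<noteq> q - a \<bullet> intl \<delta> \<and> a \<bullet> \<phi> y2 \<noteq> q - a \<bullet> intl \<delta> \<and>
          (q - a \<bullet> intl \<delta> < a \<bullet> \<phi> y1 \<longleftrightarrow> q - a \<bullet> intl \<delta> < a \<bullet> \<phi> y2)"
          unfolding t_def by simp
      qed
    qed
    have code_eq: "code N r y1 = code N r y2"
      if y: "y1 \<in> ?Y" "y2 \<in> ?Y" "\<sigma> (\<phi> y1) = \<sigma> (\<phi> y2)" for y1 y2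
    proof -
      have "y1 + intl \<delta> \<in> Wl i \<longleftrightarrow> y2 + intl \<delta> \<in> Wl i" if "\<delta> \<in> \<Delta> r" "i \<in> I" for \<delta> i
      proof -
        have "y1 + intl \<delta> \<in> Wl i \<longleftrightarrow> \<phi> y1 + intl \<delta> \<in> Wl i" "y2 + intl \<delta> \<in> Wl i \<longleftrightarrow> \<phi> y2 + intl \<delta> \<in> Wl i"
          using \<phi> y that by blast+
        then show ?thesis
          using step[OF y that] step[OF y(2,1) y(3)[symmetric] that] by blast
      qed
      then have "x \<in> code N r y1 \<longleftrightarrow> x \<in> code N r y2" for x
        using mem_code[OF y(1)] mem_code[OF y(2)] by (cases x) metis
      then show ?thesis by blast
    qed
    have sep: "\<forall>u\<in>F. (\<forall>a\<in>D. a \<bullet> u = 0) \<longrightarrow> u = 0"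
      by (rule normals_separating[OF D(1-3,5) cover])
    have bd: "\<forall>y\<in>\<phi> ` ?Y. \<forall>a\<in>D. a \<bullet> y \<notin> T r a \<and> (\<exists>t\<in>T r a. t < a \<bullet> y) \<and> (\<exists>t\<in>T r a. a \<bullet> y < t)"
    proof (intro ballI)
      fix y' a assume "y' \<in> \<phi> ` ?Y" and a: "a \<in> D"
      then obtain y where y: "y \<in> ?Y" "y' = \<phi> y" by blast
      have "norm y' \<le> norm y + dist y' y"
        using norm_triangle_ineq2[of y' y] by (simp add: dist_norm)
      also have "\<dots> \<le> R + 1"
        using y \<phi> R(2) by (intro add_mono) (auto simp: less_imp_le)
      finally have "\<bar>a \<bullet> y'\<bar> \<le> norm a * (R + 1)"
        using Cauchy_Schwarz_ineq2[of a y'] mult_left_mono[of "norm y'" "R + 1" "norm a"] by simp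
      then have "- M a < a \<bullet> y'" "a \<bullet> y' < M a"
        unfolding M_def by linarith+
      moreover have "a \<bullet> y' \<notin> T r a"
        using \<phi> y a by fast
      ultimately show "a \<bullet> y' \<notin> T r a \<and> (\<exists>t\<in>T r a. t < a \<bullet> y') \<and> (\<exists>t\<in>T r a. a \<bullet> y' < t)"
        unfolding T_def by blast
    qed
    have subF: "\<phi> ` ?Y \<subseteq> F"
      using \<phi> by blast
    note cells = card_cells_le[OF subspace_internal D(1,2) sep finT[OF r] bd subF, folded \<sigma>_def]
    have fin: "finite ((\<lambda>y. \<sigma> (\<phi> y)) ` ?Y)"
      using cells(1) by (simp add: image_image)
    have finc: "finite (code N r ` ?Y)"
      using fin by (rule card_image_le_factor) (rule code_eq)
    have "card (code N r ` ?Y) \<le> card ((\<lambda>y. \<sigma> (\<phi> y)) ` ?Y)"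
      using fin by (rule card_image_le_factor) (rule code_eq)
    also have "\<dots> \<le> (\<Sum>J\<in>flag_normals F D. \<Prod>a\<in>J. card (T r a)) * 2 ^ card D"
      using cells(2) by (simp add: image_image)
    finally have "real (card (code N r ` ?Y)) \<le> real ((\<Sum>J\<in>flag_normals F D. \<Prod>a\<in>J. card (T r a)) * 2 ^ card D)"
      unfolding of_nat_le_iff .
    also have "\<dots> = (\<Sum>J\<in>flag_normals F D. real (\<Prod>a\<in>J. card (T r a))) * 2 ^ card D"
      by simp
    also have "\<dots> \<le> (\<Sum>J\<in>flag_normals F D. B ^ dim F *
        r powr real_of_int (flag_exponent E F \<Gamma> ((\<lambda>a. {x \<in> F. a \<bullet> x = 0}) ` J))) * 2 ^ card D"
      using prod_le[OF _ r] by (intro mult_right_mono sum_mono) auto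
    also have "\<dots> = (2 ^ card D * B ^ dim F) * (\<Sum>J\<in>flag_normals F D.
      r powr real_of_int (flag_exponent E F \<Gamma> ((\<lambda>a. {x \<in> F. a \<bullet> x = 0}) ` J)))"
      by (simp add: sum_distrib_left sum_distrib_right mult_ac)
    finally show ?thesis
      using finc by blast
  qed
  have "2 ^ card D * B ^ dim F > 0"
    using B by simp
  with main show ?thesis
    by blast
qed

end

section \<open>Lower bound and growth rate\<close>

text \<open>Separating vectors span \<open>F\<close>, and a spanning set of \<open>dim F\<close>
  vectors is a basis, so a functional with the prescribed values exists.\<close>

lemma separating_interpolation:
  fixes F :: "'a::euclidean_space set"
  assumes F: "subspace F" and D: "finite D" "D \<subseteq> F" "card D = dim F"
    and sep: "\<forall>u\<in>F. (\<forall>a\<in>D. a \<bullet> u = 0) \<longrightarrow> u = 0"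
  shows "\<exists>x\<in>F. \<forall>a\<in>D. a \<bullet> x = c a"
proof -
  have "span D = F"
    using F D(2) sep by (rule span_eq_subspace_if_separating)
  then have "independent D"
    using D by (intro card_le_dim_spanning[of D F]) auto
  then obtain g :: "'a \<Rightarrow> real" where g: "linear g" "\<forall>a\<in>D. g a = c a"
    using linear_independent_extend by blast
  obtain y z where yz: "y \<in> span F" "\<And>w. w \<in> span F \<Longrightarrow> orthogonal z w" "adjoint g 1 = y + z"
    by (rule orthogonal_subspace_decomp_exists[of F "adjoint g 1"]) (erule that; blast)
  have "y \<in> F"
    using yz(1) F by (metis span_eq_iff)
  moreover have "a \<bullet> y = c a" if a: "a \<in> D" for a
  proof -
    have "a \<bullet> adjoint g 1 = c a"
      using adjoint_works[OF g(1), of a 1] g(2) a by simp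
    moreover have "a \<bullet> z = 0"
      using yz(2)[of a] a D(2) span_base by (metis inner_commute orthogonal_def subsetD)
    ultimately show ?thesis
      unfolding yz(3) by (simp add: inner_add_right)
  qed
  ultimately show ?thesis by blast
qed

context polytopal_scheme
begin

lemma lattice_dense:
  assumes "open U" "v \<in> U" "v \<in> F"
  shows "\<exists>\<gamma>\<in>\<Gamma>. intl \<gamma> \<in> U"
proof -
  have "v \<in> top_of_set F closure_of (intl ` \<Gamma>)"
    using dense assms(3) by simp
  moreover have "openin (top_of_set F) (F \<inter> U)" "v \<in> F \<inter> U"
    using assms by (auto simp: openin_open)
  ultimately obtain y where "y \<in> intl ` \<Gamma>" "y \<in> F \<inter> U"
    unfolding in_closure_of by blast
  then show ?thesis by blast
qed

text \<open>The local half-space form of a properly supporting hyperplane enters here: near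
  \<open>w\<close> the window piece is bounded by the whole hyperplane, and no other face
  interferes.\<close>

lemma direction_halfspace:
  assumes "V \<in> directions F I Wl"
  shows "\<exists>i a w e. i \<in> I \<and> a \<in> F \<and> V = {x \<in> F. a \<bullet> x = 0} \<and> w \<in> F \<and> e > 0 \<and>
    (\<forall>x\<in>F. dist x w < e \<longrightarrow> (x \<in> Wl i \<longleftrightarrow> a \<bullet> x \<le> a \<bullet> w))"
proof -
  obtain H where H: "H \<in> supporting_hyperplanes F I Wl" "V = {x - y |x y. x \<in> H \<and> y \<in> H}"
    using assms unfolding directions_def by blast
  obtain i where i: "i \<in> I" "properly_supporting F (Wl i) H"
    using H(1) unfolding supporting_hyperplanes_def by blast
  obtain a b w U where *: "a \<in> F" "a \<noteq> 0" "H = hyperplane F a b" "w \<in> H"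
    "openin (top_of_set F) U" "w \<in> U" "Wl i \<inter> U = halfspace F a b \<inter> U"
    using i(2) unfolding properly_supporting_def by blast
  obtain e where e: "e > 0" "ball w e \<inter> F \<subseteq> U"
    using *(5,6) by (metis openin_contains_ball)
  have w: "w \<in> F" "a \<bullet> w = b"
    using *(3,4) unfolding hyperplane_def by auto
  have "x \<in> Wl i \<longleftrightarrow> a \<bullet> x \<le> a \<bullet> w" if "x \<in> F" "dist x w < e" for x
  proof -
    have "x \<in> U"
      using that e(2) by (auto simp: dist_commute)
    then have "x \<in> Wl i \<longleftrightarrow> x \<in> halfspace F a b"
      using *(7) by blast
    then show ?thesis
      using that(1) w(2) unfolding halfspace_def by simp
  qed
  moreover have "V = {x \<in> F. a \<bullet> x = 0}"
    unfolding H(2) *(3) by (rule hyperplane_direction[OF subspace_internal *(1,2)])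
  ultimately show ?thesis
    using i(1) *(1) w(1) e(1) by blast
qed

text \<open>Translating the window so that the faces of a flag nearly meet at an interior point \<open>p\<close> gives,
  near \<open>p\<close>, a grid of full hyperplanes all of whose boxes are told apart by the patches.\<close>

lemma codes_lower:
  assumes N: "norm_on E N" and f: "f \<in> flags F I Wl"
  shows "\<exists>c>0. \<exists>r0. \<forall>r\<ge>r0. finite (code N r ` (intl ` \<Gamma> \<inter> W)) \<longrightarrow>
    c * r powr real_of_int (flag_exponent E F \<Gamma> f) \<le> real (card (code N r ` (intl ` \<Gamma> \<inter> W)))"
proof -
  define \<alpha> where "\<alpha> = (\<lambda>V. real_of_int (hyperplane_exponent E F \<Gamma> V))"
  have fdir: "f \<subseteq> directions F I Wl" and cardf: "card f = dim F" and Intf: "\<Inter>f = {0}"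
    using f unfolding flags_def by auto
  have finf: "finite f" and fne: "f \<noteq> {}"
    using cardf dim_internal by (metis card.empty card.infinite not_one_le_zero)+
  define local_form where "local_form = (\<lambda>V i a w e. i \<in> I \<and> a \<in> F \<and> V = {x \<in> F. a \<bullet> x = 0} \<and>
    w \<in> F \<and> e > 0 \<and> (\<forall>x\<in>F. dist x w < e \<longrightarrow> (x \<in> Wl i \<longleftrightarrow> a \<bullet> x \<le> a \<bullet> w)))"
  have "\<forall>V\<in>f. \<exists>i a w e. local_form V i a w e"
    unfolding local_form_def using direction_halfspace fdir by blast
  from bchoice[OF this] obtain l where "\<forall>V\<in>f. \<exists>a w e. local_form V (l V) a w e" ..
  from bchoice[OF this] obtain a where "\<forall>V\<in>f. \<exists>w e. local_form V (l V) (a V) w e" ..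
  from bchoice[OF this] obtain w where "\<forall>V\<in>f. \<exists>e. local_form V (l V) (a V) (w V) e" ..
  from bchoice[OF this] obtain e where law: "\<forall>V\<in>f. local_form V (l V) (a V) (w V) (e V)" ..
  have l: "l V \<in> I" and a: "a V \<in> F" and V_eq: "V = {x \<in> F. a V \<bullet> x = 0}" and w: "w V \<in> F"
    and e: "e V > 0" if "V \<in> f" for V
    using law that unfolding local_form_def by blast+
  have half: "x \<in> Wl (l V) \<longleftrightarrow> a V \<bullet> x \<le> a V \<bullet> w V" if "V \<in> f" "x \<in> F" "dist x (w V) < e V" for V x
    using law that unfolding local_form_def by blast
  have inj_a: "inj_on a f"
    using V_eq by (intro inj_onI) metis
  have sep: "\<forall>u\<in>F. (\<forall>b\<in>a ` f. b \<bullet> u = 0) \<longrightarrow> u = 0"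
  proof (intro ballI impI)
    fix u assume u: "u \<in> F" "\<forall>b\<in>a ` f. b \<bullet> u = 0"
    have "u \<in> V" if "V \<in> f" for V
      using V_eq[OF that] u that by blast
    then show "u = 0"
      using Intf by blast
  qed
  have aF: "a ` f \<subseteq> F"
    using a by blast
  have card_af: "card (a ` f) = dim F"
    using inj_a cardf by (simp add: card_image)
  obtain K where K: "K > 0" "\<forall>z\<in>F. norm z \<le> K * (\<Sum>b\<in>a ` f. \<bar>b \<bullet> z\<bar>)"
    using norm_le_sum_inner[OF subspace_internal finite_imageI[OF finf] sep] by meson
  obtain j p \<eta>0 where p: "j \<in> I" "p \<in> F" "\<eta>0 > 0" "ball p \<eta>0 \<inter> F \<subseteq> Wl j"
    by (rule window_interior)
  \<comment> \<open>Three displacements of size at most \<eta> have to fit into the radius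
    \<open>e V\<close>: from \<open>p\<close> to \<open>y\<close>, the error in approximating
    \<open>w V - p\<close>, and the internal part of \<gamma>.\<close>
  define \<eta> where "\<eta> = min \<eta>0 (Min (e ` f) / 3)"
  have \<eta>: "\<eta> > 0" "\<eta> \<le> \<eta>0" and \<eta>e: "3 * \<eta> \<le> e V" if "V \<in> f" for V
  proof -
    have "Min (e ` f) > 0"
      using finf fne e by (subst Min_gr_iff) auto
    moreover have "Min (e ` f) \<le> e V"
      using finf that by simp
    ultimately show "\<eta> > 0" "\<eta> \<le> \<eta>0" "3 * \<eta> \<le> e V"
      unfolding \<eta>_def using p(3) by auto
  qed
  have \<eta>0: "\<eta> > 0" "\<eta> \<le> \<eta>0"
    using \<eta> fne by blast+
  have near_W: "x \<in> W" if "x \<in> F" "dist x p < \<eta>" for x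
  proof -
    have "x \<in> ball p \<eta>0"
      using that(2) \<eta>0(2) by (simp add: dist_commute)
    then show ?thesis
      using that(1) p(4) label_subset[OF p(1)] by blast
  qed
  \<comment> \<open>If every \<open>a V \<bullet> x\<close> is at most \<delta> in absolute value,
    then \<open>norm x\<close> is at most \<open>K * dim F * \<delta> = \<eta> / 2\<close>.\<close>
  define \<delta> where "\<delta> = \<eta> / (2 * K * real (dim F))"
  have \<delta>: "\<delta> > 0"
    unfolding \<delta>_def using \<eta>0(1) K(1) dim_internal by simp
  have small: "norm x < \<eta>" if "x \<in> F" "\<forall>V\<in>f. \<bar>a V \<bullet> x\<bar> \<le> \<delta>" for x
  proof -
    have "(\<Sum>b\<in>a ` f. \<bar>b \<bullet> x\<bar>) \<le> real (card (a ` f)) * \<delta>"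
      using that(2) by (intro sum_bounded_above) auto
    then have "K * (\<Sum>b\<in>a ` f. \<bar>b \<bullet> x\<bar>) \<le> K * (real (dim F) * \<delta>)"
      using K(1) unfolding card_af by (intro mult_left_mono) auto
    also have "\<dots> = \<eta> / 2"
      unfolding \<delta>_def using K(1) dim_internal by (simp del: dim_eq_0)
    finally show ?thesis
      using K(2) that(1) \<eta>0(1) by force
  qed
  define L where "L = 1 + (\<Sum>V\<in>f. norm (a V))"
  have L: "L > 0"
    unfolding L_def by (intro add_pos_nonneg sum_nonneg) auto
  have aL: "norm (a V) \<le> L" if "V \<in> f" for V
    using member_le_sum[OF that, of "\<lambda>V. norm (a V)"] finf unfolding L_def by simp
  \<comment> \<open>A displacement of size \<rho> changes the offset of a wall by at most
    \<open>\<delta> / 4\<close>. Two of them occur, so all walls stay within offset \<delta> of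
    \<open>p\<close>.\<close>
  define \<rho> where "\<rho> = min \<eta> (\<delta> / (4 * L))"
  have \<rho>: "\<rho> > 0" "\<rho> \<le> \<eta>"
    unfolding \<rho>_def using \<eta>0(1) \<delta> L by auto
  have a\<rho>: "\<bar>a V \<bullet> u\<bar> \<le> \<delta> / 4" if "V \<in> f" "norm u \<le> \<rho>" for V u
  proof -
    have "\<bar>a V \<bullet> u\<bar> \<le> norm (a V) * norm u"
      by (rule Cauchy_Schwarz_ineq2)
    also have "\<dots> \<le> L * \<rho>"
      using aL[OF that(1)] that(2) L by (intro mult_mono) auto
    also have "\<dots> \<le> L * (\<delta> / (4 * L))"
      unfolding \<rho>_def using L by (intro mult_left_mono) auto
    finally show ?thesis
      using L by simp
  qed
  \<comment> \<open>Density provides a lattice vector whose translation brings the face at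
    \<open>w V\<close> close to the common point \<open>p\<close>.\<close>
  have "\<forall>V\<in>f. \<exists>\<gamma>. \<gamma> \<in> \<Gamma> \<and> intl \<gamma> \<in> ball (w V - p) \<rho>"
    using lattice_dense[OF open_ball] w p(2) subspace_internal \<rho>(1)
    by (metis centre_in_ball subspace_diff)
  from bchoice[OF this] obtain g where g: "\<And>V. V \<in> f \<Longrightarrow> g V \<in> \<Gamma>"
    "\<And>V. V \<in> f \<Longrightarrow> norm (w V - p - intl (g V)) < \<rho>"
    by (auto simp: dist_norm)
  obtain A where A: "A \<ge> 1"
    "\<forall>r c. slab \<Gamma> intl (r / A) c \<subseteq> {\<gamma> \<in> \<Gamma>. N (phys \<gamma>) \<le> r \<and> norm (intl \<gamma>) \<le> c}"
    using slab_subset_phys_ball[OF N] by meson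
  have "\<forall>V\<in>f. \<exists>k>0. \<forall>r\<ge>1. k * r powr \<alpha> V \<le> real (card ((\<lambda>\<gamma>. a V \<bullet> intl \<gamma>) ` slab \<Gamma> intl r \<rho>))"
  proof
    fix V assume V: "V \<in> f"
    show "\<exists>k>0. \<forall>r\<ge>1. k * r powr \<alpha> V \<le> real (card ((\<lambda>\<gamma>. a V \<bullet> intl \<gamma>) ` slab \<Gamma> intl r \<rho>))"
      using offsets_card[OF \<rho>(1) V_eq[OF V]] unfolding \<alpha>_def by meson
  qed
  from bchoice[OF this] obtain k where k: "\<forall>V\<in>f. k V > 0 \<and>
      (\<forall>r\<ge>1. k V * r powr \<alpha> V \<le> real (card ((\<lambda>\<gamma>. a V \<bullet> intl \<gamma>) ` slab \<Gamma> intl r \<rho>)))"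
    by blast
  \<comment> \<open>Half of the patch radius is reserved for \<open>g V\<close> and half for
    \<gamma>; the entry \<open>2 * A\<close> makes the radius of the slab at least
    \<open>1\<close>.\<close>
  define r0 where "r0 = Max (insert (2 * A) ((\<lambda>V. 2 * N (phys (g V))) ` f))"
  have r0: "2 * A \<le> r0" "\<And>V. V \<in> f \<Longrightarrow> 2 * N (phys (g V)) \<le> r0"
    unfolding r0_def using finf by (auto intro!: Max_ge)
  define \<kappa> where "\<kappa> = (\<Prod>V\<in>f. k V * (1 / (2 * A)) powr \<alpha> V)"
  have "\<kappa> > 0"
    unfolding \<kappa>_def using k A(1) by (intro prod_pos) auto
  moreover have "\<kappa> * r powr real_of_int (flag_exponent E F \<Gamma> f) \<le> real (card (code N r ` (intl ` \<Gamma> \<inter> W)))"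
    if r: "r \<ge> r0" and fin: "finite (code N r ` (intl ` \<Gamma> \<inter> W))" for r
  proof -
    let ?Y = "intl ` \<Gamma> \<inter> W"
    define G where "G = slab \<Gamma> intl (r / 2 / A) \<rho>"
    have r1: "r / 2 / A \<ge> 1"
      using r r0(1) A(1) by (simp add: field_simps)
    have G: "\<gamma> \<in> \<Gamma>" "N (phys \<gamma>) \<le> r / 2" "norm (intl \<gamma>) \<le> \<rho>" if "\<gamma> \<in> G" for \<gamma>
      using A(2) that unfolding G_def by blast+
    have finG: "finite G"
      using slab_lattice_card[OF \<rho>(1)] r1 unfolding G_def by blast
    define s where "s = (\<lambda>V. a V \<bullet> (w V - p - intl (g V)))"
    \<comment> \<open>Positions of the walls of direction \<open>V\<close> relative to
      \<open>p\<close>. By \<open>mem_code\<close> below, each acts as a full hyperplane within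
      distance \<eta> of \<open>p\<close>.\<close>
    define T where "T = (\<lambda>V. (\<lambda>\<gamma>. s V - a V \<bullet> intl \<gamma>) ` G)"
    have finT: "finite (T V)" for V
      unfolding T_def using finG by simp
    have T_bd: "\<bar>t\<bar> < \<delta>" if V: "V \<in> f" and t: "t \<in> T V" for V t
    proof -
      obtain \<gamma> where "\<gamma> \<in> G" "t = s V - a V \<bullet> intl \<gamma>"
        using t unfolding T_def by blast
      moreover have "\<bar>s V\<bar> \<le> \<delta> / 4"
        unfolding s_def using g(2)[OF V] by (intro a\<rho>[OF V]) simp
      ultimately show ?thesis
        using a\<rho>[OF V G(3)] \<delta> by fastforce
    qed
    have cardT: "k V * (1 / (2 * A)) powr \<alpha> V * r powr \<alpha> V \<le> real (card (T V))" if V: "V \<in> f" for V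
    proof -
      have "T V = (\<lambda>x. s V - x) ` ((\<lambda>\<gamma>. a V \<bullet> intl \<gamma>) ` G)"
        unfolding T_def by (simp add: image_image)
      then have "card (T V) = card ((\<lambda>\<gamma>. a V \<bullet> intl \<gamma>) ` G)"
        by (simp add: card_image)
      moreover have "k V * (r / 2 / A) powr \<alpha> V \<le> real (card ((\<lambda>\<gamma>. a V \<bullet> intl \<gamma>) ` G))"
        using k V r1 unfolding G_def by blast
      moreover have "(r / 2 / A) powr \<alpha> V = (1 / (2 * A)) powr \<alpha> V * r powr \<alpha> V"
        using A(1) r r0(1) by (simp flip: powr_mult)
      ultimately show ?thesis
        by (simp add: mult.assoc)
    qed
    have mem_code: "(g V + \<gamma>, l V) \<in> code N r y \<longleftrightarrow> a V \<bullet> (y - p) \<le> s V - a V \<bullet> intl \<gamma>"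
      if V: "V \<in> f" and \<gamma>: "\<gamma> \<in> G" and y: "y \<in> F" "dist y p < \<eta>" for V \<gamma> y
    proof -
      have intl_add: "intl (g V + \<gamma>) = intl (g V) + intl \<gamma>"
        using linear_intl by (simp add: linear_add)
      have "N (phys (g V + \<gamma>)) \<le> N (phys (g V)) + N (phys \<gamma>)"
        using N phys_in linear_phys unfolding norm_on_def by (simp add: linear_add)
      also have "\<dots> \<le> r"
        using r0(2)[OF V] r G(2)[OF \<gamma>] by linarith
      finally have "(g V + \<gamma>, l V) \<in> code N r y \<longleftrightarrow> y + intl (g V + \<gamma>) \<in> Wl (l V)"
        unfolding code_def using g(1)[OF V] G(1)[OF \<gamma>] l[OF V] by (simp add: lattice_add)
      also have "\<dots> \<longleftrightarrow> a V \<bullet> (y + intl (g V + \<gamma>)) \<le> a V \<bullet> w V"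
      proof (rule half[OF V])
        show "y + intl (g V + \<gamma>) \<in> F"
          using y(1) intl_in subspace_internal by (simp add: subspace_add)
        have eq: "y + intl (g V + \<gamma>) - w V = (y - p) - (w V - p - intl (g V)) + intl \<gamma>"
          unfolding intl_add by simp
        have "norm (y + intl (g V + \<gamma>) - w V) \<le> norm (y - p) + norm (w V - p - intl (g V)) + norm (intl \<gamma>)"
          using norm_triangle_ineq[of "(y - p) - (w V - p - intl (g V))" "intl \<gamma>"]
            norm_triangle_ineq4[of "y - p" "w V - p - intl (g V)"] unfolding eq by linarith
        then show "dist (y + intl (g V + \<gamma>)) (w V) < e V"
          using y(2) g(2)[OF V] G(3)[OF \<gamma>] \<eta>e[OF V] \<rho>(2) unfolding dist_norm by linarith
      qed
      also have "\<dots> \<longleftrightarrow> a V \<bullet> (y - p) \<le> s V - a V \<bullet> intl \<gamma>"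
        unfolding s_def intl_add by (auto simp: inner_add_right inner_diff_right)
      finally show ?thesis .
    qed
    \<comment> \<open>One point per box of the grid: in each direction it lies directly below the
      wall \<open>\<tau> V\<close>, with no wall in between.\<close>
    have "\<forall>\<tau>\<in>PiE f T. \<exists>x. x \<in> ?Y \<and> dist x p < \<eta> \<and>
        (\<forall>V\<in>f. a V \<bullet> (x - p) < \<tau> V \<and> (\<forall>t\<in>T V. t < \<tau> V \<longrightarrow> t < a V \<bullet> (x - p)))"
    proof
      fix \<tau> assume \<tau>: "\<tau> \<in> PiE f T"
      \<comment> \<open>The wall preceding \<open>\<tau> V\<close>, or \<open>- \<delta>\<close> if
        there is none, which keeps the box near \<open>p\<close>.\<close>
      define pr where "pr = (\<lambda>V. Max (insert (- \<delta>) {t \<in> T V. t < \<tau> V}))"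
      have fin_pr: "finite (insert (- \<delta>) {t \<in> T V. t < \<tau> V})" for V
        using finT by simp
      have \<tau>_bd: "\<bar>\<tau> V\<bar> < \<delta>" if "V \<in> f" for V
        using T_bd[OF that] \<tau> that by blast
      have pr_less: "pr V < \<tau> V" if "V \<in> f" for V
        unfolding pr_def using fin_pr \<tau>_bd[OF that] by (subst Max_less_iff) auto
      have pr_ge: "- \<delta> \<le> pr V" "\<And>t. t \<in> T V \<Longrightarrow> t < \<tau> V \<Longrightarrow> t \<le> pr V" for V
        unfolding pr_def using fin_pr[of V] by (auto intro!: Max_ge)
      \<comment> \<open>Midpoint values in every direction. The inverse of \<open>a\<close> appears
        because the interpolation is indexed by normals and the grid by directions.\<close>
      obtain x0 where x0: "x0 \<in> F" "\<forall>b\<in>a ` f. b \<bullet> x0 = (pr (the_inv_into f a b) + \<tau> (the_inv_into f a b)) / 2"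
        using separating_interpolation[OF subspace_internal finite_imageI[OF finf] aF card_af sep,
          of "\<lambda>b. (pr (the_inv_into f a b) + \<tau> (the_inv_into f a b)) / 2"] by blast
      have ax0: "a V \<bullet> x0 = (pr V + \<tau> V) / 2" if "V \<in> f" for V
        using x0(2) that the_inv_into_f_f[OF inj_a that] by simp
      have between: "pr V < a V \<bullet> x0" "a V \<bullet> x0 < \<tau> V" if "V \<in> f" for V
        using ax0[OF that] pr_less[OF that] by simp_all
      have "norm x0 < \<eta>"
      proof (rule small[OF x0(1)], rule ballI)
        fix V assume V: "V \<in> f"
        show "\<bar>a V \<bullet> x0\<bar> \<le> \<delta>"
          using between[OF V] pr_ge(1)[of V] \<tau>_bd[OF V] by linarith
      qed
      define U where "U = ball p \<eta> \<inter> (\<Inter>V\<in>f. {x. pr V < a V \<bullet> (x - p)} \<inter> {x. a V \<bullet> (x - p) < \<tau> V})"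
      have "open U"
        unfolding U_def using finf
        by (intro open_Int open_ball open_INT ballI open_Collect_less continuous_intros)
      moreover have "p + x0 \<in> U"
        unfolding U_def using \<open>norm x0 < \<eta>\<close> between by (auto simp: dist_norm)
      moreover have "p + x0 \<in> F"
        using p(2) x0(1) subspace_internal by (simp add: subspace_add)
      ultimately obtain \<gamma> where \<gamma>: "\<gamma> \<in> \<Gamma>" "intl \<gamma> \<in> U"
        using lattice_dense by blast
      have "dist (intl \<gamma>) p < \<eta>"
        using \<gamma>(2) unfolding U_def by (simp add: dist_commute)
      moreover have "intl \<gamma> \<in> ?Y"
        using near_W[OF intl_in calculation] \<gamma>(1) by blast
      moreover have "a V \<bullet> (intl \<gamma> - p) < \<tau> V \<and> (\<forall>t\<in>T V. t < \<tau> V \<longrightarrow> t < a V \<bullet> (intl \<gamma> - p))"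
        if "V \<in> f" for V
      proof -
        have "pr V < a V \<bullet> (intl \<gamma> - p)" "a V \<bullet> (intl \<gamma> - p) < \<tau> V"
          using \<gamma>(2) that unfolding U_def by auto
        then show ?thesis
          using pr_ge(2) by (meson le_less_trans)
      qed
      ultimately show "\<exists>x. x \<in> ?Y \<and> dist x p < \<eta> \<and>
        (\<forall>V\<in>f. a V \<bullet> (x - p) < \<tau> V \<and> (\<forall>t\<in>T V. t < \<tau> V \<longrightarrow> t < a V \<bullet> (x - p)))"
        by blast
    qed
    from bchoice[OF this] obtain x where x: "\<forall>\<tau>\<in>PiE f T. x \<tau> \<in> ?Y \<and> dist (x \<tau>) p < \<eta> \<and>
        (\<forall>V\<in>f. a V \<bullet> (x \<tau> - p) < \<tau> V \<and> (\<forall>t\<in>T V. t < \<tau> V \<longrightarrow> t < a V \<bullet> (x \<tau> - p)))"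
      by blast
    \<comment> \<open>The code of \<open>x \<tau>\<close> records that this point is below the wall
      \<open>\<tau> V\<close>. If that wall came strictly before \<open>\<tau>' V\<close>, then
      \<open>x \<tau>'\<close> would lie above it and have a different code.\<close>
    have le: "\<tau>' V \<le> \<tau> V"
      if \<tau>: "\<tau> \<in> PiE f T" "\<tau>' \<in> PiE f T" "code N r (x \<tau>) = code N r (x \<tau>')" and V: "V \<in> f" for \<tau> \<tau>' V
    proof -
      have \<tau>V: "\<tau> V \<in> T V"
        using \<tau>(1) V by blast
      then obtain \<gamma> where \<gamma>: "\<gamma> \<in> G" "\<tau> V = s V - a V \<bullet> intl \<gamma>"
        unfolding T_def by blast
      have xF: "x \<tau> \<in> F" "x \<tau>' \<in> F"
        using x \<tau> window_subset by blast+
      have "a V \<bullet> (x \<tau> - p) \<le> \<tau> V"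
        using x \<tau>(1) V by (auto simp: less_imp_le)
      then have "(g V + \<gamma>, l V) \<in> code N r (x \<tau>')"
        using mem_code[OF V \<gamma>(1) xF(1)] x \<tau> unfolding \<gamma>(2) by blast
      then have "a V \<bullet> (x \<tau>' - p) \<le> \<tau> V"
        using mem_code[OF V \<gamma>(1) xF(2)] x \<tau>(2) unfolding \<gamma>(2) by blast
      then show ?thesis
        using x \<tau>(2) V \<tau>V by (meson not_le)
    qed
    have "inj_on (\<lambda>\<tau>. code N r (x \<tau>)) (PiE f T)"
    proof (rule inj_onI)
      fix \<tau> \<tau>' assume \<tau>: "\<tau> \<in> PiE f T" "\<tau>' \<in> PiE f T" "code N r (x \<tau>) = code N r (x \<tau>')"
      show "\<tau> = \<tau>'"
        using \<tau>(1,2) le[OF \<tau>] le[OF \<tau>(2,1) \<tau>(3)[symmetric]] by (intro PiE_ext) (auto intro: antisym)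
    qed
    moreover have "(\<lambda>\<tau>. code N r (x \<tau>)) ` PiE f T \<subseteq> code N r ` ?Y"
      using x by blast
    ultimately have le_codes: "card (PiE f T) \<le> card (code N r ` ?Y)"
      using fin by (rule card_inj_on_le)
    have "real_of_int (flag_exponent E F \<Gamma> f) = (\<Sum>V\<in>f. \<alpha> V)"
      unfolding \<alpha>_def flag_exponent_def by simp
    then have "\<kappa> * r powr real_of_int (flag_exponent E F \<Gamma> f)
        = (\<Prod>V\<in>f. k V * (1 / (2 * A)) powr \<alpha> V * r powr \<alpha> V)"
      unfolding \<kappa>_def using r r0(1) A(1) finf by (simp add: prod.distrib powr_sum)
    also have "\<dots> \<le> (\<Prod>V\<in>f. real (card (T V)))"
      using cardT k by (intro prod_mono) (auto simp: less_imp_le)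
    also have "\<dots> = real (card (PiE f T))"
      using finf by (simp add: card_PiE)
    also have "\<dots> \<le> real (card (code N r ` ?Y))"
      using le_codes by (rule of_nat_mono)
    finally show ?thesis .
  qed
  ultimately show ?thesis
    by blast
qed

section \<open>Existence of the maximal exponent and the growth rate\<close>

lemma hyperplane_exponent_bounded:
  assumes "subspace V"
  shows "\<bar>hyperplane_exponent E F \<Gamma> V\<bar> \<le> 2 * int DIM('a)"
proof -
  obtain B where "finite B" "independent B" "stabiliser E F \<Gamma> V = int_module.span B"
    "card B = free_rank (stabiliser E F \<Gamma> V)"
    using assms by (rule stabiliser_basis)
  then have "free_rank (stabiliser E F \<Gamma> V) \<le> DIM('a)"
    using independent_bound by metis
  moreover have "dim E \<le> DIM('a)" "beta E F \<Gamma> V \<le> DIM('a)"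
    unfolding beta_def by (rule dim_subset_UNIV)+
  ultimately show ?thesis
    unfolding hyperplane_exponent_def by linarith
qed

text \<open>\<open>Max\<close> is meaningful only for a finite set of values. The exponents are
  integers in a bounded range, which gives finiteness without counting supporting
  hyperplanes.\<close>

lemma finite_flag_exponents: "finite (flag_exponent E F \<Gamma> ` flags F I Wl)"
proof (rule finite_subset)
  let ?m = "int (dim F) * (2 * int DIM('a))"
  show "flag_exponent E F \<Gamma> ` flags F I Wl \<subseteq> {- ?m..?m}"
  proof (rule image_subsetI)
    fix f assume f: "f \<in> flags F I Wl"
    have "\<bar>hyperplane_exponent E F \<Gamma> V\<bar> \<le> 2 * int DIM('a)" if "V \<in> f" for V
    proof (rule hyperplane_exponent_bounded)
      have "V \<in> directions F I Wl"
        using f that unfolding flags_def by blast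
      then show "subspace V"
        using subspace_internal by (subst normal(3)) (auto simp: subspace_def inner_add_right)
    qed
    then have "(\<Sum>V\<in>f. \<bar>hyperplane_exponent E F \<Gamma> V\<bar>) \<le> int (card f) * (2 * int DIM('a))"
      by (intro sum_bounded_above)
    also have "card f = dim F"
      using f unfolding flags_def by blast
    finally have "\<bar>flag_exponent E F \<Gamma> f\<bar> \<le> ?m"
      unfolding flag_exponent_def by (rule order_trans[OF sum_abs])
    then show "flag_exponent E F \<Gamma> f \<in> {- ?m..?m}"
      by auto
  qed
qed simp

lemma flag_normals_imp_flag:
  assumes D: "finite D" "\<forall>a\<in>D. {x \<in> F. a \<bullet> x = 0} \<in> directions F I Wl" "inj_on (\<lambda>a. {x \<in> F. a \<bullet> x = 0}) D"
    and J: "J \<in> flag_normals F D"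
  shows "(\<lambda>a. {x \<in> F. a \<bullet> x = 0}) ` J \<in> flags F I Wl"
proof -
  have J: "J \<subseteq> D" "card J = dim F" "\<forall>u\<in>F. (\<forall>a\<in>J. a \<bullet> u = 0) \<longrightarrow> u = 0"
    using J unfolding flag_normals_def by auto
  \<comment> \<open>The intersection of an empty family would be \<open>UNIV\<close>;
    \<open>dim F \<ge> 1\<close> excludes this.\<close>
  have "J \<noteq> {}"
    using J(2) dim_internal by (metis card.empty not_one_le_zero)
  then have "\<Inter>((\<lambda>a. {x \<in> F. a \<bullet> x = 0}) ` J) = {0}"
    using J(3) subspace_0[OF subspace_internal] by auto
  moreover have "card ((\<lambda>a. {x \<in> F. a \<bullet> x = 0}) ` J) = dim F"
    using J(2) inj_on_subset[OF D(3) J(1)] by (simp add: card_image)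
  ultimately show ?thesis
    using D(2) J(1) unfolding flags_def by blast
qed

end

theorem theorem2p6:
  fixes E F \<Gamma> W :: "'a::euclidean_space set"
    and I :: "'l set" and Wl :: "'l \<Rightarrow> 'a set" and N :: "'a \<Rightarrow> real"
  assumes "polytopal_scheme E F \<Gamma> W I Wl"
    and "norm_on E N"
  shows "(\<lambda>r. real (complexity E F \<Gamma> W I Wl N r)) \<asymp>
         (\<lambda>r. r powr real_of_int (complexity_exponent E F \<Gamma> I Wl))"
proof -
  interpret polytopal_scheme E F \<Gamma> W I Wl by fact
  let ?codes = "\<lambda>r. code N r ` (intl ` \<Gamma> \<inter> W)"
  let ?V = "\<lambda>a. {x \<in> F. a \<bullet> x = 0}"
  let ?\<alpha> = "real_of_int (complexity_exponent E F \<Gamma> I Wl)"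
  obtain D Q where D: "finite D" "D \<subseteq> F" "0 \<notin> D" "\<forall>a\<in>D. ?V a \<in> directions F I Wl" "inj_on ?V D"
    "\<forall>a\<in>D. finite (Q a)"
    "\<forall>i\<in>I. \<forall>x\<in>top_of_set F frontier_of Wl i. \<exists>a\<in>D. a \<bullet> x \<in> Q a"
    by (rule arrangement)
  obtain C where C: "C > 0" "\<forall>r\<ge>1. finite (?codes r) \<and> real (card (?codes r))
      \<le> C * (\<Sum>J\<in>flag_normals F D. r powr real_of_int (flag_exponent E F \<Gamma> (?V ` J)))"
    using codes_upper[OF assms(2) D(1-3,5-7)] by meson
  have J_flag: "?V ` J \<in> flags F I Wl" if "J \<in> flag_normals F D" for J
    using flag_normals_imp_flag[OF D(1,4,5) that] .
  have exponent_le: "flag_exponent E F \<Gamma> f \<le> complexity_exponent E F \<Gamma> I Wl" if "f \<in> flags F I Wl" for f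
    unfolding complexity_exponent_def using finite_flag_exponents that by (intro Max_ge) auto
  \<comment> \<open>Without flags the upper bound would be an empty sum, so there would be no codes
    for \<open>r = 1\<close> and no internal lattice point in the window, against density.\<close>
  have "flags F I Wl \<noteq> {}"
  proof
    assume "flags F I Wl = {}"
    then have "flag_normals F D = {}"
      using J_flag by blast
    then have "card (?codes 1) = 0" "finite (?codes 1)"
      using C(2) by auto
    then have empty: "intl ` \<Gamma> \<inter> W = {}"
      by simp
    obtain i x e where "i \<in> I" "x \<in> F" "e > 0" "ball x e \<inter> F \<subseteq> Wl i"
      by (rule window_interior)
    moreover then obtain \<gamma> where "\<gamma> \<in> \<Gamma>" "intl \<gamma> \<in> ball x e"
      using lattice_dense[OF open_ball] by (metis centre_in_ball)
    ultimately show False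
      using empty intl_in label_subset by blast
  qed
  then have "complexity_exponent E F \<Gamma> I Wl \<in> flag_exponent E F \<Gamma> ` flags F I Wl"
    unfolding complexity_exponent_def using finite_flag_exponents by (intro Max_in) auto
  then obtain f where f: "f \<in> flags F I Wl" "flag_exponent E F \<Gamma> f = complexity_exponent E F \<Gamma> I Wl"
    by auto
  \<comment> \<open>The finiteness assumed in this lower bound is supplied by the upper
    bound.\<close>
  obtain c r0 where c: "c > 0" "\<forall>r\<ge>r0. finite (?codes r) \<longrightarrow> c * r powr ?\<alpha> \<le> real (card (?codes r))"
    using codes_lower[OF assms(2) f(1)] unfolding f(2) by meson
  define C' where "C' = C * (real (card (flag_normals F D)) + 1)"
  have "C' > 0"
    unfolding C'_def using C(1) by (intro mult_pos_pos) auto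
  moreover have "\<forall>\<^sub>F r in at_top. c * r powr ?\<alpha> \<le> real (complexity E F \<Gamma> W I Wl N r) \<and>
      real (complexity E F \<Gamma> W I Wl N r) \<le> C' * r powr ?\<alpha>"
    unfolding complexity_eq_card_codes
  proof (rule eventually_at_top_linorderI[of "max 1 r0"])
    fix r :: real assume "max 1 r0 \<le> r"
    then have r: "r \<ge> 1" "r \<ge> r0" by auto
    \<comment> \<open>For \<open>r \<ge> 1\<close> each summand is at most the maximal power, and
      the number of summands does not depend on \<open>r\<close>.\<close>
    have "(\<Sum>J\<in>flag_normals F D. r powr real_of_int (flag_exponent E F \<Gamma> (?V ` J)))
        \<le> real (card (flag_normals F D)) * r powr ?\<alpha>"
      using r(1) exponent_le J_flag by (intro sum_bounded_above powr_mono) auto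
    also have "\<dots> \<le> (real (card (flag_normals F D)) + 1) * r powr ?\<alpha>"
      by (intro mult_right_mono) auto
    finally have "C * (\<Sum>J\<in>flag_normals F D. r powr real_of_int (flag_exponent E F \<Gamma> (?V ` J))) \<le> C' * r powr ?\<alpha>"
      unfolding C'_def using C(1) by simp
    then show "c * r powr ?\<alpha> \<le> real (card (?codes r)) \<and> real (card (?codes r)) \<le> C' * r powr ?\<alpha>"
      using C(2) c(2) r by fastforce
  qed
  ultimately show ?thesis
    unfolding same_growth_def using c(1) by blast
qed

end
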